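(* Let $X = Y\cup_{\gamma}e^n$ be a $1$-connected $n$-dimensional CW-complex, obtained as the mapping cone of a map $\gamma\colon S^{n-1}\to Y$, with associated map $q\colon X\to S^n$. Suppose that $q_\# = 0 \colon \pi_{n}(X) \to \pi_{n}(S^n)$. Then the assignment $\Theta(\alpha) = \iota^{\alpha}$ for $\alpha \in G_n(X)$ defines a homomorphism $$\Theta \colon G_n(X) \to \mathcal{E}_{\#}(X).$$ This homomorphism restricts to a homomorphism $$\Theta' \colon G_n(X)\cap \mathrm{ker}\,h_n \to \mathcal{E}_{*}(X)\cap\mathcal{E}_{\#}(X),$$ where $h_n \colon \pi_n(X) \to H_n(X)$ denotes the Hurewicz homomorphism.
   Context: A space is a connected CW-complex of finite type; maps and homotopies are based, and a map is not distinguished from its homotopy class. $\iota\colon X\to X$ is the identity map. The mapping cone sequence is $S^{n-1}\xrightarrow{\gamma} Y\xrightarrow{j} X\xrightarrow{q}\Sigma S^{n-1}\equiv S^n$. Pinching the equator of the cone gives a coaction $c\colon X\to X\vee S^n$. For $f\in[X,W]$ and $\alpha\in\pi_n(W)$, $f^\alpha\in[X,W]$ is the composition $X\xrightarrow{c}X\vee S^n\xrightarrow{f\vee\alpha}W\vee W\xrightarrow{\nabla}W$, where $\nabla$ is the folding map; $\iota^\alpha\in[X,X]$ is the case $f=\iota$, $W=X$. The $n$-th Gottlieb group $G_n(X)\subseteq\pi_n(X)$ consists of those $\alpha\in\pi_n(X)$ for which there is a map $a\colon X\times S^n\to X$ whose restriction to $X\vee S^n$ is $(\iota,\alpha)\colon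 X\vee S^n\to X$. $\mathcal{E}(X)$ is the group (under composition) of homotopy classes of self-homotopy equivalences of $X$. For $X$ of dimension $N$, $\mathcal{E}_{\#}(X)=\{f\in\mathcal{E}(X)\mid f_\#=1\colon\pi_i(X)\to\pi_i(X)\text{ for all } i\le N\}$. Also $\mathcal{E}_*(X)=\{f\in\mathcal{E}(X)\mid f_*=1\colon H_i(X)\to H_i(X)\text{ for all } i\}$ (integral homology). $0$ denotes the trivial homomorphism. *)

theory Defs
  imports "HOL-Homology.Homology"
begin

section \<open>Quotients, disjoint sums and wedges\<close>

text \<open>The final topology on the image of a map; \<open>f\<close> becomes a quotient map onto it.
  Quotients below are taken along a map sending each point to a chosen
  representative of its equivalence class.\<close>

definition quotient_topology :: "'a topology \<Rightarrow> ('a \<Rightarrow> 'b) \<Rightarrow> 'b topology" where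
  "quotient_topology T f =
     topology (\<lambda>U. U \<subseteq> f ` topspace T \<and> openin T {x \<in> topspace T. f x \<in> U})"

lemma openin_quotient_topology:
  "openin (quotient_topology T f) U \<longleftrightarrow>
     U \<subseteq> f ` topspace T \<and> openin T {x \<in> topspace T. f x \<in> U}"
proof -
  have "istopology (\<lambda>U. U \<subseteq> f ` topspace T \<and> openin T {x \<in> topspace T. f x \<in> U})"
    unfolding istopology_def
  proof (intro conjI allI impI)
    fix U V
    assume "U \<subseteq> f ` topspace T \<and> openin T {x \<in> topspace T. f x \<in> U}"
      and "V \<subseteq> f ` topspace T \<and> openin T {x \<in> topspace T. f x \<in> V}"
    moreover have "{x \<in> topspace T. f x \<in> U \<inter> V}
        = {x \<in> topspace T. f x \<in> U} \<inter> {x \<in> topspace T. f x \<in> V}"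
      by auto
    ultimately show "U \<inter> V \<subseteq> f ` topspace T" "openin T {x \<in> topspace T. f x \<in> U \<inter> V}"
      by (auto simp only: openin_Int)
  next
    fix K
    assume K: "\<forall>U\<in>K. U \<subseteq> f ` topspace T \<and> openin T {x \<in> topspace T. f x \<in> U}"
    then show "\<Union>K \<subseteq> f ` topspace T"
      by auto
    have "{x \<in> topspace T. f x \<in> \<Union>K} = (\<Union>U\<in>K. {x \<in> topspace T. f x \<in> U})"
      by auto
    with K show "openin T {x \<in> topspace T. f x \<in> \<Union>K}"
      by auto
  qed
  then show ?thesis
    by (simp add: quotient_topology_def)
qed

lemma topspace_quotient_topology [simp]:
  "topspace (quotient_topology T f) = f ` topspace T"
proof -
  have "{x \<in> topspace T. f x \<in> f ` topspace T} = topspace T"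
    by auto
  then have "openin (quotient_topology T f) (f ` topspace T)"
    by (simp add: openin_quotient_topology)
  then show ?thesis
    by (meson openin_quotient_topology openin_subset openin_topspace subset_antisym)
qed

lemma quotient_map_quotient_topology: "quotient_map T (quotient_topology T f) f"
  by (auto simp: quotient_map_def openin_quotient_topology)

definition disjoint_sum :: "'a topology \<Rightarrow> 'b topology \<Rightarrow> ('a + 'b) topology" where
  "disjoint_sum X Y = topology (\<lambda>U. openin X (Inl -` U) \<and> openin Y (Inr -` U))"

lemma openin_disjoint_sum:
  "openin (disjoint_sum X Y) U \<longleftrightarrow> openin X (Inl -` U) \<and> openin Y (Inr -` U)"
proof -
  have "istopology (\<lambda>U. openin X (Inl -` U) \<and> openin Y (Inr -` U))"
    unfolding istopology_def by (auto simp: vimage_Union)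
  then show ?thesis
    by (simp add: disjoint_sum_def)
qed

lemma topspace_disjoint_sum [simp]:
  "topspace (disjoint_sum X Y) = Inl ` topspace X \<union> Inr ` topspace Y" (is "_ = ?R")
proof
  show "topspace (disjoint_sum X Y) \<subseteq> ?R"
  proof
    fix z assume "z \<in> topspace (disjoint_sum X Y)"
    moreover have "openin (disjoint_sum X Y) (topspace (disjoint_sum X Y))"
      by simp
    ultimately show "z \<in> ?R"
      by (cases z) (auto simp only: openin_disjoint_sum vimage_eq dest!: openin_subset)
  qed
  have "Inl -` ?R = topspace X" "Inr -` ?R = topspace Y"
    by auto
  then have "openin (disjoint_sum X Y) ?R"
    by (simp only: openin_disjoint_sum openin_topspace)
  then show "?R \<subseteq> topspace (disjoint_sum X Y)"
    by (rule openin_subset)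
qed

text \<open>The wedge point of \<open>X \<or> Z\<close> is represented by \<open>Inl x0\<close>.\<close>

fun wedge_rep :: "'a \<Rightarrow> 'b \<Rightarrow> 'a + 'b \<Rightarrow> 'a + 'b" where
  "wedge_rep x0 z0 (Inl x) = Inl x"
| "wedge_rep x0 z0 (Inr z) = (if z = z0 then Inl x0 else Inr z)"

definition wedge :: "'a topology \<Rightarrow> 'a \<Rightarrow> 'b topology \<Rightarrow> 'b \<Rightarrow> ('a + 'b) topology" where
  "wedge X x0 Z z0 = quotient_topology (disjoint_sum X Z) (wedge_rep x0 z0)"

text \<open>\<open>f \<or> g\<close> into \<open>V \<or> W\<close>, the folding map \<open>W \<or> W \<rightarrow> W\<close>,
  and the inclusion \<open>X \<or> Z \<rightarrow> X \<times> Z\<close>.\<close>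

definition wedge_map :: "'v \<Rightarrow> 'w \<Rightarrow> ('a \<Rightarrow> 'v) \<Rightarrow> ('b \<Rightarrow> 'w) \<Rightarrow> 'a + 'b \<Rightarrow> 'v + 'w" where
  "wedge_map v0 w0 f g = wedge_rep v0 w0 \<circ> map_sum f g"

definition folding :: "'w + 'w \<Rightarrow> 'w" where
  "folding = case_sum id id"

definition wedge_incl :: "'a \<Rightarrow> 'b \<Rightarrow> 'a + 'b \<Rightarrow> 'a \<times> 'b" where
  "wedge_incl x0 z0 = case_sum (\<lambda>x. (x, z0)) (\<lambda>z. (x0, z))"


section \<open>Based homotopy classes\<close>

definition homotopy_class ::
  "'a topology \<Rightarrow> 'a \<Rightarrow> 'b topology \<Rightarrow> 'b \<Rightarrow> ('a \<Rightarrow> 'b) \<Rightarrow> ('a \<Rightarrow> 'b) set" where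
  "homotopy_class X x0 W w0 f = {g. homotopic_with (\<lambda>h. h x0 = w0) X W f g}"

definition homotopy_classes ::
  "'a topology \<Rightarrow> 'a \<Rightarrow> 'b topology \<Rightarrow> 'b \<Rightarrow> ('a \<Rightarrow> 'b) set set" where
  "homotopy_classes X x0 W w0 =
     {homotopy_class X x0 W w0 f | f. continuous_map X W f \<and> f x0 = w0}"

text \<open>Composition of \<open>A \<in> [X,V]\<close> with \<open>F \<in> [V,W]\<close>. Here, as for the other operations on
  classes below, a union over all representatives is taken; it is a single class
  because the operation respects based homotopy.\<close>

definition class_comp ::
  "'a topology \<Rightarrow> 'a \<Rightarrow> 'w topology \<Rightarrow> 'w \<Rightarrow> ('v \<Rightarrow> 'w) set \<Rightarrow> ('a \<Rightarrow> 'v) set \<Rightarrow> ('a \<Rightarrow> 'w) set" where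
  "class_comp X x0 W w0 F A = (\<Union>f\<in>F. \<Union>a\<in>A. homotopy_class X x0 W w0 (f \<circ> a))"


section \<open>Spheres, suspension coordinates and homotopy groups\<close>

definition sphere_base :: "nat \<Rightarrow> real" where
  "sphere_base = (\<lambda>i. if i = 0 then 1 else 0)"

text \<open>The identification \<open>\<Sigma>S\<^sup>n\<^sup>-\<^sup>1 \<equiv> S\<^sup>n\<close> for \<open>n \<ge> 1\<close>. With \<open>e = sphere_base\<close>, the loop
  \<open>t \<mapsto> sphere_susp n (s, t)\<close> traverses once, starting at \<open>e\<close>, the circle with diameter
  \<open>[e, s]\<close> in the plane through \<open>e\<close> and \<open>s\<close> parallel to the \<open>n\<close>-th coordinate axis
  (note \<open>\<bar>e - s\<bar>\<^sup>2 = 2 - 2 * s 0\<close>). The map collapses exactly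
  \<open>S\<^sup>n\<^sup>-\<^sup>1 \<times> {0, 1} \<union> {e} \<times> [0, 1]\<close>, to \<open>e\<close>, and is injective elsewhere.\<close>

definition sphere_susp :: "nat \<Rightarrow> (nat \<Rightarrow> real) \<times> real \<Rightarrow> (nat \<Rightarrow> real)" where
  "sphere_susp n = (\<lambda>(s, t) i.
     (sphere_base i + s i) / 2 + cos (2 * pi * t) * (sphere_base i - s i) / 2
     + (if i = n then sin (2 * pi * t) * sqrt (2 - 2 * s 0) / 2 else 0))"

abbreviation cylinder :: "nat \<Rightarrow> ((nat \<Rightarrow> real) \<times> real) topology" where
  "cylinder n \<equiv> prod_topology (nsphere (n - 1)) (top_of_set {0..1})"

text \<open>Sum of two based maps on \<open>S\<^sup>n\<close> via the suspension coordinate; the value does not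
  depend on the preimage under \<open>sphere_susp\<close> picked by \<open>inv_into\<close>.\<close>

definition sphere_add ::
  "nat \<Rightarrow> ((nat \<Rightarrow> real) \<Rightarrow> 'a) \<Rightarrow> ((nat \<Rightarrow> real) \<Rightarrow> 'a) \<Rightarrow> (nat \<Rightarrow> real) \<Rightarrow> 'a" where
  "sphere_add n f g x =
     (let (s, t) = inv_into (topspace (cylinder n)) (sphere_susp n) x in
      if t \<le> 1/2 then f (sphere_susp n (s, 2 * t)) else g (sphere_susp n (s, 2 * t - 1)))"

text \<open>The multiplication is meaningful for \<open>n \<ge> 1\<close> only; for \<open>n = 0\<close> just the carrier
  (the pointed set \<open>\<pi>\<^sub>0\<close>) is used.\<close>

definition homotopy_group ::
  "nat \<Rightarrow> 'a topology \<Rightarrow> 'a \<Rightarrow> ((nat \<Rightarrow> real) \<Rightarrow> 'a) set monoid" where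
  "homotopy_group n X x0 =
     \<lparr>carrier = homotopy_classes (nsphere n) sphere_base X x0,
      mult = (\<lambda>A B. \<Union>a\<in>A. \<Union>b\<in>B.
                homotopy_class (nsphere n) sphere_base X x0 (sphere_add n a b)),
      one = homotopy_class (nsphere n) sphere_base X x0 (\<lambda>_. x0)\<rparr>"

text \<open>\<open>F\<^sub>#\<close> on \<open>\<pi>\<^sub>i\<close> for a class \<open>F\<close> of based maps into \<open>(W, w0)\<close>.\<close>

abbreviation homotopy_induced ::
  "nat \<Rightarrow> 'w topology \<Rightarrow> 'w \<Rightarrow> ('v \<Rightarrow> 'w) set
    \<Rightarrow> ((nat \<Rightarrow> real) \<Rightarrow> 'v) set \<Rightarrow> ((nat \<Rightarrow> real) \<Rightarrow> 'w) set" where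
  "homotopy_induced i W w0 F \<equiv> class_comp (nsphere i) sphere_base W w0 F"

definition one_connected :: "'a topology \<Rightarrow> 'a \<Rightarrow> bool" where
  "one_connected X x0 \<longleftrightarrow>
     path_connected_space X \<and>
     carrier (homotopy_group 1 X x0) = {\<one>\<^bsub>homotopy_group 1 X x0\<^esub>}"

text \<open>\<open>H\<^sub>n(S\<^sup>n)\<close> is infinite cyclic for \<open>n \<ge> 1\<close>; the choice of generator changes the Hurewicz
  homomorphism by a sign at most.\<close>

definition fundamental_class :: "nat \<Rightarrow> (nat \<Rightarrow> real) chain set" where
  "fundamental_class n =
     (SOME z. z \<in> carrier (homology_group (int n) (nsphere n)) \<and>
              generate (homology_group (int n) (nsphere n)) {z}
                = carrier (homology_group (int n) (nsphere n)))"

definition hurewicz :: "nat \<Rightarrow> 'a topology \<Rightarrow> ((nat \<Rightarrow> real) \<Rightarrow> 'a) set \<Rightarrow> 'a chain set" where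
  "hurewicz n X A =
     the_elem ((\<lambda>a. hom_induced (int n) (nsphere n) {} X {} a (fundamental_class n)) ` A)"


section \<open>CW-complexes\<close>

definition disk :: "nat \<Rightarrow> (nat \<Rightarrow> real) topology" where
  "disk k = subtopology (Euclidean_space k) {x. (\<Sum>i<k. x i ^ 2) \<le> 1}"

definition open_disk :: "nat \<Rightarrow> (nat \<Rightarrow> real) set" where
  "open_disk k = {x \<in> topspace (disk k). (\<Sum>i<k. x i ^ 2) < 1}"

text \<open>\<open>C k\<close> is the set of characteristic maps of the \<open>k\<close>-cells. The clauses say: the
  open cells are embedded open disks that partition \<open>X\<close>; the boundary of a cell meets
  only finitely many cells, all of lower dimension; \<open>X\<close> has the weak topology.\<close>

definition CW_structure :: "'a topology \<Rightarrow> (nat \<Rightarrow> ((nat \<Rightarrow> real) \<Rightarrow> 'a) set) \<Rightarrow> bool" where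
  "CW_structure X C \<longleftrightarrow>
     Hausdorff_space X \<and>
     (\<forall>k. \<forall>\<phi>\<in>C k. continuous_map (disk k) X \<phi> \<and>
                   embedding_map (subtopology (disk k) (open_disk k)) X \<phi>) \<and>
     (\<forall>k l. \<forall>\<phi>\<in>C k. \<forall>\<psi>\<in>C l.
        (k, \<phi>) \<noteq> (l, \<psi>) \<longrightarrow> \<phi> ` open_disk k \<inter> \<psi> ` open_disk l = {}) \<and>
     (\<Union>k. \<Union>\<phi>\<in>C k. \<phi> ` open_disk k) = topspace X \<and>
     (\<forall>k. \<forall>\<phi>\<in>C k. \<exists>\<F>. finite \<F> \<and> \<F> \<subseteq> (SIGMA l:{..<k}. C l) \<and>
        \<phi> ` (topspace (disk k) - open_disk k) \<subseteq> (\<Union>(l, \<psi>)\<in>\<F>. \<psi> ` open_disk l)) \<and>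
     (\<forall>A. A \<subseteq> topspace X \<and>
          (\<forall>k. \<forall>\<phi>\<in>C k. closedin (disk k) {x \<in> topspace (disk k). \<phi> x \<in> A})
          \<longrightarrow> closedin X A)"

definition finite_type_CW :: "'a topology \<Rightarrow> bool" where
  "finite_type_CW X \<longleftrightarrow>
     connected_space X \<and> (\<exists>C. CW_structure X C \<and> (\<forall>k. finite (C k)))"

definition finite_type_CW_dim :: "nat \<Rightarrow> 'a topology \<Rightarrow> bool" where
  "finite_type_CW_dim N X \<longleftrightarrow>
     connected_space X \<and>
     (\<exists>C. CW_structure X C \<and> (\<forall>k. finite (C k)) \<and> C N \<noteq> {} \<and> (\<forall>k>N. C k = {}))"


section \<open>The mapping cone and its coaction\<close>

text \<open>The reduced mapping cone of a based map \<open>\<gamma> : S\<^sup>n\<^sup>-\<^sup>1 \<rightarrow> Y\<close>, \<open>n \<ge> 1\<close>: the cone coordinate is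
  \<open>t \<in> [0, 1]\<close>, the apex \<open>t = 0\<close> and the segment over the base point are collapsed to \<open>y0\<close>,
  and \<open>(s, 1)\<close> is identified with \<open>\<gamma> s\<close>.\<close>

fun cone_rep ::
  "((nat \<Rightarrow> real) \<Rightarrow> 'a) \<Rightarrow> 'a \<Rightarrow> 'a + (nat \<Rightarrow> real) \<times> real \<Rightarrow> 'a + (nat \<Rightarrow> real) \<times> real" where
  "cone_rep \<gamma> y0 (Inl y) = Inl y"
| "cone_rep \<gamma> y0 (Inr (s, t)) =
     (if t = 0 \<or> s = sphere_base then Inl y0
      else if t = 1 then Inl (\<gamma> s) else Inr (s, t))"

definition mapping_cone ::
  "nat \<Rightarrow> 'a topology \<Rightarrow> 'a \<Rightarrow> ((nat \<Rightarrow> real) \<Rightarrow> 'a) \<Rightarrow> ('a + (nat \<Rightarrow> real) \<times> real) topology" where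
  "mapping_cone n Y y0 \<gamma> = quotient_topology (disjoint_sum Y (cylinder n)) (cone_rep \<gamma> y0)"

definition cone_pinch :: "nat \<Rightarrow> 'a + (nat \<Rightarrow> real) \<times> real \<Rightarrow> (nat \<Rightarrow> real)" where
  "cone_pinch n = case_sum (\<lambda>_. sphere_base) (sphere_susp n)"

text \<open>The coaction \<open>X \<rightarrow> X \<or> S\<^sup>n\<close>: the equator \<open>t = 1/2\<close> is pinched to the wedge point, the
  apex half of the cone becomes \<open>S\<^sup>n\<close> and the other half becomes the cone of \<open>X\<close>.\<close>

definition coaction ::
  "nat \<Rightarrow> 'a \<Rightarrow> ((nat \<Rightarrow> real) \<Rightarrow> 'a) \<Rightarrow> 'a + (nat \<Rightarrow> real) \<times> real
     \<Rightarrow> ('a + (nat \<Rightarrow> real) \<times> real) + (nat \<Rightarrow> real)" where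
  "coaction n y0 \<gamma> = case_sum (\<lambda>y. Inl (Inl y))
     (\<lambda>(s, t). if t \<le> 1/2 then wedge_rep (Inl y0) sphere_base (Inr (sphere_susp n (s, 2 * t)))
                else Inl (cone_rep \<gamma> y0 (Inr (s, 2 * t - 1))))"

definition coact_map ::
  "nat \<Rightarrow> 'a \<Rightarrow> ((nat \<Rightarrow> real) \<Rightarrow> 'a) \<Rightarrow> 'w
     \<Rightarrow> ('a + (nat \<Rightarrow> real) \<times> real \<Rightarrow> 'w) \<Rightarrow> ((nat \<Rightarrow> real) \<Rightarrow> 'w)
     \<Rightarrow> 'a + (nat \<Rightarrow> real) \<times> real \<Rightarrow> 'w" where
  "coact_map n y0 \<gamma> w0 f \<alpha> = folding \<circ> wedge_map w0 w0 f \<alpha> \<circ> coaction n y0 \<gamma>"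

text \<open>\<open>f\<^sup>\<alpha>\<close> on classes \<open>F \<in> [X,W]\<close>, \<open>A \<in> \<pi>\<^sub>n(W)\<close>, for \<open>X\<close> the mapping cone of \<open>\<gamma>\<close>.\<close>

definition coact ::
  "nat \<Rightarrow> 'a topology \<Rightarrow> 'a \<Rightarrow> ((nat \<Rightarrow> real) \<Rightarrow> 'a) \<Rightarrow> 'w topology \<Rightarrow> 'w
     \<Rightarrow> ('a + (nat \<Rightarrow> real) \<times> real \<Rightarrow> 'w) set \<Rightarrow> ((nat \<Rightarrow> real) \<Rightarrow> 'w) set
     \<Rightarrow> ('a + (nat \<Rightarrow> real) \<times> real \<Rightarrow> 'w) set" where
  "coact n Y y0 \<gamma> W w0 F A =
     (\<Union>f\<in>F. \<Union>\<alpha>\<in>A.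
        homotopy_class (mapping_cone n Y y0 \<gamma>) (Inl y0) W w0 (coact_map n y0 \<gamma> w0 f \<alpha>))"


section \<open>Gottlieb groups and groups of self-equivalences\<close>

text \<open>The restriction of \<open>a\<close> to \<open>X \<or> S\<^sup>n\<close> is \<open>(\<iota>, \<alpha>)\<close> up to based homotopy, as maps are not
  distinguished from their homotopy classes.\<close>

definition Gottlieb :: "nat \<Rightarrow> 'a topology \<Rightarrow> 'a \<Rightarrow> ((nat \<Rightarrow> real) \<Rightarrow> 'a) set set" where
  "Gottlieb n X x0 =
     {A \<in> carrier (homotopy_group n X x0). \<exists>\<alpha>\<in>A. \<exists>a.
        continuous_map (prod_topology X (nsphere n)) X a \<and>
        homotopic_with (\<lambda>h. h (Inl x0) = x0) (wedge X x0 (nsphere n) sphere_base) X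
          (a \<circ> wedge_incl x0 sphere_base) (case_sum id \<alpha>)}"

definition self_equivs :: "'a topology \<Rightarrow> 'a \<Rightarrow> ('a \<Rightarrow> 'a) set monoid" where
  "self_equivs X x0 =
     \<lparr>carrier = {F \<in> homotopy_classes X x0 X x0. \<exists>G \<in> homotopy_classes X x0 X x0.
                   class_comp X x0 X x0 F G = homotopy_class X x0 X x0 id \<and>
                   class_comp X x0 X x0 G F = homotopy_class X x0 X x0 id},
      mult = class_comp X x0 X x0,
      one = homotopy_class X x0 X x0 id\<rparr>"

text \<open>\<open>\<E>\<^sub>#(X)\<close> for \<open>X\<close> of dimension \<open>N\<close>.\<close>

definition self_equivs_sharp :: "nat \<Rightarrow> 'a topology \<Rightarrow> 'a \<Rightarrow> ('a \<Rightarrow> 'a) set set" where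
  "self_equivs_sharp N X x0 =
     {F \<in> carrier (self_equivs X x0).
        \<forall>i\<le>N. \<forall>A \<in> carrier (homotopy_group i X x0). homotopy_induced i X x0 F A = A}"

definition self_equivs_star :: "'a topology \<Rightarrow> 'a \<Rightarrow> ('a \<Rightarrow> 'a) set set" where
  "self_equivs_star X x0 =
     {F \<in> carrier (self_equivs X x0).
        \<forall>f\<in>F. \<forall>p. \<forall>c \<in> carrier (homology_group p X). hom_induced p X {} X {} f c = c}"

end

theory Submission
  imports Defs "HOL-Analysis.Weierstrass_Theorems" "HOL-Analysis.Abstract_Topological_Spaces"
begin

text \<open>For \<open>\<alpha> \<in> G\<^sub>n(X)\<close> with associated map \<open>a : X \<times> S\<^sup>n \<rightarrow> X\<close>, sliding the coaction along the
  diagonal gives \<open>\<iota>\<^sup>\<alpha> \<simeq> (x \<mapsto> a (x, q x))\<close>. If \<open>q \<circ> \<beta>\<close> is null-homotopic, then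
  \<open>\<iota>\<^sup>\<alpha> \<circ> \<beta> \<simeq> a (\<beta>, *) \<simeq> \<beta>\<close>; this applies to all \<open>\<beta> \<in> \<pi>\<^sub>i(X)\<close> with \<open>i \<le> n\<close>, by the assumption
  on \<open>q\<close> for \<open>i = n\<close> and since \<open>\<pi>\<^sub>i(S\<^sup>n) = 0\<close> for \<open>i < n\<close>. Hence
  \<open>\<iota>\<^sup>\<alpha> \<circ> \<iota>\<^sup>\<beta> = (\<iota>\<^sup>\<alpha>)\<^sup>\<beta>'\<close> with \<open>\<beta>' = \<iota>\<^sup>\<alpha> \<circ> \<beta> \<simeq> \<beta>\<close>, which is \<open>\<iota>\<^sup>\<beta>\<^sup>+\<^sup>\<alpha>\<close>, and Gottlieb elements
  commute with all of \<open>\<pi>\<^sub>n(X)\<close>; in particular \<open>\<iota>\<^sup>-\<^sup>\<alpha>\<close> is a homotopy inverse of \<open>\<iota>\<^sup>\<alpha>\<close>, without recourse to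
  Whitehead's theorem. In homology \<open>\<iota>\<^sup>\<alpha>\<close> induces \<open>1 + \<alpha>\<^sub>* q\<^sub>*\<close> in positive degrees, and \<open>\<alpha>\<^sub>* = 0\<close> on \<open>H\<^sub>n(S\<^sup>n)\<close> if
  \<open>\<alpha>\<close> lies in the kernel of the Hurewicz homomorphism.\<close>

text \<open>A coaction puts its sphere element on the apex half of the cone, so an iterated coaction
  lists its summands from the outside in; this is why composition first yields
  \<open>\<beta> + \<alpha>\<close> and the commutation of Gottlieb elements has to be proved.
  Viewing \<open>S^n\<close> as the cone of the map from \<open>S^(n-1)\<close> to a point turns the
  addition of maps on spheres into a coaction: the unit law, associativity and additivity in
  homology are each proved once and serve both \<pi>_n and the action on \<open>[X, X]\<close>. Most
  of the homotopies involved only move the cone coordinates of \<open>X\<close> and of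
  \<open>S^n\<close> independently inside a map on \<open>X \<times> S^n\<close>, so they reduce to
  convex combinations of self-maps of the interval. The obstacle to the vanishing of \<pi>_i(S^n)
  for \<open>i < n\<close> is that a continuous map may be onto; a Lipschitz approximation cannot
  be, by a count of grid points. In homology the relation carries the constant map as a fourth term,
  \<open>f^\<alpha> + const = f + \<alpha> q\<close>. It is then valid in degree 0 too, where a
  constant map does not induce 0.\<close>

declare One_nat_def [simp del]

section \<open>Spheres as suspensions\<close>

lemma topspace_nsphere:
  "topspace (nsphere n) = {x. (\<Sum>i\<le>n. x i ^ 2) = 1 \<and> (\<forall>i>n. x i = 0)}"
  by (simp add: nsphere)

lemma topspace_nsphere_pred:
  assumes "n \<ge> 1"
  shows "topspace (nsphere (n - 1)) = {s. (\<Sum>i<n. s i ^ 2) = 1 \<and> (\<forall>i\<ge>n. s i = 0)}"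
proof -
  have "{..n - 1} = {..<n}" "\<And>i. i > n - 1 \<longleftrightarrow> i \<ge> n"
    using assms by auto
  then show ?thesis
    by (simp add: topspace_nsphere)
qed

lemma sphere_base_in_nsphere [simp]: "sphere_base \<in> topspace (nsphere n)"
  unfolding sphere_base_def by (rule in_topspace_nsphere)

lemma nsphere_coordinate_le_1:
  assumes "x \<in> topspace (nsphere n)"
  shows "\<bar>x k\<bar> \<le> 1"
proof (cases "k \<le> n")
  case True
  then have "x k ^ 2 \<le> (\<Sum>i\<le>n. x i ^ 2)"
    by (intro member_le_sum) auto
  then show ?thesis
    using assms by (simp add: topspace_nsphere abs_square_le_1)
qed (use assms in \<open>simp add: topspace_nsphere\<close>)

lemma nsphere_pole:
  assumes x: "x \<in> topspace (nsphere n)" and "\<bar>x 0\<bar> = 1" "i > 0"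
  shows "x i = 0"
proof (cases "i \<le> n")
  case True
  have "(\<Sum>j\<in>{0,i}. x j ^ 2) \<le> (\<Sum>j\<le>n. x j ^ 2)"
    using True by (intro sum_mono2) auto
  then have "x 0 ^ 2 + x i ^ 2 \<le> 1"
    using x \<open>i > 0\<close> by (simp add: topspace_nsphere)
  moreover have "x 0 ^ 2 = 1"
    using \<open>\<bar>x 0\<bar> = 1\<close> by (metis one_power2 power2_abs)
  ultimately show ?thesis
    by simp
qed (use x in \<open>simp add: topspace_nsphere\<close>)

lemma nsphere_eq_base_iff:
  assumes "x \<in> topspace (nsphere n)"
  shows "x = sphere_base \<longleftrightarrow> x 0 = 1"
proof
  assume "x 0 = 1"
  then have "x i = 0" if "i > 0" for i
    using nsphere_pole[OF assms _ that] by simp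
  then show "x = sphere_base"
    using \<open>x 0 = 1\<close> by (auto simp: sphere_base_def)
qed (simp add: sphere_base_def)

lemma continuous_map_into_nsphere:
  assumes "\<And>i. continuous_map Z euclideanreal (\<lambda>z. f z i)"
    and "\<And>z. z \<in> topspace Z \<Longrightarrow> f z \<in> topspace (nsphere n)"
  shows "continuous_map Z (nsphere n) f"
  using assms
  by (auto simp: nsphere continuous_map_in_subtopology continuous_map_componentwise_UNIV)

lemma Hausdorff_nsphere [simp]: "Hausdorff_space (nsphere n)"
  by (simp add: nsphere Hausdorff_space_subtopology Hausdorff_space_product_topology)

lemma closed_nsphere: "closed (topspace (nsphere n))"
proof -
  have "topspace (nsphere n) = {x. (\<Sum>i\<le>n. x i ^ 2) = 1} \<inter> (\<Inter>i\<in>{n<..}. {x. x i = 0})"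
    by (auto simp: topspace_nsphere)
  moreover have "closed {x::nat \<Rightarrow> real. (\<Sum>i\<le>n. x i ^ 2) = 1}" "closed {x::nat \<Rightarrow> real. x i = 0}" for i
    by (intro closed_Collect_eq continuous_intros; simp add: continuous_on_product_coordinates)+
  ultimately show ?thesis
    by (auto intro!: closed_Int closed_INT)
qed

lemma nsphere_eq_top_of_set: "nsphere n = top_of_set (topspace (nsphere n))"
  by (simp add: nsphere euclidean_product_topology)

text \<open>Points have infinitely many coordinates; the cube with sides \<open>{-1..1}\<close> is
  compact by Tychonoff, and the sphere is closed in it.\<close>

lemma compact_nsphere: "compact (topspace (nsphere n))"
proof -
  have "compactin (powertop_real UNIV) (PiE UNIV (\<lambda>i. {-1..1::real}))"
    by (simp add: compactin_PiE)
  then have "compact (PiE UNIV (\<lambda>i::nat. {-1..1::real}))"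
    by (simp add: euclidean_product_topology)
  moreover have "topspace (nsphere n) \<subseteq> PiE UNIV (\<lambda>i. {-1..1::real})"
    using nsphere_coordinate_le_1 by (fastforce simp: abs_le_iff)
  ultimately show ?thesis
    using closed_nsphere by (metis compact_Int_closed inf.absorb_iff2)
qed

lemma compact_space_nsphere [simp]: "compact_space (nsphere n)"
  by (metis compact_nsphere compact_space_subtopology compactin_euclidean_iff nsphere_eq_top_of_set)

section \<open>The suspension coordinate on the sphere\<close>

lemma compact_space_cylinder: "compact_space (cylinder n)"
  by (simp add: compact_space_prod_topology compact_space_subtopology)

text \<open>\<open>sphere_base\<close> is the first basis vector, so its inner product with
  \<open>s\<close> is \<open>s 0\<close>; \<open>n \<ge> 1\<close> puts the index 0 into the
  sum.\<close>

lemma sum_square_plane: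
  assumes "n \<ge> 1"
  shows "(\<Sum>i<n. (a * sphere_base i + b * s i) ^ 2)
    = a ^ 2 + 2 * a * b * s 0 + b ^ 2 * (\<Sum>i<n. s i ^ 2)"
proof -
  have "(\<Sum>i<n. (a * sphere_base i + b * s i) ^ 2)
      = (\<Sum>i<n. (if i = 0 then a ^ 2 + 2 * a * b * s 0 else 0) + b ^ 2 * s i ^ 2)"
    by (intro sum.cong) (auto simp: sphere_base_def power2_eq_square algebra_simps)
  then show ?thesis
    using assms by (simp add: sum.distrib sum_distrib_left)
qed

lemma sphere_susp_low:
  "i \<noteq> n \<Longrightarrow> sphere_susp n (s, t) i
    = (1 + cos (2 * pi * t)) / 2 * sphere_base i + (1 - cos (2 * pi * t)) / 2 * s i"
  by (simp add: sphere_susp_def field_simps)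

lemma sphere_susp_top:
  assumes "n \<ge> 1" "s \<in> topspace (nsphere (n - 1))"
  shows "sphere_susp n (s, t) n = sin (2 * pi * t) * sqrt (2 - 2 * s 0) / 2"
  using assms by (simp add: sphere_susp_def sphere_base_def topspace_nsphere)

text \<open>With \<open>e = sphere_base\<close>, the vectors \<open>e + s\<close>,
  \<open>e - s\<close> and the \<open>n\<close>-th axis are pairwise orthogonal, so all points of
  the circle have the same norm; its square is that of the centre plus that of the radius, which is
  1 by the parallelogram law.\<close>

lemma sphere_susp_in_nsphere:
  assumes n: "n \<ge> 1" and s: "s \<in> topspace (nsphere (n - 1))"
  shows "sphere_susp n (s, t) \<in> topspace (nsphere n)"
proof -
  define C S where "C = cos (2 * pi * t)" and "S = sin (2 * pi * t)"
  have CS: "S ^ 2 = 1 - C ^ 2"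
    by (simp add: C_def S_def sin_squared_eq)
  have s0: "s 0 \<le> 1"
    using nsphere_coordinate_le_1[OF s, of 0] by simp
  have s1: "(\<Sum>i<n. s i ^ 2) = 1" "\<And>i. i \<ge> n \<Longrightarrow> s i = 0"
    using s by (auto simp: topspace_nsphere_pred[OF n])
  have "(\<Sum>i\<le>n. sphere_susp n (s, t) i ^ 2)
      = (\<Sum>i<n. sphere_susp n (s, t) i ^ 2) + (S * sqrt (2 - 2 * s 0) / 2) ^ 2"
    by (simp add: sphere_susp_top[OF n s] S_def flip: lessThan_Suc_atMost)
  also have "(\<Sum>i<n. sphere_susp n (s, t) i ^ 2)
      = (\<Sum>i<n. ((1 + C) / 2 * sphere_base i + (1 - C) / 2 * s i) ^ 2)"
    by (intro sum.cong refl) (simp add: sphere_susp_low C_def)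
  also have "\<dots> = ((1 + C) / 2) ^ 2 + 2 * ((1 + C) / 2) * ((1 - C) / 2) * s 0 + ((1 - C) / 2) ^ 2"
    by (subst sum_square_plane[OF n]) (simp add: s1)
  also have "(S * sqrt (2 - 2 * s 0) / 2) ^ 2 = (1 - C ^ 2) * (1 - s 0) / 2"
    using s0 by (simp add: power_mult_distrib power_divide CS)
  also have "((1 + C) / 2) ^ 2 + 2 * ((1 + C) / 2) * ((1 - C) / 2) * s 0 + ((1 - C) / 2) ^ 2
      + (1 - C ^ 2) * (1 - s 0) / 2 = 1"
    by (simp add: power2_eq_square field_simps)
  finally have "(\<Sum>i\<le>n. sphere_susp n (s, t) i ^ 2) = 1" .
  moreover have "sphere_susp n (s, t) i = 0" if "i > n" for i
    using that s1(2)[of i] by (simp add: sphere_susp_low sphere_base_def)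
  ultimately show ?thesis
    by (simp add: topspace_nsphere)
qed

lemma continuous_map_cylinder_coordinates:
  "continuous_map (cylinder n) euclideanreal (\<lambda>z. fst z k)"
  "continuous_map (cylinder n) euclideanreal snd"
proof -
  show "continuous_map (cylinder n) euclideanreal (\<lambda>z. fst z k)"
    using continuous_map_compose[OF continuous_map_fst continuous_map_nsphere_projection]
    by (simp add: o_def)
  show "continuous_map (cylinder n) euclideanreal snd"
    using continuous_map_snd continuous_map_into_fulltopology by blast
qed

lemma continuous_map_real_compose:
  assumes "continuous_map Z euclideanreal f" "continuous_on UNIV (g :: real \<Rightarrow> real)"
  shows "continuous_map Z euclideanreal (\<lambda>z. g (f z))"
  using continuous_map_compose[OF assms(1), of euclidean g] assms(2) by (simp add: o_def)

lemma continuous_map_sphere_susp: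
  assumes "n \<ge> 1"
  shows "continuous_map (cylinder n) (nsphere n) (sphere_susp n)"
proof (rule continuous_map_into_nsphere)
  fix i
  note [continuous_intros] = continuous_map_cylinder_coordinates
  have c: "continuous_map (cylinder n) euclideanreal (\<lambda>z. cos (2 * pi * snd z))"
      "continuous_map (cylinder n) euclideanreal (\<lambda>z. sin (2 * pi * snd z))"
      "continuous_map (cylinder n) euclideanreal (\<lambda>z. sqrt (2 - 2 * fst z 0))"
    by (rule continuous_map_real_compose; intro continuous_intros)+
  show "continuous_map (cylinder n) euclideanreal (\<lambda>z. sphere_susp n z i)"
    unfolding sphere_susp_def case_prod_unfold
    by (intro continuous_intros c) auto
next
  fix z assume "z \<in> topspace (cylinder n)"
  then show "sphere_susp n z \<in> topspace (nsphere n)"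
    using sphere_susp_in_nsphere[OF assms] by (cases z) auto
qed

lemma sphere_susp_collapse [simp]:
  "sphere_susp n (s, 0) = sphere_base" "sphere_susp n (s, 1) = sphere_base"
  "sphere_susp n (sphere_base, t) = sphere_base"
  by (auto simp: sphere_susp_def sphere_base_def fun_eq_iff field_simps)

text \<open>Coordinate 0 decides: it falls short of 1 by
  \<open>(1 - cos (2 * pi * t)) * (1 - s 0) / 2\<close>.\<close>

lemma sphere_susp_eq_base:
  assumes n: "n \<ge> 1" and s: "s \<in> topspace (nsphere (n - 1))" and t: "t \<in> {0..1}"
    and eq: "sphere_susp n (s, t) = sphere_base"
  shows "t = 0 \<or> t = 1 \<or> s = sphere_base"
proof -
  have "sphere_susp n (s, t) 0 = 1"
    using eq by (simp add: sphere_base_def)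
  then have "(1 - cos (2 * pi * t)) * (1 - s 0) = 0"
    using n by (simp add: sphere_susp_low sphere_base_def field_simps)
  then consider "cos (2 * pi * t) = 1" | "s 0 = 1"
    by auto
  then show ?thesis
  proof cases
    case 1
    then obtain k :: int where k: "2 * pi * t = of_int k * 2 * pi"
      using cos_one_2pi_int by blast
    then have tk: "t = of_int k"
      by simp
    with t have "k = 0 \<or> k = 1"
      by auto
    then show ?thesis
      using tk by auto
  next
    case 2
    then show ?thesis
      using nsphere_eq_base_iff[OF s] by blast
  qed
qed

text \<open>Apart from coordinate \<open>n\<close> the point is \<open>e + b (s - e)\<close> with
  \<open>e = sphere_base\<close>, so \<open>s\<close> and \<open>s'\<close> lie on one ray from
  \<open>e\<close>. A line through \<open>e\<close> meets the sphere in only one further point,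
  whence \<open>s = s'\<close> and the cosines agree; coordinate \<open>n\<close> yields the
  sines.\<close>

lemma sphere_susp_inj:
  assumes n: "n \<ge> 1" and s: "s \<in> topspace (nsphere (n - 1))" and t: "t \<in> {0..1}"
    and s': "s' \<in> topspace (nsphere (n - 1))" and t': "t' \<in> {0..1}"
    and eq: "sphere_susp n (s, t) = sphere_susp n (s', t')"
    and nb: "sphere_susp n (s, t) \<noteq> sphere_base"
  shows "s = s' \<and> t = t'"
proof -
  define b b' where "b = (1 - cos (2 * pi * t)) / 2" and "b' = (1 - cos (2 * pi * t')) / 2"
  have low: "b * (s i - sphere_base i) = b' * (s' i - sphere_base i)" for i
  proof (cases "i = n")
    case True
    then show ?thesis
      using n s s' by (simp add: topspace_nsphere sphere_base_def)
  next
    case False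
    then show ?thesis
      using fun_cong[OF eq, of i] unfolding b_def b'_def by (simp add: sphere_susp_low field_simps)
  qed
  have nb': "sphere_susp n (s', t') \<noteq> sphere_base"
    using eq nb by simp
  have s0: "s 0 < 1" "s' 0 < 1"
    using nb nb' nsphere_coordinate_le_1[OF s, of 0] nsphere_coordinate_le_1[OF s', of 0]
      nsphere_eq_base_iff[OF s] nsphere_eq_base_iff[OF s']
    by (force simp: less_le)+
  have ts: "t \<noteq> 0" "t \<noteq> 1" "t' \<noteq> 0" "t' \<noteq> 1"
    using nb nb' by auto
  have cn1: "cos (2 * pi * x) \<noteq> 1" if x: "x \<in> {0..1}" "x \<noteq> 0" "x \<noteq> 1" for x
  proof
    assume "cos (2 * pi * x) = 1"
    then obtain k :: int where "2 * pi * x = of_int k * 2 * pi"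
      using cos_one_2pi_int by blast
    then have "x = of_int k"
      by simp
    with x show False
      by auto
  qed
  have b0: "b > 0" "b' > 0"
    using cn1[OF t] cn1[OF t'] ts cos_le_one[of "2 * pi * t"] cos_le_one[of "2 * pi * t'"]
    by (auto simp: b_def b'_def less_le)
  define \<kappa> where "\<kappa> = b' / b"
  have \<kappa>: "s i = (1 - \<kappa>) * sphere_base i + \<kappa> * s' i" for i
    using low[of i] b0 by (simp add: \<kappa>_def field_simps)
  have "(\<Sum>i<n. s i ^ 2) = (1 - \<kappa>) ^ 2 + 2 * (1 - \<kappa>) * \<kappa> * s' 0 + \<kappa> ^ 2 * (\<Sum>i<n. s' i ^ 2)"
    using sum_square_plane[OF n] by (simp add: \<kappa>)
  moreover have "(\<Sum>i<n. s i ^ 2) = 1" "(\<Sum>i<n. s' i ^ 2) = 1"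
    using s s' by (simp_all add: topspace_nsphere_pred[OF n])
  ultimately have "\<kappa> * (1 - \<kappa>) * (1 - s' 0) = 0"
    by (simp add: power2_eq_square algebra_simps)
  then have "\<kappa> = 1"
    using s0 b0 by (simp add: \<kappa>_def)
  then have ss': "s = s'"
    using \<kappa> by auto
  have "b = b'"
    using \<open>\<kappa> = 1\<close> b0 by (simp add: \<kappa>_def)
  then have c: "cos (2 * pi * t) = cos (2 * pi * t')"
    by (simp add: b_def b'_def)
  have "sin (2 * pi * t) * sqrt (2 - 2 * s 0) = sin (2 * pi * t') * sqrt (2 - 2 * s 0)"
    using fun_cong[OF eq, of n] ss' by (simp add: sphere_susp_top[OF n] s')
  then have si: "sin (2 * pi * t) = sin (2 * pi * t')"
    using s0 by simp
  \<comment> \<open>Sine and cosine fix the angle modulo \<open>2 * pi\<close>; both parameters are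
    below 1 because the common image is not the base point.\<close>
  have "2 * pi * t = 2 * pi * t'"
  proof -
    have r: "0 \<le> 2 * pi * t" "2 * pi * t < 2 * pi" "0 \<le> 2 * pi * t'" "2 * pi * t' < 2 * pi"
      using t t' ts by auto
    have "\<exists>k::int. 2 * pi * t = 2 * pi * t' + 2 * pi * of_int k"
      using c si by (metis sin_cos_eq_iff)
    then obtain k :: int where "2 * pi * t = 2 * pi * (t' + of_int k)"
      by (auto simp: algebra_simps)
    then have "t = t' + of_int k"
      by simp
    moreover have "t < 1" "t' < 1" "0 \<le> t" "0 \<le> t'"
      using t t' ts by auto
    ultimately have "k = 0"
      by linarith
    with \<open>t = t' + of_int k\<close> show ?thesis
      by simp
  qed
  then show ?thesis
    using ss' by simp
qed

text \<open>The construction is reversed: the line from the base point through \<open>x\<close> with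
  coordinate \<open>n\<close> erased meets the smaller sphere again in \<open>s\<close>, and the
  place of \<open>x\<close> on the circle over \<open>s\<close> gives the angle.\<close>

lemma sphere_susp_surj:
  assumes n: "n \<ge> 1" and x: "x \<in> topspace (nsphere n)"
  obtains s t where "s \<in> topspace (nsphere (n - 1))" "t \<in> {0..1}" "sphere_susp n (s, t) = x"
proof (cases "x = sphere_base")
  case True
  then show ?thesis
    by (intro that[of sphere_base 0]) auto
next
  case False
  define W where "W = (\<Sum>i<n. x i ^ 2)"
  have xn: "W + x n ^ 2 = 1" and xz: "\<And>i. i > n \<Longrightarrow> x i = 0"
    using x by (auto simp: topspace_nsphere W_def simp flip: lessThan_Suc_atMost)
  have W1: "W \<le> 1"
    using xn by (smt (verit) zero_le_power2)
  have x0: "x 0 < 1"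
    using nsphere_coordinate_le_1[OF x, of 0] False nsphere_eq_base_iff[OF x] by force
  \<comment> \<open>\<open>D\<close> is the squared distance from the base point to \<open>x\<close>
    with coordinate \<open>n\<close> erased. That \<open>(1 - \<mu>) e + \<mu> x\<close>, without
    coordinate \<open>n\<close>, has norm 1 then means
    \<open>\<mu> * D = 2 * (1 - x 0)\<close>.\<close>
  define D where "D = 1 - 2 * x 0 + W"
  have "x 0 ^ 2 \<le> W"
    unfolding W_def using n by (intro member_le_sum) auto
  then have "D \<ge> (1 - x 0) ^ 2"
    by (simp add: D_def power2_eq_square algebra_simps)
  then have D: "D > 0"
    using x0 by (smt (verit) zero_less_power2)
  have D2: "D \<le> 2 * (1 - x 0)"
    using W1 by (simp add: D_def)
  define \<mu> where "\<mu> = 2 * (1 - x 0) / D"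
  have \<mu>: "\<mu> \<ge> 1" "\<mu> * D = 2 * (1 - x 0)"
    using D D2 by (auto simp: \<mu>_def field_simps)
  define s where "s i = (if i < n then (1 - \<mu>) * sphere_base i + \<mu> * x i else 0)" for i
  have "(\<Sum>i<n. s i ^ 2) = (\<Sum>i<n. ((1 - \<mu>) * sphere_base i + \<mu> * x i) ^ 2)"
    by (intro sum.cong) (auto simp: s_def)
  also have "\<dots> = 1 - \<mu> * (2 * (1 - x 0) - \<mu> * D)"
    by (simp add: sum_square_plane[OF n] flip: W_def) (simp add: D_def power2_eq_square algebra_simps)
  finally have s: "s \<in> topspace (nsphere (n - 1))"
    using \<mu> by (simp add: topspace_nsphere_pred[OF n]) (simp add: s_def)
  have s0: "1 - s 0 = \<mu> * (1 - x 0)"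
    using n by (simp add: s_def sphere_base_def algebra_simps)
  have s0p: "1 - s 0 > 0"
    using s0 \<mu> x0 by simp
  \<comment> \<open>Read off from the required image: the weight \<open>(1 - C) / 2\<close> of
    \<open>s\<close> must be \<open>1 / \<mu>\<close>, and \<open>S\<close> is forced by coordinate
    \<open>n\<close>.\<close>
  define C where "C = 1 - 2 / \<mu>"
  define S where "S = 2 * x n / sqrt (2 - 2 * s 0)"
  have "S ^ 2 = 2 * x n ^ 2 / (1 - s 0)"
    using s0p by (simp add: S_def power_divide power_mult_distrib field_simps)
  moreover have "x n ^ 2 = 2 * (1 - x 0) - D"
    using xn by (simp add: D_def)
  ultimately have "S ^ 2 = 2 * (2 * (1 - x 0) - D) / (\<mu> * (1 - x 0))"
    using s0 by simp
  also have "2 * (1 - x 0) - D = (1 - 1 / \<mu>) * (2 * (1 - x 0))"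
    using \<mu> by (simp add: field_simps)
  finally have "S ^ 2 = 2 * ((1 - 1 / \<mu>) * (2 * (1 - x 0))) / (\<mu> * (1 - x 0))" .
  moreover have "2 * (c * (2 * u)) / (\<mu> * u) = 4 * c / \<mu>" if "u \<noteq> 0" for c u :: real
    using that by simp
  ultimately have S2: "S ^ 2 = 4 * (1 - 1 / \<mu>) / \<mu>"
    using x0 by (metis diff_gt_0_iff_gt less_irrefl)
  have "C ^ 2 + S ^ 2 = 1"
    unfolding S2 C_def using \<mu>(1) by (simp add: power2_eq_square field_simps)
  then obtain \<theta> where \<theta>: "0 \<le> \<theta>" "\<theta> < 2 * pi" "C = cos \<theta>" "S = sin \<theta>"
    using sincos_total_2pi by blast
  define t where "t = \<theta> / (2 * pi)"
  have t: "t \<in> {0..1}" and t\<theta>: "2 * pi * t = \<theta>"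
    using \<theta> by (auto simp: t_def)
  have "sphere_susp n (s, t) i = x i" for i
  proof -
    consider "i < n" | "i = n" | "i > n"
      by linarith
    then show ?thesis
    proof cases
      case 1
      have "sphere_susp n (s, t) i = (1 + C) / 2 * sphere_base i + (1 - C) / 2 * s i"
        using 1 \<theta>(3) t\<theta> by (simp add: sphere_susp_low)
      also have "\<dots> = x i"
        using 1 \<mu>(1) by (simp add: s_def C_def field_simps)
      finally show ?thesis .
    next
      case 2
      then show ?thesis
        using t\<theta> s0p by (simp add: sphere_susp_top[OF n s] S_def flip: \<theta>(4))
    next
      case 3
      then show ?thesis
        using n xz[OF 3] by (simp add: sphere_susp_low s_def sphere_base_def)
    qed
  qed
  then show ?thesis
    using s t that by blast
qed

text \<open>A continuous surjection from a compact space onto a Hausdorff space is closed.\<close>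

lemma quotient_map_sphere_susp:
  assumes "n \<ge> 1"
  shows "quotient_map (cylinder n) (nsphere n) (sphere_susp n)"
proof (rule continuous_closed_imp_quotient_map)
  show "continuous_map (cylinder n) (nsphere n) (sphere_susp n)"
    by (rule continuous_map_sphere_susp[OF assms])
  then show "closed_map (cylinder n) (nsphere n) (sphere_susp n)"
    by (rule continuous_imp_closed_map) (simp_all add: compact_space_cylinder)
  show "sphere_susp n ` topspace (cylinder n) = topspace (nsphere n)"
  proof
    show "topspace (nsphere n) \<subseteq> sphere_susp n ` topspace (cylinder n)"
    proof
      fix x assume "x \<in> topspace (nsphere n)"
      then obtain s t where "s \<in> topspace (nsphere (n - 1))" "t \<in> {0..1}" "sphere_susp n (s, t) = x"
        using sphere_susp_surj[OF assms] by metis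
      then show "x \<in> sphere_susp n ` topspace (cylinder n)"
        by (intro image_eqI[of _ _ "(s, t)"]) auto
    qed
  qed (use sphere_susp_in_nsphere[OF assms] in auto)
qed

section \<open>Maps into a sphere of higher dimension\<close>

lemma continuous_on_nsphere_iff:
  "continuous_on (topspace (nsphere n)) f \<longleftrightarrow> continuous_map (nsphere n) euclidean f"
  by (subst nsphere_eq_top_of_set) (rule continuous_map_iff_continuous[symmetric])

text \<open>Stone-Weierstrass for the algebra of bounded functions that are Lipschitz in the sum
  metric: the coordinates separate points, and the bounds make products Lipschitz again. The passage
  is needed because a merely continuous map may fill a sphere of higher dimension.\<close>

lemma nsphere_lipschitz_approximation:
  assumes f: "continuous_on (topspace (nsphere m)) f" and e: "e > 0"
  shows "\<exists>g L B. continuous_on (topspace (nsphere m)) g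
      \<and> (\<forall>x\<in>topspace (nsphere m). \<bar>g x\<bar> \<le> (B::real)
          \<and> (\<forall>y\<in>topspace (nsphere m). \<bar>g x - g y\<bar> \<le> L * (\<Sum>k\<le>m. \<bar>x k - y k\<bar>)))
      \<and> (\<forall>x\<in>topspace (nsphere m). \<bar>f x - g x\<bar> < e)"
proof -
  define S where "S = topspace (nsphere m)"
  define D :: "(nat \<Rightarrow> real) \<Rightarrow> (nat \<Rightarrow> real) \<Rightarrow> real" where "D x y = (\<Sum>k\<le>m. \<bar>x k - y k\<bar>)" for x y
  have D0: "D x y \<ge> 0" for x y
    by (simp add: D_def sum_nonneg)
  define P where "P g \<longleftrightarrow> continuous_on S g
      \<and> (\<exists>L B. \<forall>x\<in>S. \<bar>g x\<bar> \<le> (B::real) \<and> (\<forall>y\<in>S. \<bar>g x - g y\<bar> \<le> L * D x y))" for g :: "(nat \<Rightarrow> real) \<Rightarrow> real"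
  have "\<exists>g. P g \<and> (\<forall>x\<in>S. \<bar>f x - g x\<bar> < e)"
  proof (rule Stone_Weierstrass_HOL)
    show "compact S" "continuous_on S f" "0 < e"
      using compact_nsphere f e by (simp_all add: S_def)
    show "P (\<lambda>x. c)" for c
      unfolding P_def by (intro conjI exI[of _ 0] exI[of _ "\<bar>c\<bar>"]) auto
    show "continuous_on S g" if "P g" for g
      using that by (simp add: P_def)
    show "P (\<lambda>x. g x + h x)" if gh: "P g \<and> P h" for g h
    proof -
      obtain L B L' B' where
        g: "\<And>x. x \<in> S \<Longrightarrow> \<bar>g x\<bar> \<le> B" "\<And>x y. x \<in> S \<Longrightarrow> y \<in> S \<Longrightarrow> \<bar>g x - g y\<bar> \<le> L * D x y"
        and h: "\<And>x. x \<in> S \<Longrightarrow> \<bar>h x\<bar> \<le> B'" "\<And>x y. x \<in> S \<Longrightarrow> y \<in> S \<Longrightarrow> \<bar>h x - h y\<bar> \<le> L' * D x y"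
        using gh unfolding P_def by metis
      have "\<bar>g x + h x\<bar> \<le> B + B'" if "x \<in> S" for x
        using g(1)[OF that] h(1)[OF that] by linarith
      moreover have "\<bar>g x + h x - (g y + h y)\<bar> \<le> (L + L') * D x y" if "x \<in> S" "y \<in> S" for x y
        using g(2)[OF that] h(2)[OF that] unfolding distrib_right by linarith
      ultimately show ?thesis
        using gh unfolding P_def by (blast intro: continuous_on_add)
    qed
    show "P (\<lambda>x. g x * h x)" if gh: "P g \<and> P h" for g h
    proof -
      obtain L B L' B' where
        g: "\<And>x. x \<in> S \<Longrightarrow> \<bar>g x\<bar> \<le> B" "\<And>x y. x \<in> S \<Longrightarrow> y \<in> S \<Longrightarrow> \<bar>g x - g y\<bar> \<le> L * D x y"
        and h: "\<And>x. x \<in> S \<Longrightarrow> \<bar>h x\<bar> \<le> B'" "\<And>x y. x \<in> S \<Longrightarrow> y \<in> S \<Longrightarrow> \<bar>h x - h y\<bar> \<le> L' * D x y"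
        using gh unfolding P_def by metis
      have "\<bar>g x * h x\<bar> \<le> B * B'" if "x \<in> S" for x
        using g(1)[OF that] h(1)[OF that] abs_ge_zero[of "g x"]
        unfolding abs_mult by (intro mult_mono) linarith+
      moreover have "\<bar>g x * h x - g y * h y\<bar> \<le> (B * L' + L * B') * D x y" if xy: "x \<in> S" "y \<in> S" for x y
      proof -
        have "g x * h x - g y * h y = g x * (h x - h y) + (g x - g y) * h y"
          by (simp add: algebra_simps)
        then have "\<bar>g x * h x - g y * h y\<bar> \<le> \<bar>g x\<bar> * \<bar>h x - h y\<bar> + \<bar>g x - g y\<bar> * \<bar>h y\<bar>"
          by (metis abs_mult abs_triangle_ineq)
        also have "\<dots> \<le> B * (L' * D x y) + (L * D x y) * B'"
          using g(1)[OF xy(1)] h(1)[OF xy(2)] g(2)[OF xy] h(2)[OF xy]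
            abs_ge_zero[of "g x"] abs_ge_zero[of "g x - g y"]
          by (intro add_mono mult_mono) linarith+
        finally show ?thesis
          by (simp add: algebra_simps)
      qed
      ultimately show ?thesis
        using gh unfolding P_def by (blast intro: continuous_on_mult)
    qed
    show "\<exists>g. P g \<and> g x \<noteq> g y" if xy: "x \<in> S \<and> y \<in> S \<and> x \<noteq> y" for x y
    proof -
      obtain k where k: "x k \<noteq> y k"
        using xy by auto
      have "k \<le> m"
        using xy k unfolding S_def by (metis (mono_tags, lifting) mem_Collect_eq not_le topspace_nsphere)
      then have "\<bar>u k - w k\<bar> \<le> 1 * D u w" for u w
        by (auto simp: D_def intro: member_le_sum)
      moreover have "continuous_on S (\<lambda>x. x k)"
        unfolding S_def continuous_on_nsphere_iff by (rule continuous_map_nsphere_projection)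
      ultimately have "P (\<lambda>x. x k)"
        unfolding P_def using nsphere_coordinate_le_1
        by (intro conjI exI[of _ 1]) (auto simp: S_def)
      then show ?thesis
        using k by blast
    qed
  qed
  then show ?thesis
    unfolding P_def S_def D_def by blast
qed

text \<open>Pigeonhole: a fine grid in the cube has more points than the \<open>m + 1\<close>-dimensional
  domain has cells of the width that a Lipschitz map needs to separate them.\<close>

lemma lipschitz_image_misses_small_vector:
  fixes G :: "(nat \<Rightarrow> real) \<Rightarrow> nat \<Rightarrow> real"
  assumes "m < n" "\<eta> > 0" "C \<ge> 0"
    and lip: "\<And>x y \<delta> j. \<lbrakk>\<And>k. k \<le> m \<Longrightarrow> \<bar>x k\<bar> \<le> 1; \<And>k. k \<le> m \<Longrightarrow> \<bar>y k\<bar> \<le> 1;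
        \<And>k. k \<le> m \<Longrightarrow> \<bar>x k - y k\<bar> \<le> \<delta>; j \<le> n\<rbrakk> \<Longrightarrow> \<bar>G x j - G y j\<bar> \<le> C * \<delta>"
  shows "\<exists>v. (\<forall>j\<le>n. 0 < v j \<and> v j \<le> \<eta>)
    \<and> (\<forall>x. (\<forall>k\<le>m. \<bar>x k\<bar> \<le> 1) \<longrightarrow> (\<exists>j\<le>n. G x j \<noteq> v j))"
proof (rule ccontr)
  assume contra: "\<not> ?thesis"
  have cover: "\<exists>x. (\<forall>k\<le>m. \<bar>x k\<bar> \<le> 1) \<and> (\<forall>j\<le>n. G x j = v j)"
    if "\<And>j. j \<le> n \<Longrightarrow> 0 < v j \<and> v j \<le> \<eta>" for v
  proof (rule ccontr)
    assume "\<not> ?thesis"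
    then have "\<forall>x. (\<forall>k\<le>m. \<bar>x k\<bar> \<le> 1) \<longrightarrow> (\<exists>j\<le>n. G x j \<noteq> v j)"
      by blast
    with contra that show False
      by metis
  qed
  \<comment> \<open>With \<open>N = K * M\<close>, points in one cell of width \<open>2 / N\<close>
    have images less than \<open>\<eta> / M\<close> apart, and \<open>\<eta> / M\<close> is the mesh
    of the grid.\<close>
  obtain K :: nat where K: "K > 2 * C / \<eta>"
    using reals_Archimedean2 by blast
  \<comment> \<open>Since \<open>N + 1 \<le> (K + 1) * M\<close>, there are at most
    \<open>(K + 1) ^ (m + 1) * M ^ (m + 1)\<close> cells. Once \<open>M\<close> exceeds the first
    factor, this is less than \<open>M ^ (m + 2)\<close>, hence less than the number
    \<open>M ^ (n + 1)\<close> of grid points.\<close>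
  define M where "M = (K + 1) ^ (m + 1) + 1"
  define N where "N = K * M"
  have K0: "K > 0"
    using K assms by (metis divide_nonneg_pos mult_nonneg_nonneg not_gr0 not_le of_nat_0 zero_le_numeral)
  have M0: "M > 0"
    by (simp add: M_def)
  have N0: "N > 0"
    using K0 M0 by (simp add: N_def)
  define T where "T = PiE {..n} (\<lambda>_. {1..M})"
  have "\<exists>x. (\<forall>k\<le>m. \<bar>x k\<bar> \<le> 1) \<and> (\<forall>j\<le>n. G x j = real (u j) * \<eta> / M)" if "u \<in> T" for u
  proof (rule cover)
    fix j assume "j \<le> n"
    then have "u j \<in> {1..M}"
      using that by (auto simp: T_def)
    then show "0 < real (u j) * \<eta> / M \<and> real (u j) * \<eta> / M \<le> \<eta>"
      using M0 \<open>\<eta> > 0\<close> by (auto simp: field_simps)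
  qed
  then obtain X where X: "\<And>u k. u \<in> T \<Longrightarrow> k \<le> m \<Longrightarrow> \<bar>X u k\<bar> \<le> 1"
      "\<And>u j. u \<in> T \<Longrightarrow> j \<le> n \<Longrightarrow> G (X u) j = real (u j) * \<eta> / M"
    by metis
  define cell where "cell u = restrict (\<lambda>k. nat \<lfloor>(X u k + 1) * N / 2\<rfloor>) {..m}" for u
  have "cell ` T \<subseteq> PiE {..m} (\<lambda>_. {0..N})"
  proof -
    have "nat \<lfloor>(X u k + 1) * N / 2\<rfloor> \<le> N" if "u \<in> T" "k \<le> m" for u k
    proof -
      have "(X u k + 1) * real N \<le> 2 * real N"
        using X(1)[OF that] by (intro mult_right_mono) auto
      then have "(X u k + 1) * N / 2 \<le> real N"
        by simp
      then have "\<lfloor>(X u k + 1) * N / 2\<rfloor> \<le> int N"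
        by linarith
      then show ?thesis
        by simp
    qed
    then show ?thesis
      unfolding cell_def image_subset_iff restrict_PiE_iff by simp
  qed
  moreover have "inj_on cell T"
  proof (rule inj_onI)
    fix u w assume u: "u \<in> T" and w: "w \<in> T" and eq: "cell u = cell w"
    have close: "\<bar>X u k - X w k\<bar> \<le> 2 / N" if k: "k \<le> m" for k
    proof -
      define a b where "a = (X u k + 1) * N / 2" and "b = (X w k + 1) * N / 2"
      have "a \<ge> 0" "b \<ge> 0"
        using X(1)[OF u k] X(1)[OF w k] by (auto simp: a_def b_def)
      moreover have "nat \<lfloor>a\<rfloor> = nat \<lfloor>b\<rfloor>"
        using fun_cong[OF eq, of k] k by (simp add: cell_def a_def b_def)
      ultimately have "\<lfloor>a\<rfloor> = \<lfloor>b\<rfloor>"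
        by (simp add: nat_eq_iff)
      then have "\<bar>a - b\<bar> \<le> 1"
        by linarith
      moreover have "a - b = (X u k - X w k) * (N / 2)"
        by (simp add: a_def b_def field_simps)
      ultimately have "\<bar>X u k - X w k\<bar> * (N / 2) \<le> 1"
        by (simp add: abs_mult)
      then show ?thesis
        using N0 by (simp add: field_simps)
    qed
    have "u j = w j" if j: "j \<le> n" for j
    proof -
      have "\<bar>G (X u) j - G (X w) j\<bar> \<le> C * (2 / N)"
        using X(1)[OF u] X(1)[OF w] close j by (intro lip) auto
      also have "C * (2 / N) = (2 * C / K) / M"
        by (simp add: N_def)
      also have "\<dots> < \<eta> / M"
        using K K0 M0 \<open>\<eta> > 0\<close> by (intro divide_strict_right_mono) (auto simp: field_simps)
      finally have "\<bar>real (u j) * (\<eta> / M) - real (w j) * (\<eta> / M)\<bar> < \<eta> / M"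
        using X(2)[OF u j] X(2)[OF w j] by simp
      then have "\<bar>real (u j) - real (w j)\<bar> * (\<eta> / M) < 1 * (\<eta> / M)"
        using \<open>\<eta> > 0\<close> by (simp only: abs_mult flip: left_diff_distrib) simp
      then have "\<bar>real (u j) - real (w j)\<bar> < 1"
        using \<open>\<eta> > 0\<close> M0 by (subst (asm) mult_less_cancel_right_pos) auto
      then show ?thesis
        by linarith
    qed
    then show "u = w"
      using u w unfolding T_def by (auto intro: PiE_ext)
  qed
  ultimately have "card T \<le> card (PiE {..m} (\<lambda>_. {0..N}))"
    by (intro card_inj_on_le) (auto intro: finite_PiE)
  moreover have "card T = M ^ (n + 1)" "card (PiE {..m} (\<lambda>_. {0..N})) = (N + 1) ^ (m + 1)"
    by (simp_all add: T_def card_PiE flip: Suc_eq_plus1)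
  ultimately have "M ^ (n + 1) \<le> (N + 1) ^ (m + 1)"
    by simp
  also have "\<dots> \<le> ((K + 1) * M) ^ (m + 1)"
    using M0 by (intro power_mono) (simp_all add: N_def algebra_simps Suc_le_eq)
  also have "\<dots> = (K + 1) ^ (m + 1) * M ^ (m + 1)"
    by (rule power_mult_distrib)
  also have "\<dots> < M * M ^ (m + 1)"
    using M0 by (intro mult_strict_right_mono) (auto simp: M_def)
  also have "\<dots> = M ^ (m + 2)"
    by (simp add: power_add power2_eq_square)
  also have "\<dots> \<le> M ^ (n + 1)"
    using \<open>m < n\<close> M0 by (intro power_increasing) auto
  finally show False
    by simp
qed

text \<open>Radial projection onto the unit sphere; the zero vector goes to 0, as division by 0
  yields 0.\<close>

definition normalized :: "nat \<Rightarrow> (nat \<Rightarrow> real) \<Rightarrow> nat \<Rightarrow> real" where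
  "normalized n x = (\<lambda>j. if j \<le> n then x j / L2_set x {..n} else 0)"

lemma normalized_in_nsphere:
  assumes "L2_set x {..n} \<noteq> 0"
  shows "normalized n x \<in> topspace (nsphere n)"
proof -
  have "(\<Sum>j\<le>n. (normalized n x j) ^ 2) = (\<Sum>j\<le>n. x j ^ 2) / L2_set x {..n} ^ 2"
    by (simp add: normalized_def power_divide sum_divide_distrib)
  also have "\<dots> = 1"
    using assms by (simp add: L2_set_def sum_nonneg)
  finally show ?thesis
    by (simp add: topspace_nsphere) (simp add: normalized_def)
qed

lemma L2_set_nsphere: "x \<in> topspace (nsphere n) \<Longrightarrow> L2_set x {..n} = 1"
  by (simp add: topspace_nsphere L2_set_def)

lemma normalized_nsphere [simp]:
  assumes "x \<in> topspace (nsphere n)"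
  shows "normalized n x = x"
  using assms by (auto simp: normalized_def L2_set_nsphere topspace_nsphere)

text \<open>The Lipschitz map is extended to the ball by homogeneity, so that a small vector missed
  by the extension spans a ray missed by the map itself.\<close>

lemma lipschitz_map_misses_ray:
  fixes g :: "(nat \<Rightarrow> real) \<Rightarrow> nat \<Rightarrow> real"
  assumes mn: "m < n" and L: "L \<ge> 0"
    and bd: "\<And>x j. \<lbrakk>x \<in> topspace (nsphere m); j \<le> n\<rbrakk> \<Longrightarrow> \<bar>g x j\<bar> \<le> B"
    and lip: "\<And>x y j. \<lbrakk>x \<in> topspace (nsphere m); y \<in> topspace (nsphere m); j \<le> n\<rbrakk>
       \<Longrightarrow> \<bar>g x j - g y j\<bar> \<le> L * (\<Sum>k\<le>m. \<bar>x k - y k\<bar>)"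
    and big: "\<And>x. x \<in> topspace (nsphere m) \<Longrightarrow> L2_set (g x) {..n} \<ge> c" and c: "c > 0"
  obtains p where "p \<in> topspace (nsphere n)"
    "\<And>x. x \<in> topspace (nsphere m) \<Longrightarrow> normalized n (g x) \<noteq> p"
proof -
  have B: "B \<ge> 0"
    using bd[OF sphere_base_in_nsphere, of 0] abs_ge_zero by (meson le0 order_trans)
  define r where "r x = L2_set x {..m}" for x :: "nat \<Rightarrow> real"
  define u where "u = normalized m"
  define D :: "(nat \<Rightarrow> real) \<Rightarrow> (nat \<Rightarrow> real) \<Rightarrow> real" where "D x y = (\<Sum>k\<le>m. \<bar>x k - y k\<bar>)" for x y
  \<comment> \<open>At the origin the factor \<open>r x = 0\<close> makes the value 0, whatever
    \<open>normalized\<close> yields there.\<close>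
  define G where "G x j = r x * g (u x) j" for x j
  have D0: "D x y \<ge> 0" and Dsym: "D x y = D y x" for x y
    by (auto simp: D_def sum_nonneg abs_minus_commute)
  have r0: "r x \<ge> 0" for x
    by (simp add: r_def)
  have rle: "r x \<le> r y + D x y" for x y
  proof -
    have "r x = L2_set (\<lambda>k. y k + (x k - y k)) {..m}"
      by (simp add: r_def)
    also have "\<dots> \<le> r y + L2_set (\<lambda>k. x k - y k) {..m}"
      unfolding r_def by (rule L2_set_triangle_ineq)
    also have "L2_set (\<lambda>k. x k - y k) {..m} \<le> D x y"
      unfolding D_def by (rule L2_set_le_sum_abs)
    finally show ?thesis
      by simp
  qed
  have rdiff: "\<bar>r x - r y\<bar> \<le> D x y" for x y
    using rle[of x y] rle[of y x] Dsym[of x y] by linarith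
  have uS: "u x \<in> topspace (nsphere m)" if "r x \<noteq> 0" for x
    using that normalized_in_nsphere by (simp add: u_def r_def)
  have G0: "\<bar>G x j\<bar> \<le> B * r x" if "j \<le> n" for x j
  proof (cases "r x = 0")
    case False
    then have "\<bar>G x j\<bar> = r x * \<bar>g (u x) j\<bar>"
      using r0[of x] by (simp add: G_def abs_mult)
    also have "\<dots> \<le> r x * B"
      using bd[OF uS[OF False] that] r0[of x] by (intro mult_left_mono)
    finally show ?thesis
      by (simp add: mult.commute)
  qed (simp add: G_def)
  have Glip: "\<bar>G x j - G y j\<bar> \<le> (B + L * (m + 2)) * D x y" if j: "j \<le> n" for x y j
  proof -
    have le: "B * D x y \<le> (B + L * (m + 2)) * D x y"
      using L D0[of x y] by (intro mult_right_mono) auto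
    consider "r x = 0" | "r y = 0" | "r x \<noteq> 0" "r y \<noteq> 0"
      by blast
    then show ?thesis
    proof cases
      case 1
      then have "\<bar>G x j - G y j\<bar> \<le> B * r y"
        using G0[OF j, of y] by (simp add: G_def)
      also have "\<dots> \<le> B * D x y"
        using rdiff[of x y] 1 B r0[of y] by (intro mult_left_mono) auto
      finally show ?thesis
        using le by linarith
    next
      case 2
      then have "\<bar>G x j - G y j\<bar> \<le> B * r x"
        using G0[OF j, of x] by (simp add: G_def)
      also have "\<dots> \<le> B * D x y"
        using rdiff[of x y] 2 B r0[of x] by (intro mult_left_mono) auto
      finally show ?thesis
        using le by linarith
    next
      case 3
      \<comment> \<open>Scaling by \<open>r y\<close> turns the difference of the unit vectors into
        \<open>x k - y k\<close> plus the correction \<open>(x k / r x) * (r y - r x)\<close>.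
        Summed over \<open>m + 1\<close> coordinates, the two parts give the factor
        \<open>m + 2\<close>.\<close>
      have coord: "r y * \<bar>u x k - u y k\<bar> \<le> \<bar>x k - y k\<bar> + D x y" if k: "k \<le> m" for k
      proof -
        have xk: "\<bar>x k\<bar> \<le> r x"
          using member_le_sum[of k "{..m}" "\<lambda>k. x k ^ 2"] k
          by (simp add: r_def L2_set_def real_le_rsqrt)
        have "r y * (u x k - u y k) = (x k - y k) + (x k / r x) * (r y - r x)"
          using k 3 by (simp add: u_def normalized_def field_simps flip: r_def)
        then have "\<bar>r y * (u x k - u y k)\<bar> \<le> \<bar>x k - y k\<bar> + \<bar>x k / r x\<bar> * \<bar>r y - r x\<bar>"
          by (metis abs_mult abs_triangle_ineq)
        also have "\<bar>x k / r x\<bar> * \<bar>r y - r x\<bar> \<le> 1 * D x y"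
          using xk r0[of x] 3 rdiff[of x y] by (intro mult_mono) (auto simp: divide_le_eq)
        finally show ?thesis
          using r0[of y] by (simp add: abs_mult)
      qed
      have "r y * D (u x) (u y) \<le> (\<Sum>k\<le>m. \<bar>x k - y k\<bar> + D x y)"
        unfolding D_def[of "u x"] sum_distrib_left using coord by (intro sum_mono) auto
      also have "\<dots> = (m + 2) * D x y"
        by (simp add: sum.distrib flip: D_def) (simp add: algebra_simps)
      finally have ry: "r y * D (u x) (u y) \<le> (m + 2) * D x y" .
      have "G x j - G y j = (r x - r y) * g (u x) j + r y * (g (u x) j - g (u y) j)"
        by (simp add: G_def algebra_simps)
      then have "\<bar>G x j - G y j\<bar> \<le> \<bar>r x - r y\<bar> * \<bar>g (u x) j\<bar> + r y * \<bar>g (u x) j - g (u y) j\<bar>"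
        using r0[of y] by (metis abs_mult abs_of_nonneg abs_triangle_ineq)
      also have "\<dots> \<le> D x y * B + r y * (L * D (u x) (u y))"
        using rdiff bd[OF uS[OF 3(1)] j] lip[OF uS[OF 3(1)] uS[OF 3(2)] j] r0[of y] D0[of x y]
        by (intro add_mono mult_mono mult_left_mono) (auto simp: D_def)
      also have "\<dots> \<le> D x y * B + L * ((m + 2) * D x y)"
        using mult_left_mono[OF ry L] by (simp add: algebra_simps)
      finally show ?thesis
        by (simp add: algebra_simps)
    qed
  qed
  define C where "C = (B + L * (m + 2)) * (m + 1)"
  have C0: "C \<ge> 0"
    using B L by (simp add: C_def)
  \<comment> \<open>A vector with \<open>n + 1\<close> coordinates of size at most \<eta> has length
    at most \<open>c\<close>, so it is no longer than any value of \<open>g\<close>.\<close>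
  define \<eta> where "\<eta> = c / (n + 1)"
  have \<eta>: "\<eta> > 0"
    using c by (simp add: \<eta>_def)
  have "\<bar>G x j - G y j\<bar> \<le> C * \<delta>" if "\<And>k. k \<le> m \<Longrightarrow> \<bar>x k - y k\<bar> \<le> \<delta>" "j \<le> n" for x y \<delta> j
  proof -
    have "D x y \<le> (\<Sum>k\<le>m. \<delta>)"
      unfolding D_def using that by (intro sum_mono) auto
    then have "D x y \<le> (m + 1) * \<delta>"
      by (simp add: algebra_simps)
    then have "(B + L * (m + 2)) * D x y \<le> (B + L * (m + 2)) * ((m + 1) * \<delta>)"
      using B L by (intro mult_left_mono) auto
    then show ?thesis
      using Glip[OF that(2), of x y] by (simp add: C_def mult.assoc)
  qed
  then obtain v where v: "\<And>j. j \<le> n \<Longrightarrow> 0 < v j \<and> v j \<le> \<eta>"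
      "\<And>x. (\<And>k. k \<le> m \<Longrightarrow> \<bar>x k\<bar> \<le> 1) \<Longrightarrow> \<exists>j\<le>n. G x j \<noteq> v j"
    using lipschitz_image_misses_small_vector[OF mn \<eta> C0, of G] by blast
  define V where "V = L2_set v {..n}"
  have "V \<le> (\<Sum>j\<le>n. \<bar>v j\<bar>)"
    unfolding V_def by (rule L2_set_le_sum_abs)
  also have "\<dots> \<le> (\<Sum>j\<le>n. \<eta>)"
    using v(1) by (intro sum_mono) force
  also have "\<dots> = c"
    by (simp add: \<eta>_def field_simps)
  finally have Vc: "V \<le> c" .
  have "v 0 \<le> V"
    unfolding V_def by (intro order_trans[OF _ member_le_L2_set]) auto
  then have V0: "V > 0"
    using v(1)[of 0] by simp
  show thesis
  proof (rule that)
    show "normalized n v \<in> topspace (nsphere n)"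
      using V0 by (intro normalized_in_nsphere) (simp add: V_def)
    fix x assume x: "x \<in> topspace (nsphere m)"
    show "normalized n (g x) \<noteq> normalized n v"
    proof
      assume eq: "normalized n (g x) = normalized n v"
      \<comment> \<open>If \<open>g x\<close> pointed along \<open>v\<close>, the homogeneous
        extension would take the value \<open>v\<close> at \<open>a * x\<close>, a point of the unit
        ball since \<open>V \<le> c\<close>.\<close>
      define a where "a = V / L2_set (g x) {..n}"
      have a: "0 < a" "a \<le> 1"
        using V0 Vc big[OF x] c by (auto simp: a_def)
      define y where "y k = a * x k" for k
      have "\<bar>y k\<bar> \<le> 1" for k
        using a nsphere_coordinate_le_1[OF x, of k] by (simp add: y_def abs_mult mult_le_one)
      then obtain j where j: "j \<le> n" "G y j \<noteq> v j"
        using v(2) by blast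
      have ry: "r y = a"
        using a L2_set_right_distrib[of a x "{..m}"] by (simp add: r_def y_def[abs_def] L2_set_nsphere[OF x])
      have "u y = x"
        using a x ry by (auto simp: u_def normalized_def y_def topspace_nsphere simp flip: r_def)
      then have "G y j = V * (g x j / L2_set (g x) {..n})"
        by (simp add: G_def ry a_def)
      also have "g x j / L2_set (g x) {..n} = v j / V"
        using fun_cong[OF eq, of j] j by (simp add: normalized_def V_def)
      finally show False
        using j V0 by simp
    qed
  qed
qed

text \<open>Radial projection of the segments from \<open>f z\<close> to \<open>g z\<close>, which
  avoid the origin; over \<open>z0\<close> the segment is a single point, so the homotopy is
  based.\<close>

lemma nsphere_linear_homotopy:
  assumes cont: "\<And>j. j \<le> n \<Longrightarrow> continuous_map Z euclideanreal (\<lambda>z. f z j)"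
      "\<And>j. j \<le> n \<Longrightarrow> continuous_map Z euclideanreal (\<lambda>z. g z j)"
    and nz: "\<And>z t. \<lbrakk>z \<in> topspace Z; t \<in> {0..1}\<rbrakk> \<Longrightarrow> \<exists>j\<le>n. (1 - t) * f z j + t * g z j \<noteq> 0"
    and base: "f z0 = sphere_base" "g z0 = sphere_base"
  shows "homotopic_with (\<lambda>h. h z0 = sphere_base) Z (nsphere n)
     (\<lambda>z. normalized n (f z)) (\<lambda>z. normalized n (g z))"
proof -
  define h where "h = (\<lambda>(t, z). normalized n (\<lambda>j. (1 - t) * f z j + t * g z j))"
  let ?I = "top_of_set {0..1::real}"
  have l2: "L2_set (\<lambda>j. (1 - t) * f z j + t * g z j) {..n} \<noteq> 0"
    if "z \<in> topspace Z" "t \<in> {0..1}" for z t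
    using nz[OF that] by (auto simp: L2_set_eq_0_iff)
  have "continuous_map (prod_topology ?I Z) (nsphere n) h"
  proof (rule continuous_map_into_nsphere)
    fix i
    have t: "continuous_map (prod_topology ?I Z) euclideanreal fst"
      using continuous_map_fst continuous_map_into_fulltopology by blast
    have c: "continuous_map (prod_topology ?I Z) euclideanreal
        (\<lambda>z. (1 - fst z) * f (snd z) j + fst z * g (snd z) j)" if "j \<le> n" for j
      using continuous_map_compose[OF continuous_map_snd cont(1)[OF that]]
        continuous_map_compose[OF continuous_map_snd cont(2)[OF that]]
      by (intro continuous_intros t) (simp_all add: o_def)
    have "continuous_map (prod_topology ?I Z) euclideanreal
        (\<lambda>z. sqrt (\<Sum>j\<le>n. ((1 - fst z) * f (snd z) j + fst z * g (snd z) j) ^ 2))"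
      by (rule continuous_map_real_compose[where g = sqrt])
        (intro continuous_intros c; simp)+
    then have "continuous_map (prod_topology ?I Z) euclideanreal
        (\<lambda>z. ((1 - fst z) * f (snd z) i + fst z * g (snd z) i)
            / L2_set (\<lambda>j. (1 - fst z) * f (snd z) j + fst z * g (snd z) j) {..n})" if "i \<le> n"
      using l2 that by (intro continuous_intros c) (auto simp: L2_set_def)
    then show "continuous_map (prod_topology ?I Z) euclideanreal (\<lambda>z. h z i)"
      by (cases "i \<le> n") (auto simp: h_def normalized_def case_prod_unfold)
  qed (auto simp: h_def l2 intro: normalized_in_nsphere)
  moreover have "(\<lambda>j. (1 - t) * sphere_base j + t * sphere_base j) = sphere_base" for t
    by (auto simp: algebra_simps)
  ultimately show ?thesis
    unfolding homotopic_with_def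
    by (intro exI[of _ h]) (auto simp: h_def base)
qed

text \<open>The sphere minus \<open>p\<close> is contracted along straight lines in stereographic projection from \<open>p\<close>.\<close>

lemma nonsurjective_imp_nullhomotopic:
  assumes f: "continuous_map Z (nsphere n) f" and p: "p \<in> topspace (nsphere n)"
    and miss: "\<And>z. z \<in> topspace Z \<Longrightarrow> f z \<noteq> p"
    and z0: "z0 \<in> topspace Z" and base: "f z0 = sphere_base"
  shows "homotopic_with (\<lambda>h. h z0 = sphere_base) Z (nsphere n) f (\<lambda>_. sphere_base)"
proof -
  let ?I = "top_of_set {0..1::real}"
  let ?e = "sphere_base :: nat \<Rightarrow> real"
  \<comment> \<open>On the sphere \<open>2 * c y\<close> is the squared distance from
    \<open>y\<close> to \<open>p\<close>. The vector \<open>(y - p) / c y\<close> is the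
    stereographic image of \<open>y\<close>, in the hyperplane of vectors with inner product -1 with
    \<open>p\<close>; the line from \<open>p\<close> in direction \<open>d\<close> meets the sphere
    again at \<open>p + 2 d / Q\<close>.\<close>
  define c where "c y = 1 - (\<Sum>i\<le>n. p i * y i)" for y
  define d where "d t y i = (1 - t) * ((y i - p i) / c y) + t * ((?e i - p i) / c ?e)" for t y i
  define Q where "Q t y = (\<Sum>i\<le>n. d t y i ^ 2)" for t y
  define h where "h t y i = p i + 2 * d t y i / Q t y" for t y i
  have p1: "(\<Sum>i\<le>n. p i ^ 2) = 1" and pz: "\<And>i. i > n \<Longrightarrow> p i = 0"
    using p by (auto simp: topspace_nsphere)
  have dist: "(\<Sum>i\<le>n. (y i - p i) ^ 2) = 2 * c y" if "y \<in> topspace (nsphere n)" for y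
  proof -
    have "(\<Sum>i\<le>n. (y i - p i) ^ 2) = (\<Sum>i\<le>n. y i ^ 2) + (\<Sum>i\<le>n. p i ^ 2) - 2 * (\<Sum>i\<le>n. p i * y i)"
      by (simp add: power2_diff sum.distrib sum_subtractf sum_distrib_left algebra_simps)
    then show ?thesis
      using that p1 by (simp add: topspace_nsphere c_def)
  qed
  have c0: "c y \<noteq> 0" if y: "y \<in> topspace (nsphere n)" "y \<noteq> p" for y
  proof
    assume "c y = 0"
    then have "(\<Sum>i\<le>n. (y i - p i) ^ 2) = 0"
      using dist[OF y(1)] by simp
    then have "\<And>i. i \<le> n \<Longrightarrow> y i = p i"
      by (simp add: sum_nonneg_eq_0_iff)
    moreover have "\<And>i. i > n \<Longrightarrow> y i = p i"
      using y(1) pz by (simp add: topspace_nsphere)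
    ultimately show False
      using y(2) by (meson ext not_le)
  qed
  have ep: "?e \<noteq> p"
    using miss[OF z0] base by simp
  have fS: "f z \<in> topspace (nsphere n)" if "z \<in> topspace Z" for z
    using continuous_map_image_subset_topspace[OF f] that by blast
  have pc: "(\<Sum>i\<le>n. p i * ((y i - p i) / c y)) = -1" if "y \<in> topspace (nsphere n)" "y \<noteq> p" for y
  proof -
    have "(\<Sum>i\<le>n. p i * ((y i - p i) / c y)) = ((\<Sum>i\<le>n. p i * y i) - (\<Sum>i\<le>n. p i ^ 2)) / c y"
      by (simp add: sum_divide_distrib sum_subtractf power2_eq_square right_diff_distrib diff_divide_distrib)
    also have "\<dots> = - c y / c y"
      by (simp add: p1 c_def)
    finally show ?thesis
      using c0[OF that] by simp
  qed
  \<comment> \<open>The hyperplane is convex and misses the origin, so \<open>d\<close> does not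
    vanish along the segment.\<close>
  have pd: "(\<Sum>i\<le>n. p i * d t y i) = -1" if y: "y \<in> topspace (nsphere n)" "y \<noteq> p" for t y
  proof -
    have "(\<Sum>i\<le>n. p i * d t y i) = (1 - t) * (\<Sum>i\<le>n. p i * ((y i - p i) / c y))
        + t * (\<Sum>i\<le>n. p i * ((?e i - p i) / c ?e))"
      by (simp add: d_def distrib_left sum.distrib sum_distrib_left mult.left_commute)
    also have "\<dots> = -1"
      by (simp only: pc[OF y] pc[OF sphere_base_in_nsphere ep]) simp
    finally show ?thesis .
  qed
  have Q0: "Q t y \<noteq> 0" if y: "y \<in> topspace (nsphere n)" "y \<noteq> p" for t y
  proof
    assume "Q t y = 0"
    then have "\<And>i. i \<le> n \<Longrightarrow> d t y i = 0"
      by (simp add: Q_def sum_nonneg_eq_0_iff)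
    then show False
      using pd[OF y, of t] by simp
  qed
  have hS: "h t y \<in> topspace (nsphere n)" if y: "y \<in> topspace (nsphere n)" "y \<noteq> p" for t y
  proof -
    have "(\<Sum>i\<le>n. h t y i ^ 2) = (\<Sum>i\<le>n. p i ^ 2 + 4 / Q t y * (p i * d t y i) + 4 / (Q t y)^2 * d t y i ^ 2)"
      by (intro sum.cong refl) (simp add: h_def power2_sum power_divide power_mult_distrib)
    also have "\<dots> = 1 + 4 / Q t y * (-1) + 4 / (Q t y)^2 * Q t y"
      by (simp only: sum.distrib flip: sum_distrib_left) (simp only: p1 pd[OF y] Q_def)
    also have "\<dots> = 1"
      using Q0[OF y] by (simp add: power2_eq_square)
    finally have "(\<Sum>i\<le>n. h t y i ^ 2) = 1" .
    moreover have "h t y i = 0" if "i > n" for i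
      using that pz y(1) by (simp add: h_def d_def topspace_nsphere sphere_base_def)
    ultimately show ?thesis
      by (simp add: topspace_nsphere)
  qed
  have inv: "p i + 2 * ((y i - p i) / c y) / (\<Sum>i\<le>n. ((y i - p i) / c y) ^ 2) = y i"
    if y: "y \<in> topspace (nsphere n)" "y \<noteq> p" for y i
  proof -
    have "(\<Sum>i\<le>n. ((y i - p i) / c y) ^ 2) = 2 / c y"
      using c0[OF y] dist[OF y(1)]
      by (simp add: power_divide flip: sum_divide_distrib) (simp add: power2_eq_square)
    then show ?thesis
      using c0[OF y] by (simp add: field_simps)
  qed
  have h0: "h 0 y = y" and h1: "h 1 y = ?e" if y: "y \<in> topspace (nsphere n)" "y \<noteq> p" for y
    using inv[OF y] inv[OF sphere_base_in_nsphere ep] by (auto simp: h_def d_def Q_def fun_eq_iff)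
  have he: "h t ?e = ?e" for t
  proof -
    have "d t ?e = d 0 ?e"
      unfolding d_def by (rule ext) (simp only: flip: distrib_right, simp)
    then have "h t ?e = h 0 ?e"
      by (simp add: h_def Q_def fun_eq_iff)
    then show ?thesis
      using h0[OF sphere_base_in_nsphere ep] by simp
  qed
  have "continuous_map (prod_topology ?I Z) (nsphere n) (\<lambda>(t, z). h t (f z))"
  proof (rule continuous_map_into_nsphere)
    fix i
    have t: "continuous_map (prod_topology ?I Z) euclideanreal fst"
      using continuous_map_fst continuous_map_into_fulltopology by blast
    have fi: "continuous_map (prod_topology ?I Z) euclideanreal (\<lambda>z. f (snd z) j)" for j
      using continuous_map_compose[OF continuous_map_compose[OF continuous_map_snd f]
          continuous_map_nsphere_projection[of n j]]
      by (simp add: o_def)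
    have ci: "continuous_map (prod_topology ?I Z) euclideanreal (\<lambda>z. c (f (snd z)))"
      unfolding c_def by (intro continuous_intros fi; simp)
    have di: "continuous_map (prod_topology ?I Z) euclideanreal (\<lambda>z. d (fst z) (f (snd z)) j)" for j
      unfolding d_def using c0 fS miss c0[OF sphere_base_in_nsphere ep]
      by (intro continuous_intros fi ci t) auto
    have "continuous_map (prod_topology ?I Z) euclideanreal (\<lambda>z. Q (fst z) (f (snd z)))"
      unfolding Q_def by (intro continuous_intros di; simp)
    then have "continuous_map (prod_topology ?I Z) euclideanreal (\<lambda>z. h (fst z) (f (snd z)) i)"
      unfolding h_def using Q0 fS miss
      by (intro continuous_intros di) auto
    then show "continuous_map (prod_topology ?I Z) euclideanreal (\<lambda>z. (case z of (t, z) \<Rightarrow> h t (f z)) i)"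
      by (simp add: case_prod_unfold)
  qed (auto simp: hS fS miss)
  then have "homotopic_with (\<lambda>h. h z0 = ?e) Z (nsphere n) (\<lambda>z. h 0 (f z)) (\<lambda>z. h 1 (f z))"
    unfolding homotopic_with_def
    by (intro exI[of _ "\<lambda>(t, z). h t (f z)"]) (auto simp: base he)
  then show ?thesis
    by (rule homotopic_with_eq) (auto simp: h0 h1 fS miss base z0)
qed

text \<open>A close Lipschitz approximation, corrected at the base point and projected radially, is
  homotopic to \<open>f\<close> and omits a point of the target. The case \<open>m = 0\<close> is
  included.\<close>

theorem homotopic_const_lower_nsphere:
  assumes mn: "m < n" and f: "continuous_map (nsphere m) (nsphere n) f"
    and base: "f sphere_base = sphere_base"
  shows "homotopic_with (\<lambda>h. h sphere_base = sphere_base) (nsphere m) (nsphere n) f (\<lambda>_. sphere_base)"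
proof -
  let ?S = "topspace (nsphere m)"
  let ?e = "sphere_base :: nat \<Rightarrow> real"
  \<comment> \<open>The correction at the base point doubles the error; \<open>n + 1\<close>
    coordinates with error \<open>2 * \<epsilon>\<close> add up to 1/2, which keeps the segments
    from \<open>f x\<close> to \<open>g x\<close> at distance at least 1/2 from the origin.\<close>
  define \<epsilon> :: real where "\<epsilon> = 1 / (4 * (n + 1))"
  have \<epsilon>: "\<epsilon> > 0"
    by (simp add: \<epsilon>_def)
  have fS: "f x \<in> topspace (nsphere n)" if "x \<in> ?S" for x
    using continuous_map_image_subset_topspace[OF f] that by blast
  have fc: "continuous_map (nsphere m) euclideanreal (\<lambda>x. f x j)" for j
    using continuous_map_compose[OF f continuous_map_nsphere_projection[of n j]] by (simp add: o_def)
  have "continuous_on ?S (\<lambda>x. f x j)" for j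
    using fc[of j] by (simp add: continuous_on_nsphere_iff)
  define \<Phi> where "\<Phi> j g L B \<longleftrightarrow> continuous_on ?S g
      \<and> (\<forall>x\<in>?S. \<bar>g x\<bar> \<le> B \<and> (\<forall>y\<in>?S. \<bar>g x - g y\<bar> \<le> L * (\<Sum>k\<le>m. \<bar>x k - y k\<bar>)))
      \<and> (\<forall>x\<in>?S. \<bar>f x j - g x\<bar> < \<epsilon>)" for j g and L B :: real
  have "\<forall>j. \<exists>g L B. \<Phi> j g L B"
    unfolding \<Phi>_def using nsphere_lipschitz_approximation[OF \<open>\<And>j. continuous_on ?S (\<lambda>x. f x j)\<close> \<epsilon>]
    by blast
  then obtain g' L B where "\<And>j. \<Phi> j (g' j) (L j) (B j)"
    by metis
  then have g': "\<And>j. continuous_on ?S (g' j)"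
      "\<And>j x. x \<in> ?S \<Longrightarrow> \<bar>g' j x\<bar> \<le> B j"
      "\<And>j x y. x \<in> ?S \<Longrightarrow> y \<in> ?S \<Longrightarrow> \<bar>g' j x - g' j y\<bar> \<le> L j * (\<Sum>k\<le>m. \<bar>x k - y k\<bar>)"
      "\<And>j x. x \<in> ?S \<Longrightarrow> \<bar>f x j - g' j x\<bar> < \<epsilon>"
    unfolding \<Phi>_def by blast+
  define g where "g x j = g' j x - g' j ?e + ?e j" for x j
  have ge: "g ?e = ?e"
    by (simp add: g_def fun_eq_iff)
  have gc: "continuous_map (nsphere m) euclideanreal (\<lambda>x. g x j)" for j
  proof -
    have "continuous_on ?S (\<lambda>x. g x j)"
      unfolding g_def by (intro continuous_intros g')
    then show ?thesis
      by (simp add: continuous_on_nsphere_iff)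
  qed
  have gclose: "\<bar>f x j - g x j\<bar> \<le> 2 * \<epsilon>" if "x \<in> ?S" for x j
    using g'(4)[OF that, of j] g'(4)[OF sphere_base_in_nsphere, of j]
    unfolding g_def base by linarith
  have gl2: "L2_set (\<lambda>j. f x j - g x j) {..n} \<le> 1 / 2" if "x \<in> ?S" for x
  proof -
    have "L2_set (\<lambda>j. f x j - g x j) {..n} \<le> (\<Sum>j\<le>n. \<bar>f x j - g x j\<bar>)"
      by (rule L2_set_le_sum_abs)
    also have "\<dots> \<le> (\<Sum>j\<le>n. 2 * \<epsilon>)"
      using gclose[OF that] by (intro sum_mono) auto
    also have "\<dots> = 1 / 2"
      by (simp add: \<epsilon>_def field_simps)
    finally show ?thesis .
  qed
  have seg: "1 / 2 \<le> L2_set (\<lambda>j. (1 - t) * f x j + t * g x j) {..n}"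
    if x: "x \<in> ?S" and t: "t \<in> {0..1}" for x t
  proof -
    have "1 = L2_set (\<lambda>j. ((1 - t) * f x j + t * g x j) + t * (f x j - g x j)) {..n}"
      using L2_set_nsphere[OF fS[OF x]] by (simp add: algebra_simps)
    also have "\<dots> \<le> L2_set (\<lambda>j. (1 - t) * f x j + t * g x j) {..n} + L2_set (\<lambda>j. t * (f x j - g x j)) {..n}"
      by (rule L2_set_triangle_ineq)
    also have "L2_set (\<lambda>j. t * (f x j - g x j)) {..n} = t * L2_set (\<lambda>j. f x j - g x j) {..n}"
      using t by (simp add: L2_set_right_distrib)
    also have "\<dots> \<le> 1 * (1 / 2)"
      using t gl2[OF x] by (intro mult_mono) auto
    finally show ?thesis
      by simp
  qed
  have "homotopic_with (\<lambda>h. h ?e = ?e) (nsphere m) (nsphere n)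
      (\<lambda>x. normalized n (f x)) (\<lambda>x. normalized n (g x))"
  proof (rule nsphere_linear_homotopy)
    fix x t assume "x \<in> ?S" "t \<in> {0..1::real}"
    then have "L2_set (\<lambda>j. (1 - t) * f x j + t * g x j) {..n} \<noteq> 0"
      using seg[of x t] by linarith
    then show "\<exists>j\<le>n. (1 - t) * f x j + t * g x j \<noteq> 0"
      by (auto simp: L2_set_eq_0_iff)
  qed (use fc gc base ge in auto)
  then have 1: "homotopic_with (\<lambda>h. h ?e = ?e) (nsphere m) (nsphere n) f (\<lambda>x. normalized n (g x))"
    by (rule homotopic_with_eq) (auto simp: fS base)
  define L0 where "L0 = (\<Sum>j\<le>n. \<bar>L j\<bar>)"
  define B0 where "B0 = (\<Sum>j\<le>n. \<bar>B j\<bar> + \<bar>g' j ?e\<bar> + \<bar>?e j\<bar>)"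
  obtain p where p: "p \<in> topspace (nsphere n)" "\<And>x. x \<in> ?S \<Longrightarrow> normalized n (g x) \<noteq> p"
  proof (rule lipschitz_map_misses_ray[OF mn, of L0 g B0 "1/2"])
    show "L0 \<ge> 0"
      by (simp add: L0_def sum_nonneg)
    fix x j assume x: "x \<in> ?S" and j: "j \<le> n"
    have "\<bar>B j\<bar> + \<bar>g' j ?e\<bar> + \<bar>?e j\<bar> \<le> B0"
      unfolding B0_def using j by (intro member_le_sum) auto
    then show "\<bar>g x j\<bar> \<le> B0"
      using g'(2)[OF x, of j] unfolding g_def by linarith
    fix y assume y: "y \<in> ?S"
    have "L j \<le> \<bar>L j\<bar>"
      by simp
    also have "\<dots> \<le> L0"
      unfolding L0_def using j by (intro member_le_sum) auto
    finally have "L j * (\<Sum>k\<le>m. \<bar>x k - y k\<bar>) \<le> L0 * (\<Sum>k\<le>m. \<bar>x k - y k\<bar>)"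
      by (intro mult_right_mono) (auto intro: sum_nonneg)
    then show "\<bar>g x j - g y j\<bar> \<le> L0 * (\<Sum>k\<le>m. \<bar>x k - y k\<bar>)"
      using g'(3)[OF x y, of j] by (simp add: g_def)
  next
    show "1 / 2 \<le> L2_set (g x) {..n}" if "x \<in> ?S" for x
      using seg[OF that, of 1] by simp
  qed (use that in auto)
  have "homotopic_with (\<lambda>h. h ?e = ?e) (nsphere m) (nsphere n) (\<lambda>x. normalized n (g x)) (\<lambda>_. ?e)"
    using homotopic_with_imp_continuous_maps[OF 1] p
    by (intro nonsurjective_imp_nullhomotopic[OF _ p(1)]) (simp_all add: ge)
  with 1 show ?thesis
    by (rule homotopic_with_trans)
qed

section \<open>Cones and coactions\<close>

abbreviation based_homotopic ::
  "'a topology \<Rightarrow> 'a \<Rightarrow> 'b topology \<Rightarrow> 'b \<Rightarrow> ('a \<Rightarrow> 'b) \<Rightarrow> ('a \<Rightarrow> 'b) \<Rightarrow> bool" where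
  "based_homotopic X x0 W w0 \<equiv> homotopic_with (\<lambda>h. h x0 = w0) X W"

lemma continuous_map_in_topspace:
  "continuous_map X Z f \<Longrightarrow> x \<in> topspace X \<Longrightarrow> f x \<in> topspace Z"
  using continuous_map_image_subset_topspace by blast

lemma based_homotopic_compose:
  assumes f: "based_homotopic X x0 V v0 f f'" and g: "based_homotopic V v0 W w0 g g'"
  shows "based_homotopic X x0 W w0 (g \<circ> f) (g' \<circ> f')"
proof (rule homotopic_with_trans)
  show "based_homotopic X x0 W w0 (g \<circ> f) (g \<circ> f')"
    using homotopic_with_imp_continuous_maps[OF g] homotopic_with_imp_property[OF g]
    by (intro homotopic_with_compose_continuous_map_left[OF f]) auto
  show "based_homotopic X x0 W w0 (g \<circ> f') (g' \<circ> f')"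
    using homotopic_with_imp_continuous_maps[OF f] homotopic_with_imp_property[OF f]
    by (intro homotopic_with_compose_continuous_map_right[OF g]) auto
qed

lemma based_homotopic_eq:
  assumes "based_homotopic X x0 W w0 f g" "x0 \<in> topspace X"
    and "\<And>x. x \<in> topspace X \<Longrightarrow> f' x = f x" "\<And>x. x \<in> topspace X \<Longrightarrow> g' x = g x"
  shows "based_homotopic X x0 W w0 f' g'"
  using assms by (intro homotopic_with_eq[OF assms(1)]) auto

text \<open>An open box inside one summand remains open in the sum: products distribute over
  disjoint sums.\<close>

lemma openin_prod_disjoint_sum:
  assumes "openin (prod_topology Z A) {(z, a). (z, Inl a) \<in> U}"
    and "openin (prod_topology Z B) {(z, b). (z, Inr b) \<in> U}"
  shows "openin (prod_topology Z (disjoint_sum A B)) U"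
  unfolding openin_prod_topology_alt
proof (intro allI impI)
  fix z c assume zc: "(z, c) \<in> U"
  show "\<exists>V V'. openin Z V \<and> openin (disjoint_sum A B) V' \<and> z \<in> V \<and> c \<in> V' \<and> V \<times> V' \<subseteq> U"
  proof (cases c)
    case (Inl a)
    then have "(z, a) \<in> {(z, a). (z, Inl a) \<in> U}"
      using zc by simp
    then obtain V V' where V: "openin Z V" "openin A V'" "z \<in> V" "a \<in> V'" "V \<times> V' \<subseteq> {(z, a). (z, Inl a) \<in> U}"
      using assms(1) unfolding openin_prod_topology_alt by meson
    then have "openin (disjoint_sum A B) (Inl ` V')"
      by (simp add: openin_disjoint_sum vimage_def image_iff)
    then show ?thesis
      using V Inl by (intro exI[of _ V] exI[of _ "Inl ` V'"]) auto
  next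
    case (Inr b)
    then have "(z, b) \<in> {(z, b). (z, Inr b) \<in> U}"
      using zc by simp
    then obtain V V' where V: "openin Z V" "openin B V'" "z \<in> V" "b \<in> V'" "V \<times> V' \<subseteq> {(z, b). (z, Inr b) \<in> U}"
      using assms(2) unfolding openin_prod_topology_alt by meson
    then have "openin (disjoint_sum A B) (Inr ` V')"
      by (simp add: openin_disjoint_sum vimage_def image_iff)
    then show ?thesis
      using V Inr by (intro exI[of _ V] exI[of _ "Inr ` V'"]) auto
  qed
qed

text \<open>With the unit interval for \<open>Z\<close>, homotopies may be given separately on the
  two pieces from which a cone or a wedge is glued.\<close>

lemma continuous_map_prod_disjoint_sum:
  assumes 1: "continuous_map (prod_topology Z A) W (\<lambda>(z, a). H (z, Inl a))"
    and 2: "continuous_map (prod_topology Z B) W (\<lambda>(z, b). H (z, Inr b))"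
  shows "continuous_map (prod_topology Z (disjoint_sum A B)) W H"
  unfolding continuous_map_alt
proof (intro conjI allI impI Pi_I)
  fix p assume p: "p \<in> topspace (prod_topology Z (disjoint_sum A B))"
  obtain z c where zc: "p = (z, c)"
    by (cases p)
  show "H p \<in> topspace W"
    using p continuous_map_in_topspace[OF 1] continuous_map_in_topspace[OF 2]
    by (cases c) (auto simp: zc)
next
  fix U assume U: "openin W U"
  show "openin (prod_topology Z (disjoint_sum A B)) (H -` U \<inter> topspace (prod_topology Z (disjoint_sum A B)))"
  proof (rule openin_prod_disjoint_sum)
    have "openin (prod_topology Z A) ((\<lambda>(z, a). H (z, Inl a)) -` U \<inter> topspace (prod_topology Z A))"
      using 1 U unfolding continuous_map_alt by blast
    then show "openin (prod_topology Z A) {(z, a). (z, Inl a) \<in> H -` U \<inter> topspace (prod_topology Z (disjoint_sum A B))}"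
      by (rule back_subst[of "openin (prod_topology Z A)"]) auto
    have "openin (prod_topology Z B) ((\<lambda>(z, b). H (z, Inr b)) -` U \<inter> topspace (prod_topology Z B))"
      using 2 U unfolding continuous_map_alt by blast
    then show "openin (prod_topology Z B) {(z, b). (z, Inr b) \<in> H -` U \<inter> topspace (prod_topology Z (disjoint_sum A B))}"
      by (rule back_subst[of "openin (prod_topology Z B)"]) auto
  qed
qed

lemma continuous_map_Inl: "continuous_map A (disjoint_sum A B) Inl"
proof -
  have "{x \<in> topspace A. Inl x \<in> U} = Inl -` U" if "openin A (Inl -` U)" for U :: "('a + 'b) set"
    using openin_subset[OF that] by auto
  then show ?thesis
    by (auto simp: continuous_map_def openin_disjoint_sum)
qed

lemma continuous_map_Inr: "continuous_map B (disjoint_sum A B) Inr"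
proof -
  have "{x \<in> topspace B. Inr x \<in> U} = Inr -` U" if "openin B (Inr -` U)" for U :: "('b + 'a) set"
    using openin_subset[OF that] by auto
  then show ?thesis
    by (auto simp: continuous_map_def openin_disjoint_sum)
qed

abbreviation unit_interval :: "real topology" where
  "unit_interval \<equiv> top_of_set {0..1}"

abbreviation hcylinder :: "nat \<Rightarrow> (real \<times> (nat \<Rightarrow> real) \<times> real) topology" where
  "hcylinder n \<equiv> prod_topology unit_interval (cylinder n)"

lemma continuous_map_hcylinder_coordinates:
  "continuous_map (hcylinder n) unit_interval fst"
  "continuous_map (hcylinder n) euclideanreal fst"
  "continuous_map (hcylinder n) (nsphere (n - 1)) (\<lambda>p. fst (snd p))"
  "continuous_map (hcylinder n) euclideanreal (\<lambda>p. snd (snd p))"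
proof -
  show "continuous_map (hcylinder n) unit_interval fst"
    by (rule continuous_map_fst)
  then show "continuous_map (hcylinder n) euclideanreal fst"
    using continuous_map_into_fulltopology by blast
  show "continuous_map (hcylinder n) (nsphere (n - 1)) (\<lambda>p. fst (snd p))"
    using continuous_map_compose[OF continuous_map_snd continuous_map_fst] by (simp add: o_def)
  have "continuous_map (hcylinder n) unit_interval (\<lambda>p. snd (snd p))"
    using continuous_map_compose[OF continuous_map_snd continuous_map_snd] by (simp add: o_def)
  then show "continuous_map (hcylinder n) euclideanreal (\<lambda>p. snd (snd p))"
    using continuous_map_into_fulltopology by blast
qed

lemma continuous_map_into_cylinder:
  assumes "continuous_map Z (nsphere (n - 1)) a" "continuous_map Z euclideanreal b"
    and "\<And>z. z \<in> topspace Z \<Longrightarrow> b z \<in> {0..1}"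
  shows "continuous_map Z (cylinder n) (\<lambda>z. (a z, b z))"
  using assms by (intro continuous_map_pairedI) (auto simp: continuous_map_in_subtopology)

declare topspace_disjoint_sum [simp del]

text \<open>A common frame for the mapping cone and for the sphere (the cone of the map to a point),
  so that the coaction and the addition of maps on spheres are treated at once.\<close>

locale cone_space =
  fixes n :: nat and Y :: "'a topology" and y0 :: 'a and \<gamma> :: "(nat \<Rightarrow> real) \<Rightarrow> 'a"
    and X :: "'x topology" and P :: "'a + (nat \<Rightarrow> real) \<times> real \<Rightarrow> 'x"
  assumes n: "n \<ge> 1"
    and y0: "y0 \<in> topspace Y"
    and \<gamma>: "continuous_map (nsphere (n - 1)) Y \<gamma>" "\<gamma> sphere_base = y0"
    and quot: "quotient_map (disjoint_sum Y (cylinder n)) X P"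
    and ker: "\<And>z w. \<lbrakk>z \<in> topspace (disjoint_sum Y (cylinder n)); w \<in> topspace (disjoint_sum Y (cylinder n))\<rbrakk>
      \<Longrightarrow> P z = P w \<longleftrightarrow> cone_rep \<gamma> y0 z = cone_rep \<gamma> y0 w"
begin

abbreviation "S \<equiv> topspace (nsphere (n - 1))"
abbreviation "D \<equiv> disjoint_sum Y (cylinder n)"

definition x0 where "x0 = P (Inl y0)"

lemma in_D [simp]:
  "Inl y \<in> topspace D \<longleftrightarrow> y \<in> topspace Y"
  "Inr (s, t) \<in> topspace D \<longleftrightarrow> s \<in> S \<and> t \<in> {0..1}"
  by (auto simp: topspace_disjoint_sum)

lemma \<gamma>_in: "s \<in> S \<Longrightarrow> \<gamma> s \<in> topspace Y"
  using continuous_map_in_topspace[OF \<gamma>(1)] .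

lemma P_collapse:
  "s \<in> S \<Longrightarrow> P (Inr (s, 0)) = x0"
  "t \<in> {0..1} \<Longrightarrow> P (Inr (sphere_base, t)) = x0"
  "s \<in> S \<Longrightarrow> P (Inr (s, 1)) = P (Inl (\<gamma> s))"
proof -
  show "P (Inr (s, 0)) = x0" if "s \<in> S"
    unfolding x0_def by (rule ker[THEN iffD2]) (simp_all only: in_D that y0, simp_all)
  show "P (Inr (sphere_base, t)) = x0" if "t \<in> {0..1}"
    unfolding x0_def by (rule ker[THEN iffD2]) (simp_all only: in_D that y0 sphere_base_in_nsphere, simp_all)
  show "P (Inr (s, 1)) = P (Inl (\<gamma> s))" if "s \<in> S"
    by (rule ker[THEN iffD2]) (simp_all only: in_D that \<gamma>_in, simp_all add: \<gamma>(2))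
qed

lemma P_in: "z \<in> topspace D \<Longrightarrow> P z \<in> topspace X"
  by (rule continuous_map_in_topspace[OF quotient_imp_continuous_map[OF quot]])

lemma x0_in: "x0 \<in> topspace X"
  unfolding x0_def using y0 by (intro P_in) simp

lemma P_cases [consumes 1, case_names Inl Inr]:
  assumes "x \<in> topspace X"
  obtains y where "y \<in> topspace Y" "x = P (Inl y)"
    | s t where "s \<in> S" "t \<in> {0..1}" "x = P (Inr (s, t))"
proof -
  obtain z where z: "z \<in> topspace D" "x = P z"
    using assms quotient_imp_surjective_map[OF quot] by blast
  show ?thesis
  proof (cases z)
    case (Inl y)
    then show ?thesis
      using z that(1) by simp
  next
    case (Inr p)
    then show ?thesis
      using z that(2)[of "fst p" "snd p"] by (cases p) simp
  qed
qed

lemma continuous_P: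
  "continuous_map Y X (\<lambda>y. P (Inl y))" "continuous_map (cylinder n) X (\<lambda>z. P (Inr z))"
  using continuous_map_compose[OF continuous_map_Inl quotient_imp_continuous_map[OF quot]]
    continuous_map_compose[OF continuous_map_Inr quotient_imp_continuous_map[OF quot]]
  by (simp_all add: o_def)

section \<open>Descent of maps and homotopies to the cone\<close>

definition compatible :: "('a + (nat \<Rightarrow> real) \<times> real \<Rightarrow> 'w) \<Rightarrow> bool" where
  "compatible u \<longleftrightarrow> (\<forall>s\<in>S. u (Inr (s, 0)) = u (Inl y0) \<and> u (Inr (s, 1)) = u (Inl (\<gamma> s)))
     \<and> (\<forall>t\<in>{0..1}. u (Inr (sphere_base, t)) = u (Inl y0))"

text \<open>The preimage picked by \<open>inv_into\<close> is immaterial for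
  \<open>compatible\<close> functions, which are constant on the fibres of \<open>P\<close>.\<close>

definition descend :: "('a + (nat \<Rightarrow> real) \<times> real \<Rightarrow> 'w) \<Rightarrow> 'x \<Rightarrow> 'w" where
  "descend u x = u (inv_into (topspace D) P x)"

lemma compatible_P_eq:
  assumes u: "compatible u" and zw: "z \<in> topspace D" "w \<in> topspace D" "P z = P w"
  shows "u z = u w"
proof -
  have "u z = u (cone_rep \<gamma> y0 z)" if "z \<in> topspace D" for z
  proof (cases z)
    case (Inr p)
    obtain s t where p: "p = (s, t)"
      by (cases p)
    then have "s \<in> S" "t \<in> {0..1}"
      using that Inr by auto
    then show ?thesis
      using u \<gamma>(2) by (auto simp: Inr p compatible_def)
  qed simp
  then show ?thesis
    using zw ker by metis
qed

lemma descend_P: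
  assumes "compatible u" "z \<in> topspace D"
  shows "descend u (P z) = u z"
proof -
  have Pz: "P z \<in> P ` topspace D"
    by (rule imageI[OF assms(2)])
  show ?thesis
    unfolding descend_def
    by (rule compatible_P_eq[OF assms(1) inv_into_into[OF Pz] assms(2) f_inv_into_f[OF Pz]])
qed

text \<open>The interval is locally compact and Hausdorff, so its product with the quotient map
  \<open>P\<close> is again a quotient map; continuity is therefore tested on \<open>Y\<close> and
  on the cylinder.\<close>

lemma homotopicI:
  assumes contY: "continuous_map (prod_topology unit_interval Y) W (\<lambda>(\<tau>, y). H \<tau> (Inl y))"
    and contC: "continuous_map (hcylinder n) W (\<lambda>p. H (fst p) (Inr (snd p)))"
    and comp: "\<And>\<tau>. \<tau> \<in> {0..1} \<Longrightarrow> compatible (H \<tau>)"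
    and base: "\<And>\<tau>. \<tau> \<in> {0..1} \<Longrightarrow> H \<tau> (Inl y0) = w0"
    and f: "\<And>y. y \<in> topspace Y \<Longrightarrow> f (P (Inl y)) = H 0 (Inl y)"
      "\<And>s t. \<lbrakk>s \<in> S; t \<in> {0..1}\<rbrakk> \<Longrightarrow> f (P (Inr (s, t))) = H 0 (Inr (s, t))"
    and g: "\<And>y. y \<in> topspace Y \<Longrightarrow> g (P (Inl y)) = H 1 (Inl y)"
      "\<And>s t. \<lbrakk>s \<in> S; t \<in> {0..1}\<rbrakk> \<Longrightarrow> g (P (Inr (s, t))) = H 1 (Inr (s, t))"
  shows "based_homotopic X x0 W w0 f g"
proof -
  define K where "K = (\<lambda>(\<tau>, x). descend (H \<tau>) x)"
  let ?Q = "\<lambda>(\<tau>, z). (\<tau>, P z)"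
  have q: "quotient_map (prod_topology unit_interval D) (prod_topology unit_interval X) ?Q"
    by (intro quotient_map_prod_right quot)
      (auto simp: Hausdorff_space_subtopology compact_imp_locally_compact_space compact_space_subtopology)
  have KQ: "K (?Q p) = (\<lambda>(\<tau>, z). H \<tau> z) p" if "p \<in> topspace (prod_topology unit_interval D)" for p
    using that comp by (cases p) (simp add: K_def descend_P)
  have "continuous_map (prod_topology unit_interval D) W (\<lambda>(\<tau>, z). H \<tau> z)"
    using contY contC by (intro continuous_map_prod_disjoint_sum) (simp_all add: case_prod_unfold)
  then have "continuous_map (prod_topology unit_interval D) W (K \<circ> ?Q)"
    by (rule continuous_map_eq) (simp only: KQ o_apply)
  then have "continuous_map (prod_topology unit_interval X) W K"
    by (rule continuous_compose_quotient_map[OF q])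
  moreover have "K (\<tau>, x0) = w0" if "\<tau> \<in> {0..1}" for \<tau>
    using that comp base y0 by (simp add: K_def x0_def descend_P)
  ultimately have K01: "based_homotopic X x0 W w0 (\<lambda>x. K (0, x)) (\<lambda>x. K (1, x))"
    unfolding homotopic_with_def by (intro exI[of _ K]) auto
  have "f x = K (0, x)" "g x = K (1, x)" if "x \<in> topspace X" for x
    using that comp by (cases x rule: P_cases; simp add: K_def descend_P f g)+
  then show ?thesis
    by (rule based_homotopic_eq[OF K01 x0_in])
qed

text \<open>The stationary case of \<open>homotopicI\<close>, based at \<open>f x0\<close>.\<close>

lemma continuousI:
  assumes "continuous_map Y W (\<lambda>y. f (P (Inl y)))" "continuous_map (cylinder n) W (\<lambda>z. f (P (Inr z)))"
  shows "continuous_map X W f"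
proof -
  have "based_homotopic X x0 W (f x0) f f"
  proof (rule homotopicI[where H = "\<lambda>_ z. f (P z)"])
    show "continuous_map (prod_topology unit_interval Y) W (\<lambda>(\<tau>, y). f (P (Inl y)))"
      using continuous_map_compose[OF continuous_map_snd assms(1)] by (simp add: o_def case_prod_unfold)
    show "continuous_map (hcylinder n) W (\<lambda>p. f (P (Inr (snd p))))"
      using continuous_map_compose[OF continuous_map_snd assms(2)] by (simp add: o_def)
    show "compatible (\<lambda>z. f (P z))"
      by (simp add: compatible_def P_collapse flip: x0_def)
  qed (simp_all add: x0_def)
  then show ?thesis
    by simp
qed

text \<open>On the mapping cone this is \<open>f^\<alpha>\<close>; on the sphere, viewed as a cone,
  it is the sum with \<alpha> on the first half and \<open>f\<close> on the second.\<close>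

definition coaction_map :: "('x \<Rightarrow> 'w) \<Rightarrow> ((nat \<Rightarrow> real) \<Rightarrow> 'w) \<Rightarrow> 'x \<Rightarrow> 'w" where
  "coaction_map f \<alpha> = descend (case_sum (\<lambda>y. f (P (Inl y)))
     (\<lambda>(s, t). if t \<le> 1/2 then \<alpha> (sphere_susp n (s, 2 * t)) else f (P (Inr (s, 2 * t - 1)))))"

text \<open>At \<open>t = 1/2\<close> both formulas give \<open>w0\<close>, so each is valid on a
  closed half.\<close>

lemma coaction_map:
  assumes "f x0 = w0" "\<alpha> sphere_base = w0"
  shows "y \<in> topspace Y \<Longrightarrow> coaction_map f \<alpha> (P (Inl y)) = f (P (Inl y))"
    and "\<lbrakk>s \<in> S; 0 \<le> t; t \<le> 1/2\<rbrakk> \<Longrightarrow> coaction_map f \<alpha> (P (Inr (s, t))) = \<alpha> (sphere_susp n (s, 2 * t))"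
    and "\<lbrakk>s \<in> S; 1/2 \<le> t; t \<le> 1\<rbrakk> \<Longrightarrow> coaction_map f \<alpha> (P (Inr (s, t))) = f (P (Inr (s, 2 * t - 1)))"
proof -
  have c: "compatible (case_sum (\<lambda>y. f (P (Inl y)))
     (\<lambda>(s, t). if t \<le> 1/2 then \<alpha> (sphere_susp n (s, 2 * t)) else f (P (Inr (s, 2 * t - 1)))))"
    using assms by (auto simp: compatible_def P_collapse simp flip: x0_def)
  show "y \<in> topspace Y \<Longrightarrow> coaction_map f \<alpha> (P (Inl y)) = f (P (Inl y))"
    unfolding coaction_map_def by (subst descend_P[OF c]) auto
  show "\<lbrakk>s \<in> S; 0 \<le> t; t \<le> 1/2\<rbrakk> \<Longrightarrow> coaction_map f \<alpha> (P (Inr (s, t))) = \<alpha> (sphere_susp n (s, 2 * t))"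
    unfolding coaction_map_def by (subst descend_P[OF c]) auto
  show "coaction_map f \<alpha> (P (Inr (s, t))) = f (P (Inr (s, 2 * t - 1)))" if "s \<in> S" "1/2 \<le> t" "t \<le> 1"
  proof (cases "t = 1/2")
    case True
    then show ?thesis
      using that assms unfolding coaction_map_def True
      by (subst descend_P[OF c]) (simp_all add: P_collapse)
  next
    case False
    then show ?thesis
      using that unfolding coaction_map_def by (subst descend_P[OF c]) auto
  qed
qed

lemma coaction_map_base [simp]:
  assumes "f x0 = w0" "\<alpha> sphere_base = w0"
  shows "coaction_map f \<alpha> x0 = w0"
  using coaction_map(1)[where f = f and \<alpha> = \<alpha> and y = y0] assms y0 by (simp add: x0_def)

lemma coaction_map_homotopic:
  assumes f: "based_homotopic X x0 W w0 f f'"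
    and \<alpha>: "based_homotopic (nsphere n) sphere_base W w0 \<alpha> \<alpha>'"
  shows "based_homotopic X x0 W w0 (coaction_map f \<alpha>) (coaction_map f' \<alpha>')"
proof -
  obtain F where F: "continuous_map (prod_topology unit_interval X) W F"
      "\<And>x. F (0, x) = f x" "\<And>x. F (1, x) = f' x" "\<And>\<tau>. \<tau> \<in> {0..1} \<Longrightarrow> F (\<tau>, x0) = w0"
    using f unfolding homotopic_with_def by auto
  obtain A where A: "continuous_map (prod_topology unit_interval (nsphere n)) W A"
      "\<And>x. A (0, x) = \<alpha> x" "\<And>x. A (1, x) = \<alpha>' x" "\<And>\<tau>. \<tau> \<in> {0..1} \<Longrightarrow> A (\<tau>, sphere_base) = w0"
    using \<alpha> unfolding homotopic_with_def by auto
  \<comment> \<open>Clamping by \<open>min\<close> and \<open>max\<close> changes nothing on the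
    half where a branch is used, but makes each branch continuous on the whole cylinder.\<close>
  define H where "H \<tau> = case_sum (\<lambda>y. F (\<tau>, P (Inl y)))
     (\<lambda>(s, t). if t \<le> 1/2 then A (\<tau>, sphere_susp n (s, min 1 (2 * t)))
               else F (\<tau>, P (Inr (s, max 0 (2 * t - 1)))))" for \<tau>
  have fb: "f x0 = w0" "f' x0 = w0" "\<alpha> sphere_base = w0" "\<alpha>' sphere_base = w0"
    using F(2,3)[of x0] A(2,3)[of sphere_base] F(4)[of 0] F(4)[of 1] A(4)[of 0] A(4)[of 1] by auto
  show ?thesis
  proof (rule homotopicI[where H = H])
    have "continuous_map (prod_topology unit_interval Y) (prod_topology unit_interval X) (\<lambda>p. (fst p, P (Inl (snd p))))"
      using continuous_map_compose[OF continuous_map_snd continuous_P(1)]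
      by (intro continuous_map_pairedI continuous_map_fst) (simp add: o_def)
    then show "continuous_map (prod_topology unit_interval Y) W (\<lambda>(\<tau>, y). H \<tau> (Inl y))"
      using continuous_map_compose[OF _ F(1)] by (fastforce simp: H_def o_def case_prod_unfold)
    note coord = continuous_map_hcylinder_coordinates
    have "continuous_map (hcylinder n) (nsphere n) (\<lambda>p. sphere_susp n (fst (snd p), min 1 (2 * snd (snd p))))"
      by (rule continuous_map_compose[OF _ continuous_map_sphere_susp[OF n], unfolded o_def])
        (intro continuous_map_into_cylinder continuous_map_real_compose[of _ _ "\<lambda>t. min 1 (2 * t)"]
          coord continuous_intros; auto)
    then have 1: "continuous_map (hcylinder n) W (\<lambda>p. A (fst p, sphere_susp n (fst (snd p), min 1 (2 * snd (snd p)))))"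
      by (intro continuous_map_compose[OF _ A(1), unfolded o_def] continuous_map_pairedI coord)
    have "continuous_map (hcylinder n) X (\<lambda>p. P (Inr (fst (snd p), max 0 (2 * snd (snd p) - 1))))"
      by (rule continuous_map_compose[OF _ continuous_P(2), unfolded o_def])
        (intro continuous_map_into_cylinder continuous_map_real_compose[of _ _ "\<lambda>t. max 0 (2 * t - 1)"]
          coord continuous_intros; auto)
    then have 2: "continuous_map (hcylinder n) W (\<lambda>p. F (fst p, P (Inr (fst (snd p), max 0 (2 * snd (snd p) - 1)))))"
      by (intro continuous_map_compose[OF _ F(1), unfolded o_def] continuous_map_pairedI coord)
    have "continuous_map (hcylinder n) W (\<lambda>p. if snd (snd p) \<le> 1/2
        then A (fst p, sphere_susp n (fst (snd p), min 1 (2 * snd (snd p))))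
        else F (fst p, P (Inr (fst (snd p), max 0 (2 * snd (snd p) - 1)))))"
      by (intro continuous_map_cases_le coord continuous_map_from_subtopology[OF 1]
          continuous_map_from_subtopology[OF 2])
        (auto simp: P_collapse A F)
    then show "continuous_map (hcylinder n) W (\<lambda>p. H (fst p) (Inr (snd p)))"
      by (simp add: H_def case_prod_unfold)
    show "compatible (H \<tau>)" "H \<tau> (Inl y0) = w0" if "\<tau> \<in> {0..1}" for \<tau>
      using that by (auto simp: compatible_def H_def P_collapse A F simp flip: x0_def)
    show "coaction_map f \<alpha> (P (Inr (s, t))) = H 0 (Inr (s, t))"
        "coaction_map f' \<alpha>' (P (Inr (s, t))) = H 1 (Inr (s, t))" if "s \<in> S" "t \<in> {0..1}" for s t
      using that fb by (auto simp: H_def coaction_map(2,3) F A)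
  qed (use fb in \<open>simp_all add: H_def coaction_map(1) F\<close>)
qed

lemma continuous_coaction_map:
  assumes "continuous_map X W f" "f x0 = w0" "continuous_map (nsphere n) W \<alpha>" "\<alpha> sphere_base = w0"
  shows "continuous_map X W (coaction_map f \<alpha>)"
  using coaction_map_homotopic[where f = f and f' = f and \<alpha> = \<alpha> and \<alpha>' = \<alpha> and W = W and ?w0.0 = w0] assms
  by simp

section \<open>Homotopies by reparametrising the cone coordinate\<close>

definition reparam :: "(real \<Rightarrow> real) \<Rightarrow> bool" where
  "reparam \<phi> \<longleftrightarrow> continuous_on UNIV \<phi> \<and> \<phi> ` {0..1} \<subseteq> {0..1} \<and> \<phi> 0 = 0 \<and> \<phi> 1 = 1"

text \<open>Reparametrisations form a convex set, and fixing both ends is what the gluing of the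
  cone demands. Two independent parameters, for \<open>X\<close> and for the sphere, cover the unit
  law, associativity, the slide to the axes and the commutation of Gottlieb elements.\<close>

lemma reparam_homotopic:
  assumes a: "continuous_map (prod_topology X (nsphere n)) W a" "a (x0, sphere_base) = w0"
    and \<phi>: "reparam \<phi>" "reparam \<psi>" "reparam \<phi>'" "reparam \<psi>'"
    and f: "\<And>y. y \<in> topspace Y \<Longrightarrow> f (P (Inl y)) = a (P (Inl y), sphere_base)"
      "\<And>s t. \<lbrakk>s \<in> S; 0 \<le> t; t \<le> 1\<rbrakk> \<Longrightarrow> f (P (Inr (s, t))) = a (P (Inr (s, \<phi> t)), sphere_susp n (s, \<psi> t))"
    and g: "\<And>y. y \<in> topspace Y \<Longrightarrow> g (P (Inl y)) = a (P (Inl y), sphere_base)"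
      "\<And>s t. \<lbrakk>s \<in> S; 0 \<le> t; t \<le> 1\<rbrakk> \<Longrightarrow> g (P (Inr (s, t))) = a (P (Inr (s, \<phi>' t)), sphere_susp n (s, \<psi>' t))"
  shows "based_homotopic X x0 W w0 f g"
proof -
  define mix where "mix \<phi> \<phi>' \<tau> t = (1 - \<tau>) * \<phi> t + \<tau> * \<phi>' t" for \<phi> \<phi>' :: "real \<Rightarrow> real" and \<tau> t
  have mix_in: "0 \<le> mix \<phi> \<phi>' \<tau> t \<and> mix \<phi> \<phi>' \<tau> t \<le> 1"
    if "reparam \<phi>" "reparam \<phi>'" "0 \<le> \<tau>" "\<tau> \<le> 1" "0 \<le> t" "t \<le> 1" for \<phi> \<phi>' \<tau> t
  proof -
    have "\<phi> t \<in> {0..1}" "\<phi>' t \<in> {0..1}"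
      using that by (auto simp: reparam_def image_subset_iff)
    then have "(1 - \<tau>) *\<^sub>R \<phi> t + \<tau> *\<^sub>R \<phi>' t \<in> {0..1}"
      using that by (intro convexD_alt) auto
    then show ?thesis
      by (simp add: mix_def)
  qed
  have mix_end: "mix \<phi> \<phi>' \<tau> 0 = 0" "mix \<phi> \<phi>' \<tau> 1 = 1" if "reparam \<phi>" "reparam \<phi>'" for \<phi> \<phi>' \<tau>
    using that by (simp_all add: mix_def reparam_def)
  note coord = continuous_map_hcylinder_coordinates
  have mix_cont: "continuous_map (hcylinder n) (cylinder n) (\<lambda>p. (fst (snd p), mix \<phi> \<phi>' (fst p) (snd (snd p))))"
    if "reparam \<phi>" "reparam \<phi>'" for \<phi> \<phi>'
    using that mix_in[OF that] unfolding mix_def reparam_def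
    by (intro continuous_map_into_cylinder continuous_intros coord
        continuous_map_real_compose[OF coord(4), of \<phi>] continuous_map_real_compose[OF coord(4), of \<phi>']) auto
  define H where "H \<tau> = case_sum (\<lambda>y. a (P (Inl y), sphere_base))
     (\<lambda>(s, t). a (P (Inr (s, mix \<phi> \<phi>' \<tau> t)), sphere_susp n (s, mix \<psi> \<psi>' \<tau> t)))" for \<tau>
  show ?thesis
  proof (rule homotopicI[where H = H])
    have "continuous_map (prod_topology unit_interval Y) (prod_topology X (nsphere n)) (\<lambda>p. (P (Inl (snd p)), sphere_base))"
      using continuous_map_compose[OF continuous_map_snd continuous_P(1)]
      by (intro continuous_map_pairedI) (simp_all add: o_def)
    then show "continuous_map (prod_topology unit_interval Y) W (\<lambda>(\<tau>, y). H \<tau> (Inl y))"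
      using continuous_map_compose[OF _ a(1)] by (fastforce simp: H_def o_def case_prod_unfold)
    have "continuous_map (hcylinder n) W
        (\<lambda>p. a (P (Inr (fst (snd p), mix \<phi> \<phi>' (fst p) (snd (snd p)))),
                sphere_susp n (fst (snd p), mix \<psi> \<psi>' (fst p) (snd (snd p)))))"
      by (intro continuous_map_compose[OF _ a(1), unfolded o_def] continuous_map_pairedI
          continuous_map_compose[OF _ continuous_P(2), unfolded o_def]
          continuous_map_compose[OF _ continuous_map_sphere_susp[OF n], unfolded o_def] mix_cont \<phi>)
    then show "continuous_map (hcylinder n) W (\<lambda>p. H (fst p) (Inr (snd p)))"
      by (simp add: H_def case_prod_unfold)
    show "H \<tau> (Inl y0) = w0" for \<tau>
      by (simp add: H_def a(2) flip: x0_def)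
    show "compatible (H \<tau>)" if "\<tau> \<in> {0..1}" for \<tau>
      unfolding compatible_def
    proof (intro conjI ballI)
      fix s assume s: "s \<in> S"
      show "H \<tau> (Inr (s, 0)) = H \<tau> (Inl y0)" "H \<tau> (Inr (s, 1)) = H \<tau> (Inl (\<gamma> s))"
        by (simp_all add: H_def mix_end \<phi> P_collapse(1,3)[OF s] flip: x0_def)
    next
      fix t :: real assume "t \<in> {0..1}"
      then have "mix \<phi> \<phi>' \<tau> t \<in> {0..1}"
        using mix_in[OF \<phi>(1,3)] that by simp
      from P_collapse(2)[OF this] show "H \<tau> (Inr (sphere_base, t)) = H \<tau> (Inl y0)"
        by (simp add: H_def flip: x0_def)
    qed
  qed (simp_all add: H_def f g mix_def)
qed

text \<open>The last map is piecewise linear with breaks at 1/2 and 3/4 and slopes 1/2, 1, 2; being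
  convex, it is the maximum of its affine pieces. It serves associativity.\<close>

lemma reparam_intros:
  "reparam (\<lambda>t. t)" "reparam (\<lambda>t. min 1 (2 * t))" "reparam (\<lambda>t. max 0 (2 * t - 1))"
  "reparam (\<lambda>t. max (t / 2) (max (t - 1 / 4) (2 * t - 1)))"
  unfolding reparam_def by (intro conjI continuous_intros; auto simp: max_def)+

text \<open>The coaction by a constant is \<open>f\<close> with the cone coordinate held at 0 during
  the apex half.\<close>

lemma coaction_map_const:
  assumes f: "continuous_map X W f" "f x0 = w0"
  shows "based_homotopic X x0 W w0 (coaction_map f (\<lambda>_. w0)) f"
proof (rule reparam_homotopic[where a = "f \<circ> fst" and \<phi> = "\<lambda>t. max 0 (2 * t - 1)"
      and \<psi> = "\<lambda>t. t" and \<phi>' = "\<lambda>t. t" and \<psi>' = "\<lambda>t. t"])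
  show "continuous_map (prod_topology X (nsphere n)) W (f \<circ> fst)"
    by (rule continuous_map_compose[OF continuous_map_fst f(1)])
  show "coaction_map f (\<lambda>_. w0) (P (Inr (s, t)))
      = (f \<circ> fst) (P (Inr (s, max 0 (2 * t - 1))), sphere_susp n (s, t))"
    if "s \<in> S" "0 \<le> t" "t \<le> 1" for s t
    using that f by (cases "t \<le> 1/2") (simp_all add: coaction_map[where ?w0.0 = w0] P_collapse max_absorb1 max_absorb2)
qed (use f in \<open>simp_all add: coaction_map[where ?w0.0 = w0] reparam_intros\<close>)

text \<open>On the left \<beta>, \<alpha> and \<open>f\<close> occupy \<open>[0, 1/2]\<close>,
  \<open>[1/2, 3/4]\<close>, \<open>[3/4, 1]\<close>; on the right \<open>[0, 1/4]\<close>,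
  \<open>[1/4, 1/2]\<close>, \<open>[1/2, 1]\<close>. The sum \<theta>, with \<beta> first, is
  described by its values so that any construction of it fits.\<close>

lemma coaction_map_assoc:
  assumes f: "continuous_map X W f" "f x0 = w0"
    and \<alpha>: "\<alpha> sphere_base = w0" and \<beta>: "\<beta> sphere_base = w0"
    and \<theta>: "continuous_map (nsphere n) W \<theta>" "\<theta> sphere_base = w0"
      "\<And>s t. \<lbrakk>s \<in> S; 0 \<le> t; t \<le> 1/2\<rbrakk> \<Longrightarrow> \<theta> (sphere_susp n (s, t)) = \<beta> (sphere_susp n (s, 2 * t))"
      "\<And>s t. \<lbrakk>s \<in> S; 1/2 \<le> t; t \<le> 1\<rbrakk> \<Longrightarrow> \<theta> (sphere_susp n (s, t)) = \<alpha> (sphere_susp n (s, 2 * t - 1))"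
  shows "based_homotopic X x0 W w0 (coaction_map (coaction_map f \<alpha>) \<beta>) (coaction_map f \<theta>)"
proof (rule reparam_homotopic[where a = "coaction_map f \<theta> \<circ> fst"
      and \<phi> = "\<lambda>t. max (t / 2) (max (t - 1 / 4) (2 * t - 1))"
      and \<psi> = "\<lambda>t. t" and \<phi>' = "\<lambda>t. t" and \<psi>' = "\<lambda>t. t"])
  note fb = f(2) \<alpha> \<beta> \<theta>(2)
  note cm = coaction_map[where ?w0.0 = w0]
  show "continuous_map (prod_topology X (nsphere n)) W (coaction_map f \<theta> \<circ> fst)"
    by (rule continuous_map_compose[OF continuous_map_fst continuous_coaction_map[OF f \<theta>(1,2)]])
  show "coaction_map (coaction_map f \<alpha>) \<beta> (P (Inr (s, t)))
     = (coaction_map f \<theta> \<circ> fst) (P (Inr (s, max (t / 2) (max (t - 1 / 4) (2 * t - 1)))), sphere_susp n (s, t))"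
    if s: "s \<in> S" and t: "0 \<le> t" "t \<le> 1" for s t
  proof -
    consider "t \<le> 1/2" | "1/2 \<le> t" "t \<le> 3/4" | "3/4 \<le> t"
      by linarith
    then show ?thesis
    proof cases
      case 1
      then have m: "max (t / 2) (max (t - 1 / 4) (2 * t - 1)) = t / 2"
        by (simp add: max_def)
      show ?thesis
        unfolding m using 1 s t fb by (simp add: cm \<theta>)
    next
      case 2
      then have m: "max (t / 2) (max (t - 1 / 4) (2 * t - 1)) = t - 1 / 4"
        by (simp add: max_def)
      have "2 * (t - 1 / 4) = 2 * t - 1 / 2" "2 * (2 * t - 1 / 2) - 1 = 2 * (2 * t - 1)"
        by simp_all
      then show ?thesis
        unfolding m using 2 s t fb by (simp add: cm \<theta>)
    next
      case 3
      then have m: "max (t / 2) (max (t - 1 / 4) (2 * t - 1)) = 2 * t - 1"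
        by (simp add: max_def)
      show ?thesis
        unfolding m using 3 s t fb by (simp add: cm)
    qed
  qed
qed (use f \<alpha> \<beta> \<theta> in \<open>simp_all add: coaction_map[where ?w0.0 = w0] reparam_intros\<close>)

section \<open>The pinching map onto the sphere\<close>

definition pinch :: "'x \<Rightarrow> nat \<Rightarrow> real" where
  "pinch = descend (case_sum (\<lambda>_. sphere_base) (sphere_susp n))"

lemma pinch:
  "y \<in> topspace Y \<Longrightarrow> pinch (P (Inl y)) = sphere_base"
  "\<lbrakk>s \<in> S; 0 \<le> t; t \<le> 1\<rbrakk> \<Longrightarrow> pinch (P (Inr (s, t))) = sphere_susp n (s, t)"
proof -
  have "compatible (case_sum (\<lambda>_. sphere_base) (sphere_susp n))"
    by (simp add: compatible_def)
  note p = descend_P[OF this]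
  show "y \<in> topspace Y \<Longrightarrow> pinch (P (Inl y)) = sphere_base"
    "\<lbrakk>s \<in> S; 0 \<le> t; t \<le> 1\<rbrakk> \<Longrightarrow> pinch (P (Inr (s, t))) = sphere_susp n (s, t)"
    by (simp_all add: pinch_def p)
qed

lemma pinch_base [simp]: "pinch x0 = sphere_base"
  using pinch(1)[OF y0] by (simp add: x0_def)

lemma continuous_pinch: "continuous_map X (nsphere n) pinch"
proof (rule continuousI)
  show "continuous_map Y (nsphere n) (\<lambda>y. pinch (P (Inl y)))"
    by (rule continuous_map_eq[of _ _ "\<lambda>_. sphere_base"]) (simp_all add: pinch)
  show "continuous_map (cylinder n) (nsphere n) (\<lambda>z. pinch (P (Inr z)))"
    by (rule continuous_map_eq[OF continuous_map_sphere_susp[OF n]]) (auto simp: pinch)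
qed

text \<open>The homotopy slides the two coordinates of \<open>x \<mapsto> (x, q x)\<close> apart until it traverses
  the axes of \<open>X \<times> S\<^sup>n\<close> one after the other.\<close>

lemma coaction_map_axes:
  assumes a: "continuous_map (prod_topology X (nsphere n)) W a" "a (x0, sphere_base) = w0"
  shows "based_homotopic X x0 W w0 (\<lambda>x. a (x, pinch x))
     (coaction_map (\<lambda>x. a (x, sphere_base)) (\<lambda>s. a (x0, s)))"
proof (rule reparam_homotopic[OF a, where \<phi> = "\<lambda>t. t" and \<psi> = "\<lambda>t. t"
      and \<phi>' = "\<lambda>t. max 0 (2 * t - 1)" and \<psi>' = "\<lambda>t. min 1 (2 * t)"])
  note cm = coaction_map[where ?w0.0 = w0]
  show "coaction_map (\<lambda>x. a (x, sphere_base)) (\<lambda>s. a (x0, s)) (P (Inr (s, t)))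
    = a (P (Inr (s, max 0 (2 * t - 1))), sphere_susp n (s, min 1 (2 * t)))"
    if "s \<in> S" "0 \<le> t" "t \<le> 1" for s t
    using that a(2) by (cases "t \<le> 1/2") (simp_all add: cm P_collapse max_absorb1 max_absorb2 min_absorb1 min_absorb2)
qed (use a in \<open>simp_all add: coaction_map[where ?w0.0 = w0] reparam_intros pinch\<close>)

text \<open>The slide to the axes for \<open>\<alpha> \<circ> snd\<close>, which is constant on the
  axis \<open>X\<close>.\<close>

lemma coaction_map_const_left:
  assumes \<alpha>: "continuous_map (nsphere n) W \<alpha>" "\<alpha> sphere_base = w0"
  shows "based_homotopic X x0 W w0 (\<alpha> \<circ> pinch) (coaction_map (\<lambda>_. w0) \<alpha>)"
proof -
  have "continuous_map (prod_topology X (nsphere n)) W (\<alpha> \<circ> snd)"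
    by (rule continuous_map_compose[OF continuous_map_snd \<alpha>(1)])
  from coaction_map_axes[OF this, of w0] show ?thesis
    using \<alpha> by (simp add: o_def)
qed

end

section \<open>The coaction in homology\<close>

lemma cone_space_mapping_cone:
  assumes "n \<ge> 1" "y0 \<in> topspace Y" "continuous_map (nsphere (n - 1)) Y \<gamma>" "\<gamma> sphere_base = y0"
  shows "cone_space n Y y0 \<gamma> (mapping_cone n Y y0 \<gamma>) (cone_rep \<gamma> y0)"
proof
  show "quotient_map (disjoint_sum Y (cylinder n)) (mapping_cone n Y y0 \<gamma>) (cone_rep \<gamma> y0)"
    unfolding mapping_cone_def by (rule quotient_map_quotient_topology)
qed (use assms in auto)

text \<open>In the cone of the map to a point both ends of the cylinder and the segment over the
  base point become one point, which is exactly the collapse made by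
  \<open>sphere_susp\<close>.\<close>

lemma cone_space_nsphere:
  assumes n: "n \<ge> 1"
  shows "cone_space n (top_of_set {sphere_base}) sphere_base (\<lambda>_. sphere_base) (nsphere n)
     (case_sum (\<lambda>_. sphere_base) (sphere_susp n))"
proof
  let ?Y = "top_of_set {sphere_base :: nat \<Rightarrow> real}"
  let ?D = "disjoint_sum ?Y (cylinder n)"
  let ?P = "case_sum (\<lambda>_. sphere_base) (sphere_susp n)"
  let ?S = "topspace (nsphere (n - 1))"
  have q: "quotient_map (cylinder n) (nsphere n) (sphere_susp n)"
    by (rule quotient_map_sphere_susp[OF n])
  show "quotient_map ?D (nsphere n) ?P"
    unfolding quotient_map_def
  proof (intro conjI allI impI)
    have "sphere_susp n ` topspace (cylinder n) = topspace (nsphere n)"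
      by (rule quotient_imp_surjective_map[OF q])
    moreover have "sphere_base \<in> topspace (nsphere n)"
      by simp
    ultimately show "?P ` topspace ?D = topspace (nsphere n)"
      by (simp add: topspace_disjoint_sum image_Un image_image insert_absorb)
    fix U assume U: "U \<subseteq> topspace (nsphere n)"
    have "Inr -` {x \<in> topspace ?D. ?P x \<in> U} = {x \<in> topspace (cylinder n). sphere_susp n x \<in> U}"
      by (auto simp: topspace_disjoint_sum)
    moreover have "Inl -` {x \<in> topspace ?D. ?P x \<in> U} = {x \<in> topspace ?Y. x \<in> U}"
      by (auto simp: topspace_disjoint_sum)
    moreover have "openin ?Y {x \<in> topspace ?Y. x \<in> U}"
      by (cases "sphere_base \<in> U") (simp_all add: openin_subtopology_refl conj_commute cong: conj_cong)
    ultimately show "openin ?D {x \<in> topspace ?D. ?P x \<in> U} \<longleftrightarrow> openin (nsphere n) U"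
      using q U unfolding quotient_map_def openin_disjoint_sum by simp
  qed
  show "?P z = ?P w \<longleftrightarrow> cone_rep (\<lambda>_. sphere_base) sphere_base z = cone_rep (\<lambda>_. sphere_base) sphere_base w"
    if z: "z \<in> topspace ?D" and w: "w \<in> topspace ?D" for z w
  proof -
    \<comment> \<open>A point is collapsed to the base point by both maps or by neither; on the
      points of the second kind \<open>sphere_susp\<close> is injective.\<close>
    have rep: "(cone_rep (\<lambda>_. sphere_base) sphere_base v = Inl sphere_base \<and> ?P v = sphere_base)
        \<or> (\<exists>s t. v = Inr (s, t) \<and> s \<in> ?S \<and> t \<in> {0..1}
            \<and> cone_rep (\<lambda>_. sphere_base) sphere_base v = v \<and> sphere_susp n (s, t) \<noteq> sphere_base)"
      if v: "v \<in> topspace ?D" for v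
    proof (cases v)
      case (Inl y)
      then show ?thesis
        using v by (auto simp: topspace_disjoint_sum)
    next
      case (Inr r)
      obtain s t where r: "r = (s, t)"
        by (cases r)
      have st: "s \<in> ?S" "t \<in> {0..1}"
        using v unfolding Inr r topspace_disjoint_sum by auto
      show ?thesis
      proof (cases "t = 0 \<or> t = 1 \<or> s = sphere_base")
        case True
        then show ?thesis
          by (auto simp: Inr r)
      next
        case False
        then have "sphere_susp n (s, t) \<noteq> sphere_base"
          using sphere_susp_eq_base[OF n st] by blast
        then show ?thesis
          using False st by (simp add: Inr r)
      qed
    qed
    from rep[OF z] show ?thesis
    proof (elim disjE exE conjE)
      assume 1: "cone_rep (\<lambda>_. sphere_base) sphere_base z = Inl sphere_base" "?P z = sphere_base"
      from rep[OF w] show ?thesis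
      proof (elim disjE exE conjE)
        assume "cone_rep (\<lambda>_. sphere_base) sphere_base w = Inl sphere_base" "?P w = sphere_base"
        then show ?thesis
          using 1 by simp
      next
        fix s' t'
        assume 2: "w = Inr (s', t')" "sphere_susp n (s', t') \<noteq> sphere_base"
          "cone_rep (\<lambda>_. sphere_base) sphere_base w = w"
        show ?thesis
          unfolding 1 2(3) using 2(2) by (simp add: 2(1) eq_commute[of sphere_base])
      qed
    next
      fix s t
      assume 1: "z = Inr (s, t)" "s \<in> ?S" "t \<in> {0..1}" "sphere_susp n (s, t) \<noteq> sphere_base"
        "cone_rep (\<lambda>_. sphere_base) sphere_base z = z"
      from rep[OF w] show ?thesis
      proof (elim disjE exE conjE)
        assume "cone_rep (\<lambda>_. sphere_base) sphere_base w = Inl sphere_base" "?P w = sphere_base"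
        then show ?thesis
          unfolding 1(5) using 1(1,4) by simp
      next
        fix s' t'
        assume 2: "w = Inr (s', t')" "s' \<in> ?S" "t' \<in> {0..1}"
          "cone_rep (\<lambda>_. sphere_base) sphere_base w = w"
        have "sphere_susp n (s, t) = sphere_susp n (s', t') \<longleftrightarrow> s = s' \<and> t = t'"
          using sphere_susp_inj[OF n 1(2,3) 2(2,3) _ 1(4)] by auto
        then show ?thesis
          unfolding 1(5) 2(4) by (simp add: 1(1) 2(1))
      qed
    qed
  qed
qed (use n in \<open>auto simp: continuous_map_const\<close>)

text \<open>The product of two classes is the set of sums of their members; a chain \<open>c\<close>
  homologous to \<open>a + b\<close> is such a sum, \<open>(c - b) + b\<close>.\<close>

lemma homology_group_nat_mult:
  "homologous_rel_set p X {} a \<otimes>\<^bsub>homology_group (int p) X\<^esub> homologous_rel_set p X {} b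
     = homologous_rel_set p X {} (a + b)"
proof -
  have "\<exists>r s. homologous_rel p X {} a r \<and> homologous_rel p X {} b s \<and> c = r + s"
    if "homologous_rel p X {} (a + b) c" for c
    using homologous_rel_diff[OF that homologous_rel_refl[of p X "{}" b]]
    by (intro exI[of _ "c - b"] exI[of _ b]) simp
  then show ?thesis
    unfolding mult_relative_homology_group by (auto intro: homologous_rel_add)
qed

text \<open>On singular chains that are small with respect to the cover the identity holds exactly.\<close>

lemma hom_induced_cover_additive:
  assumes cont: "continuous_map X W f" "continuous_map X W g" "continuous_map X W h" "continuous_map X W k"
    and cover: "openin X U" "openin X V" "topspace X \<subseteq> U \<union> V"
    and U: "\<And>x. x \<in> U \<Longrightarrow> f x = h x \<and> g x = k x"
    and V: "\<And>x. x \<in> V \<Longrightarrow> f x = g x \<and> h x = k x"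
    and c: "c \<in> carrier (homology_group p X)"
  shows "hom_induced p X {} W {} f c \<otimes>\<^bsub>homology_group p W\<^esub> hom_induced p X {} W {} k c
       = hom_induced p X {} W {} g c \<otimes>\<^bsub>homology_group p W\<^esub> hom_induced p X {} W {} h c"
proof (cases "p < 0")
  case True
  then have triv: "carrier (homology_group p W) = {\<one>\<^bsub>homology_group p W\<^esub>}"
    using trivial_homology_group unfolding trivial_group_def by blast
  have "hom_induced p X {} W {} u c = \<one>\<^bsub>homology_group p W\<^esub>" for u
    using hom_induced_carrier[of p X "{}" W "{}" u c] triv by blast
  then show ?thesis
    by simp
next
  case False
  then obtain m where m: "p = int m"
    by (metis int_nat_eq not_less)
  obtain z where z: "singular_relcycle m X {} z" "c = homologous_rel_set m X {} z"
    using c unfolding m carrier_relative_homology_group by blast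
  obtain z' where z': "singular_relcycle m X {} z'" "homologous_rel m X {} z z'"
      "\<And>\<sigma>. \<sigma> \<in> Poly_Mapping.keys z' \<Longrightarrow> \<exists>B\<in>{U, V}. \<sigma> \<in> standard_simplex m \<rightarrow> B"
    using small_homologous_rel_relcycle_exists[of "{U, V}" X m "{}" z] cover z(1) by auto
  have c': "c = homologous_rel_set m X {} z'"
    using z(2) z'(2) by (simp add: homologous_rel_set_eq)
  have "chain_map m f z' + chain_map m k z' = chain_map m g z' + chain_map m h z'"
  proof -
    have "Poly_Mapping.keys z' \<subseteq> {\<sigma>. \<exists>B\<in>{U, V}. \<sigma> \<in> standard_simplex m \<rightarrow> B}"
      using z'(3) by blast
    then show ?thesis
    proof (induction rule: frag_induction)
      case (one \<sigma>)
      then consider "\<sigma> \<in> standard_simplex m \<rightarrow> U" | "\<sigma> \<in> standard_simplex m \<rightarrow> V"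
        by blast
      then show ?case
      proof cases
        case 1
        then have "simplex_map m f \<sigma> = simplex_map m h \<sigma>" "simplex_map m g \<sigma> = simplex_map m k \<sigma>"
          using U by (auto simp: simplex_map_def Pi_iff intro!: restrict_ext)
        then show ?thesis
          by (simp add: add.commute)
      next
        case 2
        then have "simplex_map m f \<sigma> = simplex_map m g \<sigma>" "simplex_map m h \<sigma> = simplex_map m k \<sigma>"
          using V by (auto simp: simplex_map_def Pi_iff intro!: restrict_ext)
        then show ?thesis
          by simp
      qed
    next
      case (diff a b)
      then show ?case
        by (simp add: chain_map_diff algebra_simps)
    qed simp
  qed
  then show ?thesis
    using cont z'(1) unfolding m c'
    by (simp add: hom_induced_chain_map homology_group_nat_mult)
qed

text \<open>Every neighbourhood of the base point meets both halves of the cone. Flattening \<open>\<alpha>\<close> near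
  the base point makes the sets where one of the two halves is trivial cover \<open>X\<close> by open sets.\<close>

lemma nsphere_flattening_exists:
  obtains \<kappa> where "based_homotopic (nsphere n) sphere_base (nsphere n) sphere_base \<kappa> id"
    "\<And>x. x \<in> topspace (nsphere n) \<Longrightarrow> x 0 > 0 \<Longrightarrow> \<kappa> x = sphere_base"
proof -
  \<comment> \<open>\<open>c\<close> stretches \<open>[-1, 0]\<close> onto \<open>[-1, 1]\<close>
    and is 1 above. The factor \<rho> restores unit length:
    \<open>\<rho>^2 (1 - u^2) = 1 - (2 u + 1)^2\<close> for \<open>u\<close> in
    \<open>[-1, 0]\<close>. The \<open>max\<close> and the absolute value make \<rho> continuous on
    the whole line.\<close>
  define c where "c u = min 1 (2 * u + 1)" for u :: real
  define \<rho> where "\<rho> u = sqrt (max 0 (- 4 * u) / (1 + \<bar>u\<bar>))" for u :: real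
  define \<kappa> where "\<kappa> x i = (if i = 0 then c (x 0) else \<rho> (x 0) * x i)" for x :: "nat \<Rightarrow> real" and i :: nat
  have sum0: "(\<Sum>i\<le>n. x i ^ 2) = x 0 ^ 2 + (\<Sum>i\<in>{..n} - {0}. x i ^ 2)" for x :: "nat \<Rightarrow> real"
    by (subst sum.remove[of _ 0]) auto
  have cr: "c u ^ 2 + \<rho> u ^ 2 * (1 - u ^ 2) = 1" if "\<bar>u\<bar> \<le> 1" for u
  proof (cases "u \<le> 0")
    case True
    then have "\<rho> u ^ 2 = - 4 * u / (1 - u)" "c u = 2 * u + 1"
      by (simp_all add: \<rho>_def c_def divide_nonpos_nonneg)
    moreover have "- 4 * u / (1 - u) * (1 - u ^ 2) = - 4 * u * (1 + u)"
    proof -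
      have "1 - u ^ 2 = (1 - u) * (1 + u)"
        by (simp add: power2_eq_square algebra_simps)
      then show ?thesis
        using True by simp
    qed
    ultimately show ?thesis
      by (simp add: power2_eq_square algebra_simps)
  qed (simp add: \<rho>_def c_def)
  have \<kappa>S: "\<kappa> x \<in> topspace (nsphere n)" if x: "x \<in> topspace (nsphere n)" for x
  proof -
    have "(\<Sum>i\<in>{..n} - {0}. \<kappa> x i ^ 2) = (\<Sum>i\<in>{..n} - {0}. \<rho> (x 0) ^ 2 * x i ^ 2)"
      by (intro sum.cong) (auto simp: \<kappa>_def power_mult_distrib)
    also have "\<dots> = \<rho> (x 0) ^ 2 * (1 - x 0 ^ 2)"
      using x sum0[of x] by (simp add: topspace_nsphere flip: sum_distrib_left)
    finally have "(\<Sum>i\<le>n. \<kappa> x i ^ 2) = 1"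
      unfolding sum0[of "\<kappa> x"] using cr nsphere_coordinate_le_1[OF x] by (simp add: \<kappa>_def)
    then show ?thesis
      using x by (simp add: topspace_nsphere) (simp add: \<kappa>_def)
  qed
  have flat: "\<kappa> x = sphere_base" if "x 0 > 0" for x
    using that by (auto simp: \<kappa>_def c_def \<rho>_def sphere_base_def fun_eq_iff)
  have proj: "continuous_map (nsphere n) euclideanreal (\<lambda>x. x i)" for i
    by (rule continuous_map_nsphere_projection)
  have "based_homotopic (nsphere n) sphere_base (nsphere n) sphere_base
      (\<lambda>x. normalized n (\<kappa> x)) (\<lambda>x. normalized n (id x))"
  proof (rule nsphere_linear_homotopy)
    have "continuous_map (nsphere n) euclideanreal (\<lambda>x. c (x 0))"
      by (rule continuous_map_real_compose[OF proj]) (simp add: c_def, intro continuous_intros)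
    moreover have "continuous_map (nsphere n) euclideanreal (\<lambda>x. \<rho> (x 0))"
      by (rule continuous_map_real_compose[OF proj]) (simp add: \<rho>_def, intro continuous_intros, auto)
    ultimately show "continuous_map (nsphere n) euclideanreal (\<lambda>x. \<kappa> x j)" for j
      unfolding \<kappa>_def by (cases "j = 0") (auto intro: continuous_map_real_mult proj)
    show "continuous_map (nsphere n) euclideanreal (\<lambda>x. id x j)" for j
      using proj by simp
    show "\<kappa> sphere_base = sphere_base" "id sphere_base = (sphere_base :: nat \<Rightarrow> real)"
      by (rule flat, simp add: sphere_base_def, simp)
    fix x t assume x: "x \<in> topspace (nsphere n)" and t: "t \<in> {0..1::real}"
    show "\<exists>j\<le>n. (1 - t) * \<kappa> x j + t * id x j \<noteq> 0"
    proof (rule ccontr)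
      assume "\<not> ?thesis"
      then have z: "(1 - t) * \<kappa> x j + t * x j = 0" if "j \<le> n" for j
        using that by auto
      have \<rho>0: "\<rho> (x 0) \<ge> 0"
        by (simp add: \<rho>_def)
      show False
      \<comment> \<open>The segment could meet the origin only if \<open>\<kappa> x\<close> and
        \<open>x\<close> were antipodal. Off the poles some coordinate of positive index is nonzero
        and is multiplied by a nonnegative factor; the poles themselves are fixed by
        \<kappa>.\<close>
      proof (cases "\<exists>j\<le>n. j > 0 \<and> x j \<noteq> 0")
        case True
        then obtain j where j: "j \<le> n" "j > 0" "x j \<noteq> 0"
          by blast
        have "((1 - t) * \<rho> (x 0) + t) * x j = 0"
          using z[OF j(1)] j by (simp add: \<kappa>_def algebra_simps)
        then have "(1 - t) * \<rho> (x 0) + t = 0"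
          using j by simp
        moreover have "(1 - t) * \<rho> (x 0) \<ge> 0"
          using t \<rho>0 by simp
        ultimately have t0: "t = 0"
          using t by auto
        then have "\<kappa> x j = 0" if "j \<le> n" for j
          using z[OF that] by simp
        then have "(\<Sum>i\<le>n. \<kappa> x i ^ 2) = 0"
          by simp
        then show False
          using \<kappa>S[OF x] by (simp add: topspace_nsphere)
      next
        case False
        then have "(\<Sum>i\<in>{..n} - {0}. x i ^ 2) = 0"
          by (intro sum.neutral) auto
        then have "x 0 ^ 2 = 1"
          using x sum0[of x] by (simp add: topspace_nsphere)
        then consider "x 0 = 1" | "x 0 = -1"
          using power2_eq_1_iff by blast
        then show False
          using z[of 0] by cases (simp_all add: \<kappa>_def c_def)
      qed
    qed
  qed
  then have "based_homotopic (nsphere n) sphere_base (nsphere n) sphere_base \<kappa> id"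
    by (rule based_homotopic_eq) (auto simp: \<kappa>S)
  then show ?thesis
    using flat that by blast
qed

context cone_space
begin

text \<open>Where the half carrying \<open>f\<close> is not met, and where the half carrying
  \<alpha> is trivial, the four maps agree in pairs. Keeping the constant map as a term makes the
  formula valid in degree 0 as well.\<close>

lemma hom_induced_coaction_map:
  assumes f: "continuous_map X W f" "f x0 = w0"
    and \<alpha>: "continuous_map (nsphere n) W \<alpha>" "\<alpha> sphere_base = w0"
    and c: "c \<in> carrier (homology_group p X)"
  shows "hom_induced p X {} W {} (coaction_map f \<alpha>) c \<otimes>\<^bsub>homology_group p W\<^esub> hom_induced p X {} W {} (\<lambda>_. w0) c
       = hom_induced p X {} W {} f c \<otimes>\<^bsub>homology_group p W\<^esub> hom_induced p X {} W {} (\<alpha> \<circ> pinch) c"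
proof -
  let ?e = "sphere_base :: nat \<Rightarrow> real"
  obtain \<kappa> where \<kappa>: "based_homotopic (nsphere n) ?e (nsphere n) ?e \<kappa> id"
      "\<And>x. x \<in> topspace (nsphere n) \<Longrightarrow> x 0 > 0 \<Longrightarrow> \<kappa> x = ?e"
    using nsphere_flattening_exists by blast
  define \<alpha>' where "\<alpha>' = \<alpha> \<circ> \<kappa>"
  have \<alpha>\<alpha>': "based_homotopic (nsphere n) ?e W w0 \<alpha>' \<alpha>"
    using based_homotopic_compose[OF \<kappa>(1), where W = W and ?w0.0 = w0 and g = \<alpha> and g' = \<alpha>] \<alpha> by (simp add: \<alpha>'_def)
  have \<alpha>'c: "continuous_map (nsphere n) W \<alpha>'" and \<alpha>'b: "\<alpha>' ?e = w0"
    using homotopic_with_imp_continuous_maps[OF \<alpha>\<alpha>'] homotopic_with_imp_property[OF \<alpha>\<alpha>'] by auto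
  have w0: "w0 \<in> topspace W"
    using continuous_map_in_topspace[OF f(1) x0_in] f(2) by simp
  \<comment> \<open>\<open>Q\<close> pinches all but the apex half to the base point. Where
    \<open>Q\<close> differs from the base point, only the apex half is met; where its coordinate 0
    is positive, the flattened \<open>\<alpha>'\<close> contributes only \<open>w0\<close>. The base
    point has coordinate 0 equal to 1, so the two open sets cover.\<close>
  define Q where "Q = coaction_map (\<lambda>_. ?e) id"
  note cm = coaction_map[where ?w0.0 = w0]
  note cmQ = coaction_map[where f = "\<lambda>_. ?e" and \<alpha> = id and ?w0.0 = ?e, simplified, folded Q_def]
  have Qc: "continuous_map X (nsphere n) Q"
    unfolding Q_def by (rule continuous_coaction_map) auto
  define U where "U = {x \<in> topspace X. Q x \<in> topspace (nsphere n) - {?e}}"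
  define V where "V = {x \<in> topspace X. Q x 0 \<in> {0<..}}"
  have ind: "hom_induced p X {} W {} u = hom_induced p X {} W {} v" if "based_homotopic X x0 W w0 u v" for u v
    using that by (intro homology_homotopy_empty) (auto elim: homotopic_with_mono)
  have "hom_induced p X {} W {} (coaction_map f \<alpha>') c \<otimes>\<^bsub>homology_group p W\<^esub> hom_induced p X {} W {} (\<lambda>_. w0) c
       = hom_induced p X {} W {} (coaction_map f (\<lambda>_. w0)) c
          \<otimes>\<^bsub>homology_group p W\<^esub> hom_induced p X {} W {} (coaction_map (\<lambda>_. w0) \<alpha>') c"
  proof (rule hom_induced_cover_additive[where U = U and V = V])
    show "openin X U"
      unfolding U_def
      by (intro openin_continuous_map_preimage[OF Qc] openin_diff openin_topspace)
        (simp add: closedin_Hausdorff_singleton)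
    have "continuous_map X euclideanreal (\<lambda>x. Q x 0)"
      using continuous_map_compose[OF Qc continuous_map_nsphere_projection[of n 0]] by (simp add: o_def)
    then show "openin X V"
      unfolding V_def by (rule openin_continuous_map_preimage) simp
    show "topspace X \<subseteq> U \<union> V"
      using continuous_map_in_topspace[OF Qc] by (auto simp: U_def V_def sphere_base_def)
    show "coaction_map f \<alpha>' x = coaction_map (\<lambda>_. w0) \<alpha>' x \<and> coaction_map f (\<lambda>_. w0) x = w0" if "x \<in> U" for x
    proof -
      have x: "x \<in> topspace X" "Q x \<noteq> ?e"
        using that by (auto simp: U_def)
      from x(1) show ?thesis
      proof (cases rule: P_cases)
        case (Inl y)
        then show ?thesis
          using x(2) by (simp add: cmQ)
      next
        case (Inr s t)
        then have "t \<le> 1/2"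
          using x(2) cmQ(3)[of s t] by force
        then show ?thesis
          using Inr f(2) \<alpha>'b by (simp add: cm)
      qed
    qed
    show "coaction_map f \<alpha>' x = coaction_map f (\<lambda>_. w0) x \<and> coaction_map (\<lambda>_. w0) \<alpha>' x = w0" if "x \<in> V" for x
    proof -
      have x: "x \<in> topspace X" "Q x 0 > 0"
        using that by (auto simp: V_def)
      from x(1) show ?thesis
      proof (cases rule: P_cases)
        case (Inl y)
        then show ?thesis
          using f(2) \<alpha>'b by (simp add: cm)
      next
        case (Inr s t)
        show ?thesis
        proof (cases "t \<le> 1/2")
          case True
          then have "Q x = sphere_susp n (s, 2 * t)"
            using Inr by (simp add: cmQ)
          then have "\<kappa> (sphere_susp n (s, 2 * t)) = ?e"
            using x(2) Inr by (intro \<kappa>(2) sphere_susp_in_nsphere[OF n]) auto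
          then have "\<alpha>' (sphere_susp n (s, 2 * t)) = w0"
            by (simp add: \<alpha>'_def \<alpha>)
          then show ?thesis
            using True Inr f(2) \<alpha>'b by (simp add: cm)
        next
          case False
          then show ?thesis
            using Inr f(2) \<alpha>'b by (simp add: cm)
        qed
      qed
    qed
  qed (use f \<alpha>'c \<alpha>'b w0 c in \<open>auto intro!: continuous_coaction_map\<close>)
  moreover have "hom_induced p X {} W {} (coaction_map f \<alpha>') = hom_induced p X {} W {} (coaction_map f \<alpha>)"
    using f by (intro ind coaction_map_homotopic \<alpha>\<alpha>') simp
  moreover have "hom_induced p X {} W {} (coaction_map f (\<lambda>_. w0)) = hom_induced p X {} W {} f"
    by (intro ind coaction_map_const f)
  moreover have "hom_induced p X {} W {} (coaction_map (\<lambda>_. w0) \<alpha>') = hom_induced p X {} W {} (\<alpha> \<circ> pinch)"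
  proof (rule ind, rule homotopic_with_trans)
    show "based_homotopic X x0 W w0 (coaction_map (\<lambda>_. w0) \<alpha>') (coaction_map (\<lambda>_. w0) \<alpha>)"
      using w0 by (intro coaction_map_homotopic \<alpha>\<alpha>') simp
    show "based_homotopic X x0 W w0 (coaction_map (\<lambda>_. w0) \<alpha>) (\<alpha> \<circ> pinch)"
      by (rule homotopic_with_symD[OF coaction_map_const_left[OF \<alpha>]])
  qed
  ultimately show ?thesis
    by simp
qed

end

section \<open>Homology of constant maps and of the sphere\<close>

lemma hom_induced_const_trivial:
  assumes "p \<noteq> 0" "w0 \<in> topspace W"
  shows "hom_induced p X {} W {} (\<lambda>_. w0) c = \<one>\<^bsub>homology_group p W\<^esub>"
proof -
  let ?pt = "discrete_topology {()}"
  have triv: "carrier (homology_group p ?pt) = {\<one>\<^bsub>homology_group p ?pt\<^esub>}"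
    using homology_dimension_axiom[of ?pt "()" p] assms(1) unfolding trivial_group_def by simp
  have "hom_induced p X {} W {} (\<lambda>_. w0) c
      = hom_induced p ?pt {} W {} (\<lambda>_. w0) (hom_induced p X {} ?pt {} (\<lambda>_. ()) c)"
    using assms(2) by (subst hom_induced_compose') (auto simp: o_def)
  also have "hom_induced p X {} ?pt {} (\<lambda>_. ()) c = \<one>\<^bsub>homology_group p ?pt\<^esub>"
    using hom_induced_carrier[of p X "{}" ?pt "{}"] triv by blast
  also have "hom_induced p ?pt {} W {} (\<lambda>_. w0) \<dots> = \<one>\<^bsub>homology_group p W\<^esub>"
    by (rule hom_one[OF hom_induced_hom]) simp_all
  finally show ?thesis .
qed

lemma fundamental_class_generates:
  assumes "n \<ge> 1"
  shows "fundamental_class n \<in> carrier (homology_group (int n) (nsphere n))"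
    and "generate (homology_group (int n) (nsphere n)) {fundamental_class n}
       = carrier (homology_group (int n) (nsphere n))"
proof -
  let ?G = "homology_group (int n) (nsphere n)"
  have "cyclic_group ?G"
    using cyclic_reduced_homology_group_nsphere[of "int n" n] un_reduced_homology_group[of "int n" "nsphere n"] assms
    by simp
  then obtain z where "z \<in> carrier ?G" "subgroup_generated ?G {z} = ?G"
    unfolding cyclic_group_def by blast
  then have "z \<in> carrier ?G \<and> generate ?G {z} = carrier ?G"
    by (metis Int_insert_right Int_empty_right carrier_subgroup_generated)
  then have "fundamental_class n \<in> carrier ?G \<and> generate ?G {fundamental_class n} = carrier ?G"
    unfolding fundamental_class_def by (rule someI)
  then show "fundamental_class n \<in> carrier ?G" "generate ?G {fundamental_class n} = carrier ?G"
    by auto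
qed

text \<open>In degree \<open>n\<close> both homomorphisms kill the generator, a constant map being
  trivial in positive degrees. In any other degree the reduced homology of the sphere vanishes, so
  \<open>z\<close> is its own image under the constant self-map of the sphere, after which
  \<open>g\<close> acts as a constant.\<close>

lemma hom_induced_nsphere_eq_const:
  assumes n: "n \<ge> 1" and g: "continuous_map (nsphere n) W g" "g sphere_base = w0"
    and fc: "hom_induced (int n) (nsphere n) {} W {} g (fundamental_class n) = \<one>\<^bsub>homology_group (int n) W\<^esub>"
    and z: "z \<in> carrier (homology_group p (nsphere n))"
  shows "hom_induced p (nsphere n) {} W {} g z = hom_induced p (nsphere n) {} W {} (\<lambda>_. w0) z"
proof (cases "p = int n")
  case True
  have w0: "w0 \<in> topspace W"
    using continuous_map_in_topspace[OF g(1), of sphere_base] g(2) by simp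
  interpret h: group_hom "homology_group (int n) (nsphere n)" "homology_group (int n) W"
    "hom_induced (int n) (nsphere n) {} W {} g"
    by (simp add: group_hom_def group_hom_axioms_def hom_induced_empty_hom)
  have "z \<in> generate (homology_group (int n) (nsphere n)) {fundamental_class n}"
    using z True fundamental_class_generates[OF n] by simp
  then have "z \<in> carrier (homology_group (int n) (nsphere n))
      \<and> hom_induced (int n) (nsphere n) {} W {} g z = \<one>\<^bsub>homology_group (int n) W\<^esub>"
    using fundamental_class_generates(1)[OF n] by induction (auto simp: fc simp del: one_relative_homology_group)
  then show ?thesis
    using hom_induced_const_trivial[OF _ w0, where p = "int n" and X = "nsphere n"] n True by simp
next
  case False
  let ?pt = "discrete_topology {()}"
  let ?G = "homology_group p (nsphere n)"
  let ?e = "hom_induced p (nsphere n) {} ?pt {} (\<lambda>_. ())"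
  let ?k = "hom_induced p (nsphere n) {} (nsphere n) {} (\<lambda>_. sphere_base)"
  interpret e: group_hom ?G "homology_group p ?pt" ?e
    by (simp add: group_hom_def group_hom_axioms_def hom_induced_empty_hom)
  have kz: "?k z \<in> carrier ?G"
    by (rule hom_induced_carrier)
  have "?e (?k z) = ?e z"
    by (subst hom_induced_compose') (auto simp: o_def)
  then have "?e (z \<otimes>\<^bsub>?G\<^esub> inv\<^bsub>?G\<^esub> (?k z)) = \<one>\<^bsub>homology_group p ?pt\<^esub>"
    using z kz by simp
  then have "z \<otimes>\<^bsub>?G\<^esub> inv\<^bsub>?G\<^esub> (?k z) \<in> carrier (reduced_homology_group p (nsphere n))"
    using z kz by (simp add: carrier_reduced_homology_group kernel_def)
  moreover have "carrier (reduced_homology_group p (nsphere n)) = {\<one>\<^bsub>?G\<^esub>}"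
    using reduced_homology_group_nsphere(2)[OF False] unfolding trivial_group_def
    by (simp add: one_reduced_homology_group)
  ultimately have "z \<otimes>\<^bsub>?G\<^esub> inv\<^bsub>?G\<^esub> (?k z) = \<one>\<^bsub>?G\<^esub>"
    by simp
  then have zk: "z = ?k z"
    using z kz by (metis e.G.inv_closed e.G.inv_equality e.G.inv_inv)
  have "hom_induced p (nsphere n) {} W {} g (?k z) = hom_induced p (nsphere n) {} W {} (\<lambda>_. w0) z"
    using g by (subst hom_induced_compose') (auto simp: o_def)
  then show ?thesis
    using zk by simp
qed

section \<open>Groups of homotopy classes\<close>

lemma homotopy_class_eqI:
  assumes "based_homotopic X x0 W w0 f g"
  shows "homotopy_class X x0 W w0 f = homotopy_class X x0 W w0 g"
  unfolding homotopy_class_def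
  using homotopic_with_trans[OF assms] homotopic_with_trans[OF homotopic_with_symD[OF assms]] by blast

lemma homotopy_class_self:
  "continuous_map X W f \<Longrightarrow> f x0 = w0 \<Longrightarrow> f \<in> homotopy_class X x0 W w0 f"
  by (simp add: homotopy_class_def)

lemma homotopy_class_nonempty:
  "continuous_map X W f \<Longrightarrow> f x0 = w0 \<Longrightarrow> homotopy_class X x0 W w0 f \<noteq> {}"
  using homotopy_class_self by fast

lemma homotopy_class_memD:
  assumes "g \<in> homotopy_class X x0 W w0 f"
  shows "based_homotopic X x0 W w0 f g" "continuous_map X W g" "g x0 = w0"
proof -
  show *: "based_homotopic X x0 W w0 f g"
    using assms by (simp add: homotopy_class_def)
  show "continuous_map X W g" "g x0 = w0"
    using homotopic_with_imp_continuous_maps[OF *] homotopic_with_imp_property[OF *] by simp_all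
qed

lemma homotopy_class_eqD:
  assumes "homotopy_class X x0 W w0 f = homotopy_class X x0 W w0 g" "continuous_map X W g" "g x0 = w0"
  shows "based_homotopic X x0 W w0 f g"
proof -
  have "g \<in> homotopy_class X x0 W w0 f"
    unfolding assms(1) by (rule homotopy_class_self[OF assms(2,3)])
  then show ?thesis
    by (rule homotopy_class_memD(1))
qed

lemma homotopy_class_cong:
  assumes "continuous_map X W f" "f x0 = w0" "x0 \<in> topspace X" "\<And>x. x \<in> topspace X \<Longrightarrow> f x = g x"
  shows "homotopy_class X x0 W w0 f = homotopy_class X x0 W w0 g"
  using assms by (intro homotopy_class_eqI homotopic_with_equal) auto

lemma homotopy_class_in_classes:
  "continuous_map X W f \<Longrightarrow> f x0 = w0 \<Longrightarrow> homotopy_class X x0 W w0 f \<in> homotopy_classes X x0 W w0"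
  unfolding homotopy_classes_def by blast

lemma homotopy_classesE:
  assumes "A \<in> homotopy_classes X x0 W w0"
  obtains f where "A = homotopy_class X x0 W w0 f" "continuous_map X W f" "f x0 = w0"
  using assms unfolding homotopy_classes_def by blast

text \<open>The pattern by which the operations on classes are shown to be well defined;
  nonemptiness excludes the empty union.\<close>

lemma Union_homotopy_classes_eq:
  assumes "F \<noteq> {}" "A \<noteq> {}"
    and "\<And>f a. \<lbrakk>f \<in> F; a \<in> A\<rbrakk> \<Longrightarrow> C f a = D"
  shows "(\<Union>f\<in>F. \<Union>a\<in>A. C f a) = D"
  using assms by auto

lemma class_comp_homotopy_class:
  assumes f: "continuous_map V W f" "f v0 = w0" and a: "continuous_map X V a" "a x0 = v0"
  shows "class_comp X x0 W w0 (homotopy_class V v0 W w0 f) (homotopy_class X x0 V v0 a)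
    = homotopy_class X x0 W w0 (f \<circ> a)"
  unfolding class_comp_def
proof (rule Union_homotopy_classes_eq)
  fix f' a' assume "f' \<in> homotopy_class V v0 W w0 f" "a' \<in> homotopy_class X x0 V v0 a"
  then have "based_homotopic X x0 W w0 (f \<circ> a) (f' \<circ> a')"
    by (intro based_homotopic_compose[where V = V and ?v0.0 = v0] homotopy_class_memD(1))
  then show "homotopy_class X x0 W w0 (f' \<circ> a') = homotopy_class X x0 W w0 (f \<circ> a)"
    by (rule homotopy_class_eqI[symmetric])
qed (intro homotopy_class_nonempty f a)+

lemma class_comp_in_classes:
  assumes "F \<in> homotopy_classes V v0 W w0" "A \<in> homotopy_classes X x0 V v0"
  shows "class_comp X x0 W w0 F A \<in> homotopy_classes X x0 W w0"
proof -
  obtain f where f: "F = homotopy_class V v0 W w0 f" "continuous_map V W f" "f v0 = w0"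
    using assms(1) by (rule homotopy_classesE)
  obtain a where a: "A = homotopy_class X x0 V v0 a" "continuous_map X V a" "a x0 = v0"
    using assms(2) by (rule homotopy_classesE)
  show ?thesis
    unfolding f(1) a(1) class_comp_homotopy_class[OF f(2,3) a(2,3)]
    using f a by (intro homotopy_class_in_classes continuous_map_compose[OF a(2) f(2)]) simp
qed

lemma class_comp_assoc:
  assumes "F \<in> homotopy_classes V v0 W w0" "G \<in> homotopy_classes U u0 V v0" "A \<in> homotopy_classes X x0 U u0"
  shows "class_comp X x0 W w0 F (class_comp X x0 V v0 G A)
    = class_comp X x0 W w0 (class_comp U u0 W w0 F G) A"
proof -
  obtain f where f: "F = homotopy_class V v0 W w0 f" "continuous_map V W f" "f v0 = w0"
    using assms(1) by (rule homotopy_classesE)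
  obtain g where g: "G = homotopy_class U u0 V v0 g" "continuous_map U V g" "g u0 = v0"
    using assms(2) by (rule homotopy_classesE)
  obtain a where a: "A = homotopy_class X x0 U u0 a" "continuous_map X U a" "a x0 = u0"
    using assms(3) by (rule homotopy_classesE)
  have "(g \<circ> a) x0 = v0" "(f \<circ> g) u0 = w0"
    using f g a by simp_all
  then show ?thesis
    unfolding f(1) g(1) a(1) class_comp_homotopy_class[OF g(2,3) a(2,3)]
      class_comp_homotopy_class[OF f(2,3) g(2,3)]
    using class_comp_homotopy_class[OF f(2,3) continuous_map_compose[OF a(2) g(2)]]
      class_comp_homotopy_class[OF continuous_map_compose[OF g(2) f(2)] _ a(2,3)]
    by (simp add: comp_assoc)
qed

lemma class_comp_id_left:
  assumes "A \<in> homotopy_classes X x0 V v0"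
  shows "class_comp X x0 V v0 (homotopy_class V v0 V v0 id) A = A"
proof -
  obtain a where a: "A = homotopy_class X x0 V v0 a" "continuous_map X V a" "a x0 = v0"
    using assms by (rule homotopy_classesE)
  show ?thesis
    unfolding a(1) using class_comp_homotopy_class[OF _ _ a(2,3), of V id v0] by simp
qed

lemma class_comp_id_right:
  assumes "A \<in> homotopy_classes X x0 V v0"
  shows "class_comp X x0 V v0 A (homotopy_class X x0 X x0 id) = A"
proof -
  obtain a where a: "A = homotopy_class X x0 V v0 a" "continuous_map X V a" "a x0 = v0"
    using assms by (rule homotopy_classesE)
  show ?thesis
    unfolding a(1) using class_comp_homotopy_class[OF a(2,3), of X id x0] by simp
qed

lemma id_in_homotopy_classes: "homotopy_class X x0 X x0 id \<in> homotopy_classes X x0 X x0"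
  by (intro homotopy_class_in_classes) auto

text \<open>These are the units of the monoid \<open>[X, X]\<close> under composition.\<close>

lemma group_self_equivs: "group (self_equivs X x0)"
proof -
  define M where "M = \<lparr>carrier = homotopy_classes X x0 X x0, monoid.mult = class_comp X x0 X x0,
      one = homotopy_class X x0 X x0 id\<rparr>"
  have "monoid M"
    by (rule monoidI)
      (simp_all add: M_def class_comp_in_classes id_in_homotopy_classes class_comp_id_left
        class_comp_id_right class_comp_assoc)
  moreover have "units_of M = self_equivs X x0"
    by (auto simp: units_of_def Units_def M_def self_equivs_def)
  ultimately show ?thesis
    using monoid.units_group by metis
qed

lemma self_equivs_simps:
  "monoid.mult (self_equivs X x0) = class_comp X x0 X x0"
  "one (self_equivs X x0) = homotopy_class X x0 X x0 id"
  by (simp_all add: self_equivs_def)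

lemma self_equivs_in_classes: "F \<in> carrier (self_equivs X x0) \<Longrightarrow> F \<in> homotopy_classes X x0 X x0"
  by (simp add: self_equivs_def)

text \<open>Composition is an action of \<open>[X, X]\<close> on the homotopy sets; if
  \<open>F\<close> fixes \<open>A\<close>, its inverse \<open>G\<close> satisfies
  \<open>G A = G (F A) = (G F) A = A\<close>.\<close>

lemma self_equivs_sharp_subgroup: "subgroup (self_equivs_sharp N X x0) (self_equivs X x0)"
proof -
  interpret E: group "self_equivs X x0"
    by (rule group_self_equivs)
  show ?thesis
  proof
    show "self_equivs_sharp N X x0 \<subseteq> carrier (self_equivs X x0)"
      by (auto simp: self_equivs_sharp_def)
    show "\<one>\<^bsub>self_equivs X x0\<^esub> \<in> self_equivs_sharp N X x0"
      using E.one_closed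
      by (auto simp: self_equivs_sharp_def self_equivs_simps homotopy_group_def class_comp_id_left)
  next
    fix F G assume FG: "F \<in> self_equivs_sharp N X x0" "G \<in> self_equivs_sharp N X x0"
    then have "F \<otimes>\<^bsub>self_equivs X x0\<^esub> G \<in> carrier (self_equivs X x0)"
      by (auto simp: self_equivs_sharp_def)
    moreover have "class_comp (nsphere i) sphere_base X x0 (class_comp X x0 X x0 F G) A = A"
      if "i \<le> N" "A \<in> homotopy_classes (nsphere i) sphere_base X x0" for i A
      using FG that class_comp_assoc[of F X x0 X x0 G X x0 A "nsphere i" sphere_base]
      by (simp add: self_equivs_sharp_def self_equivs_in_classes homotopy_group_def)
    ultimately show "F \<otimes>\<^bsub>self_equivs X x0\<^esub> G \<in> self_equivs_sharp N X x0"
      by (simp add: self_equivs_sharp_def self_equivs_simps homotopy_group_def)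
  next
    fix F assume F: "F \<in> self_equivs_sharp N X x0"
    then have Fc: "F \<in> carrier (self_equivs X x0)"
      by (simp add: self_equivs_sharp_def)
    define G where "G = inv\<^bsub>self_equivs X x0\<^esub> F"
    have G: "G \<in> carrier (self_equivs X x0)" "class_comp X x0 X x0 G F = homotopy_class X x0 X x0 id"
      using E.inv_closed[OF Fc] E.l_inv[OF Fc] by (simp_all add: G_def self_equivs_simps)
    have "class_comp (nsphere i) sphere_base X x0 G A = A"
      if "i \<le> N" "A \<in> homotopy_classes (nsphere i) sphere_base X x0" for i A
    proof -
      have "class_comp (nsphere i) sphere_base X x0 F A = A"
        using F that by (simp add: self_equivs_sharp_def homotopy_group_def)
      then show ?thesis
        using class_comp_assoc[of G X x0 X x0 F X x0 A "nsphere i" sphere_base] G Fc that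
        by (simp add: self_equivs_in_classes class_comp_id_left)
    qed
    then show "inv\<^bsub>self_equivs X x0\<^esub> F \<in> self_equivs_sharp N X x0"
      using G(1) by (simp add: self_equivs_sharp_def homotopy_group_def G_def)
  qed
qed

lemma hom_induced_based_homotopic:
  "based_homotopic X x0 W w0 f g \<Longrightarrow> hom_induced p X {} W {} f = hom_induced p X {} W {} g"
  by (intro homology_homotopy_empty) (auto elim: homotopic_with_mono)

text \<open>Homotopic maps agree in homology, so the condition on all representatives may be tested
  on one.\<close>

lemma homotopy_class_in_self_equivs_star_iff:
  assumes "continuous_map X X f" "f x0 = x0"
  shows "homotopy_class X x0 X x0 f \<in> self_equivs_star X x0 \<longleftrightarrow>
     homotopy_class X x0 X x0 f \<in> carrier (self_equivs X x0) \<and>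
     (\<forall>p. \<forall>c \<in> carrier (homology_group p X). hom_induced p X {} X {} f c = c)"
proof -
  have "hom_induced p X {} X {} g = hom_induced p X {} X {} f" if "g \<in> homotopy_class X x0 X x0 f" for g p
    using homotopy_class_memD(1)[OF that] by (rule hom_induced_based_homotopic[symmetric])
  then show ?thesis
    using homotopy_class_self[of X X f x0 x0] assms unfolding self_equivs_star_def mem_Collect_eq
    by metis
qed

lemma self_equivs_star_subgroup: "subgroup (self_equivs_star X x0) (self_equivs X x0)"
proof -
  interpret E: group "self_equivs X x0"
    by (rule group_self_equivs)
  show ?thesis
  proof
    show sub: "self_equivs_star X x0 \<subseteq> carrier (self_equivs X x0)"
      by (auto simp: self_equivs_star_def)
    show "\<one>\<^bsub>self_equivs X x0\<^esub> \<in> self_equivs_star X x0"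
      using E.one_closed homotopy_class_in_self_equivs_star_iff[of X id x0]
      by (simp add: self_equivs_simps hom_induced_id)
    fix F assume F: "F \<in> self_equivs_star X x0"
    then have Fc: "F \<in> carrier (self_equivs X x0)"
      using sub by blast
    obtain f where f: "F = homotopy_class X x0 X x0 f" "continuous_map X X f" "f x0 = x0"
      using self_equivs_in_classes[OF Fc] by (rule homotopy_classesE)
    have f1: "hom_induced p X {} X {} f c = c" if "c \<in> carrier (homology_group p X)" for p c
      using F that homotopy_class_in_self_equivs_star_iff[of X f x0] f by simp
    {
      fix G assume G: "G \<in> self_equivs_star X x0"
      then have Gc: "G \<in> carrier (self_equivs X x0)"
        using sub by blast
      obtain g where g: "G = homotopy_class X x0 X x0 g" "continuous_map X X g" "g x0 = x0"
        using self_equivs_in_classes[OF Gc] by (rule homotopy_classesE)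
      have FG: "F \<otimes>\<^bsub>self_equivs X x0\<^esub> G = homotopy_class X x0 X x0 (f \<circ> g)"
        using class_comp_homotopy_class[OF f(2,3) g(2,3)] f(1) g(1) by (simp add: self_equivs_simps)
      have "hom_induced p X {} X {} (f \<circ> g) c = c" if "c \<in> carrier (homology_group p X)" for p c
        using that f1 G homotopy_class_in_self_equivs_star_iff[of X g x0] f g
        by (simp add: hom_induced_compose_empty)
      moreover have "F \<otimes>\<^bsub>self_equivs X x0\<^esub> G \<in> carrier (self_equivs X x0)"
        using Fc Gc by blast
      ultimately show "F \<otimes>\<^bsub>self_equivs X x0\<^esub> G \<in> self_equivs_star X x0"
        unfolding FG using f g homotopy_class_in_self_equivs_star_iff[OF continuous_map_compose[OF g(2) f(2)], of x0]
        by simp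
    }
    define G where "G = inv\<^bsub>self_equivs X x0\<^esub> F"
    have G: "G \<in> carrier (self_equivs X x0)" "class_comp X x0 X x0 G F = homotopy_class X x0 X x0 id"
      using E.inv_closed[OF Fc] E.l_inv[OF Fc] by (simp_all add: G_def self_equivs_simps)
    obtain g where g: "G = homotopy_class X x0 X x0 g" "continuous_map X X g" "g x0 = x0"
      using self_equivs_in_classes[OF G(1)] by (rule homotopy_classesE)
    have "homotopy_class X x0 X x0 (g \<circ> f) = homotopy_class X x0 X x0 id"
      using class_comp_homotopy_class[OF g(2,3) f(2,3)] G(2) f(1) g(1) by simp
    then have "based_homotopic X x0 X x0 (g \<circ> f) id"
      by (rule homotopy_class_eqD) auto
    then have "hom_induced p X {} X {} (g \<circ> f) = hom_induced p X {} X {} id" for p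
      by (rule hom_induced_based_homotopic)
    moreover have "hom_induced p X {} X {} (g \<circ> f) c = hom_induced p X {} X {} g (hom_induced p X {} X {} f c)" for p c
      using f g by (simp add: hom_induced_compose_empty)
    ultimately have "hom_induced p X {} X {} g c = c" if "c \<in> carrier (homology_group p X)" for p c
      using that by (metis f1 hom_induced_id)
    then show "inv\<^bsub>self_equivs X x0\<^esub> F \<in> self_equivs_star X x0"
      using G(1) g homotopy_class_in_self_equivs_star_iff[of X g x0] by (simp flip: G_def)
  qed
qed

text \<open>Away from the base point \<open>inv_into\<close> can only return \<open>(s, t)\<close>;
  over the base point every preimage is collapsed, and there the formula gives
  \<open>w0\<close>.\<close>

lemma sphere_add_susp:
  assumes n: "n \<ge> 1" and st: "s \<in> topspace (nsphere (n - 1))" "t \<in> {0..1}"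
    and base: "f sphere_base = w0" "g sphere_base = w0"
  shows "sphere_add n f g (sphere_susp n (s, t))
    = (if t \<le> 1/2 then f (sphere_susp n (s, 2 * t)) else g (sphere_susp n (s, 2 * t - 1)))"
proof -
  define x where "x = sphere_susp n (s, t)"
  have "x \<in> sphere_susp n ` topspace (cylinder n)"
    unfolding x_def using st by (intro imageI) simp
  then have inv: "inv_into (topspace (cylinder n)) (sphere_susp n) x \<in> topspace (cylinder n)"
      "sphere_susp n (inv_into (topspace (cylinder n)) (sphere_susp n) x) = x"
    by (rule inv_into_into, rule f_inv_into_f)
  obtain s' t' where st': "inv_into (topspace (cylinder n)) (sphere_susp n) x = (s', t')"
    by fastforce
  then have s't': "s' \<in> topspace (nsphere (n - 1))" "t' \<in> {0..1}" "sphere_susp n (s', t') = x"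
    using inv by simp_all
  have collapse: "(if t \<le> 1/2 then f (sphere_susp n (s, 2 * t)) else g (sphere_susp n (s, 2 * t - 1))) = w0"
    if "t = 0 \<or> t = 1 \<or> s = sphere_base" for s t
    using that base by auto
  have "sphere_add n f g x
      = (if t' \<le> 1/2 then f (sphere_susp n (s', 2 * t')) else g (sphere_susp n (s', 2 * t' - 1)))"
    unfolding sphere_add_def st' Let_def by simp
  also have "\<dots> = (if t \<le> 1/2 then f (sphere_susp n (s, 2 * t)) else g (sphere_susp n (s, 2 * t - 1)))"
  proof (cases "x = sphere_base")
    case True
    then have "t = 0 \<or> t = 1 \<or> s = sphere_base" "t' = 0 \<or> t' = 1 \<or> s' = sphere_base"
      using sphere_susp_eq_base[OF n st] sphere_susp_eq_base[OF n s't'(1,2)] s't'(3) by (auto simp: x_def)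
    then show ?thesis
      using collapse by metis
  next
    case False
    then have "s = s' \<and> t = t'"
      using s't'(3) by (intro sphere_susp_inj[OF n st s't'(1,2)]) (simp_all add: x_def)
    then show ?thesis
      by simp
  qed
  finally show ?thesis
    by (simp add: x_def)
qed

text \<open>Passing from \<open>t\<close> to \<open>1 - t\<close> changes only the sign of the sine,
  which enters coordinate \<open>n\<close> alone; so reversal of the suspension coordinate is
  induced by a reflection of the sphere.\<close>

lemma sphere_susp_reflect:
  assumes "n \<ge> 1" "s \<in> topspace (nsphere (n - 1))"
  shows "sphere_susp n (s, 1 - t) = (\<lambda>i. if i = n then - sphere_susp n (s, t) i else sphere_susp n (s, t) i)"
proof -
  have "2 * pi * (1 - t) = 2 * pi - 2 * pi * t"
    by (simp add: algebra_simps)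
  then have "cos (2 * pi * (1 - t)) = cos (2 * pi * t)" "sin (2 * pi * (1 - t)) = - sin (2 * pi * t)"
    by (simp_all add: cos_diff sin_diff)
  then have "sphere_susp n (s, 1 - t) i = (if i = n then - sphere_susp n (s, t) i else sphere_susp n (s, t) i)" for i
    by (cases "i = n") (simp_all add: sphere_susp_low sphere_susp_top[OF assms])
  then show ?thesis
    by (rule ext)
qed

section \<open>The homotopy group through coactions on the sphere\<close>

locale pointed_space =
  fixes n :: nat and X :: "'x topology" and x0 :: 'x
  assumes n: "n \<ge> 1" and x0: "x0 \<in> topspace X"
begin

sublocale sph: cone_space n "top_of_set {sphere_base}" sphere_base "\<lambda>_. sphere_base" "nsphere n"
  "case_sum (\<lambda>_. sphere_base) (sphere_susp n)"
  by (rule cone_space_nsphere[OF n])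

abbreviation "e \<equiv> (sphere_base :: nat \<Rightarrow> real)"
abbreviation "\<pi> \<equiv> homotopy_group n X x0"
abbreviation "sphere_class \<equiv> homotopy_class (nsphere n) e X x0"

lemma sph_x0 [simp]: "sph.x0 = e"
  by (simp add: sph.x0_def)

lemma susp_cases [consumes 1]:
  assumes "x \<in> topspace (nsphere n)"
  obtains s t where "s \<in> topspace (nsphere (n - 1))" "0 \<le> t" "t \<le> 1" "x = sphere_susp n (s, t)"
  using sphere_susp_surj[OF n assms] by (metis atLeastAtMost_iff)

text \<open>The arguments are swapped: the first summand lies on the apex half, which belongs to the
  second argument of \<open>coaction_map\<close>.\<close>

lemma sphere_add_eq_coaction:
  assumes "\<alpha> e = w0" "\<beta> e = w0" "x \<in> topspace (nsphere n)"
  shows "sphere_add n \<alpha> \<beta> x = sph.coaction_map \<beta> \<alpha> x"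
  using assms(3)
proof (cases x rule: susp_cases)
  case (1 s t)
  then show ?thesis
    using sphere_add_susp[OF n, of s t \<alpha> w0 \<beta>] sph.coaction_map(2,3)[where f = \<beta> and \<alpha> = \<alpha> and ?w0.0 = w0, of s t] assms
    by simp
qed

lemma sphere_add_homotopic_coaction:
  assumes "continuous_map (nsphere n) X \<alpha>" "\<alpha> e = x0" "continuous_map (nsphere n) X \<beta>" "\<beta> e = x0"
  shows "based_homotopic (nsphere n) e X x0 (sphere_add n \<alpha> \<beta>) (sph.coaction_map \<beta> \<alpha>)"
proof -
  have c: "continuous_map (nsphere n) X (sph.coaction_map \<beta> \<alpha>)"
    using assms by (intro sph.continuous_coaction_map) auto
  have b: "sph.coaction_map \<beta> \<alpha> e = x0"
    using sph.coaction_map_base[where f = \<beta> and \<alpha> = \<alpha> and ?w0.0 = x0] assms by simp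
  have eq: "sphere_add n \<alpha> \<beta> x = sph.coaction_map \<beta> \<alpha> x" if "x \<in> topspace (nsphere n)" for x
    by (rule sphere_add_eq_coaction[where ?w0.0 = x0]) (use assms that in auto)
  show ?thesis
    by (rule homotopic_with_symD, rule homotopic_with_equal) (simp_all add: b c eq)
qed

lemma mult_sphere_class:
  assumes \<alpha>: "continuous_map (nsphere n) X \<alpha>" "\<alpha> e = x0" and \<beta>: "continuous_map (nsphere n) X \<beta>" "\<beta> e = x0"
  shows "sphere_class \<alpha> \<otimes>\<^bsub>\<pi>\<^esub> sphere_class \<beta> = sphere_class (sph.coaction_map \<beta> \<alpha>)"
proof -
  have "(\<Union>a\<in>sphere_class \<alpha>. \<Union>b\<in>sphere_class \<beta>. sphere_class (sphere_add n a b)) = sphere_class (sph.coaction_map \<beta> \<alpha>)"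
  proof (rule Union_homotopy_classes_eq)
    fix a b assume ab: "a \<in> sphere_class \<alpha>" "b \<in> sphere_class \<beta>"
    have "sphere_class (sphere_add n a b) = sphere_class (sph.coaction_map b a)"
      using homotopy_class_memD(2,3)[OF ab(1)] homotopy_class_memD(2,3)[OF ab(2)]
      by (intro homotopy_class_eqI sphere_add_homotopic_coaction)
    also have "\<dots> = sphere_class (sph.coaction_map \<beta> \<alpha>)"
      using homotopy_class_memD(1)[OF ab(1)] homotopy_class_memD(1)[OF ab(2)]
      by (intro homotopy_class_eqI[symmetric] sph.coaction_map_homotopic[unfolded sph_x0])
    finally show "sphere_class (sphere_add n a b) = sphere_class (sph.coaction_map \<beta> \<alpha>)" .
  qed (intro homotopy_class_nonempty \<alpha> \<beta>)+
  then show ?thesis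
    by (simp add: homotopy_group_def)
qed

lemma homotopy_group_carrierE:
  assumes "A \<in> carrier \<pi>"
  obtains \<alpha> where "A = sphere_class \<alpha>" "continuous_map (nsphere n) X \<alpha>" "\<alpha> e = x0"
proof -
  have "A \<in> homotopy_classes (nsphere n) e X x0"
    using assms by (simp add: homotopy_group_def)
  then show ?thesis
    by (rule homotopy_classesE) (rule that)
qed

lemma sphere_class_in_carrier:
  "continuous_map (nsphere n) X \<alpha> \<Longrightarrow> \<alpha> e = x0 \<Longrightarrow> sphere_class \<alpha> \<in> carrier \<pi>"
  by (simp add: homotopy_group_def homotopy_class_in_classes)

lemma one_homotopy_group: "\<one>\<^bsub>\<pi>\<^esub> = sphere_class (\<lambda>_. x0)"
  by (simp add: homotopy_group_def)

definition reflect :: "(nat \<Rightarrow> real) \<Rightarrow> nat \<Rightarrow> real" where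
  "reflect x = (\<lambda>i. if i = n then - x i else x i)"

lemma reflect_susp: "s \<in> topspace (nsphere (n - 1)) \<Longrightarrow> reflect (sphere_susp n (s, t)) = sphere_susp n (s, 1 - t)"
  using sphere_susp_reflect[OF n] by (simp add: reflect_def)

lemma continuous_reflect: "continuous_map (nsphere n) (nsphere n) reflect"
  unfolding reflect_def[abs_def] by (rule continuous_map_nsphere_reflection)

lemma reflect_base [simp]: "reflect e = e"
  using n by (auto simp: reflect_def sphere_base_def)

lemma mult_reflect:
  assumes \<alpha>: "continuous_map (nsphere n) X \<alpha>" "\<alpha> e = x0"
  shows "sphere_class (\<alpha> \<circ> reflect) \<otimes>\<^bsub>\<pi>\<^esub> sphere_class \<alpha> = \<one>\<^bsub>\<pi>\<^esub>"
proof -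
  note cm = sph.coaction_map[where f = \<alpha> and \<alpha> = "\<alpha> \<circ> reflect" and ?w0.0 = x0]
  \<comment> \<open>The sum runs through \<alpha> at parameter \<open>\<bar>1 - 2 * t\<bar>\<close>,
    from 1 down to 0 and back. Raising the parameter to at least \<tau> pushes it to 1, where
    \<open>sphere_susp\<close> is the base point.\<close>
  define H :: "real \<Rightarrow> (nat \<Rightarrow> real) + (nat \<Rightarrow> real) \<times> real \<Rightarrow> 'x" where
    "H \<tau> = case_sum (\<lambda>_. x0) (\<lambda>(s, t). \<alpha> (sphere_susp n (s, max \<tau> \<bar>1 - 2 * t\<bar>)))" for \<tau>
  have "based_homotopic (nsphere n) sph.x0 X x0 (sph.coaction_map \<alpha> (\<alpha> \<circ> reflect)) (\<lambda>_. x0)"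
  proof (rule sph.homotopicI[where H = H])
    show "continuous_map (prod_topology unit_interval (top_of_set {e})) X (\<lambda>(\<tau>, y). H \<tau> (Inl y))"
      using x0 by (simp add: H_def case_prod_unfold)
    note coord = continuous_map_hcylinder_coordinates[of n]
    have "continuous_map (hcylinder n) euclideanreal (\<lambda>p. \<bar>1 - 2 * snd (snd p)\<bar>)"
      by (rule continuous_map_real_compose[OF coord(4)]) (intro continuous_intros)
    then have "continuous_map (hcylinder n) X (\<lambda>p. \<alpha> (sphere_susp n (fst (snd p), max (fst p) \<bar>1 - 2 * snd (snd p)\<bar>)))"
      by (intro continuous_map_compose[OF _ \<alpha>(1), unfolded o_def]
          continuous_map_compose[OF _ continuous_map_sphere_susp[OF n], unfolded o_def]
          continuous_map_into_cylinder coord continuous_map_real_max) auto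
    then show "continuous_map (hcylinder n) X (\<lambda>p. H (fst p) (Inr (snd p)))"
      by (simp add: H_def case_prod_unfold)
    show "sph.compatible (H \<tau>)" "H \<tau> (Inl e) = x0" if "\<tau> \<in> {0..1}" for \<tau>
      using that \<alpha> by (auto simp: sph.compatible_def H_def max_absorb2)
    show "sph.coaction_map \<alpha> (\<alpha> \<circ> reflect) (case_sum (\<lambda>_. e) (sphere_susp n) (Inl y)) = H 0 (Inl y)" for y
      using \<alpha> sph.coaction_map_base[where f = \<alpha> and \<alpha> = "\<alpha> \<circ> reflect" and ?w0.0 = x0] by (simp add: H_def)
    show "sph.coaction_map \<alpha> (\<alpha> \<circ> reflect) (case_sum (\<lambda>_. e) (sphere_susp n) (Inr (s, t))) = H 0 (Inr (s, t))"
      if "s \<in> topspace (nsphere (n - 1))" "t \<in> {0..1}" for s t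
    proof (cases "t \<le> 1/2")
      case True
      then have "max 0 \<bar>1 - 2 * t\<bar> = 1 - 2 * t"
        by simp
      then show ?thesis
        using cm(2)[of s t] True that \<alpha> by (simp add: H_def reflect_susp)
    next
      case False
      then have "max 0 \<bar>1 - 2 * t\<bar> = 2 * t - 1"
        by simp
      then show ?thesis
        using cm(3)[of s t] False that \<alpha> by (simp add: H_def)
    qed
    show "x0 = H 1 (Inr (s, t))" if "s \<in> topspace (nsphere (n - 1))" "t \<in> {0..1}" for s t
    proof -
      have "max 1 \<bar>1 - 2 * t\<bar> = 1"
        using that by (auto simp: max_def abs_if)
      then show ?thesis
        using \<alpha> by (simp add: H_def)
    qed
  qed (simp_all add: H_def)
  then have "sphere_class (sph.coaction_map \<alpha> (\<alpha> \<circ> reflect)) = sphere_class (\<lambda>_. x0)"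
    by (intro homotopy_class_eqI) simp
  then show ?thesis
    using mult_sphere_class[OF continuous_map_compose[OF continuous_reflect \<alpha>(1)] _ \<alpha>] \<alpha>(2)
    by (simp add: one_homotopy_group)
qed

lemma coaction_map_props:
  assumes "continuous_map (nsphere n) X \<alpha>" "\<alpha> e = x0" "continuous_map (nsphere n) X \<beta>" "\<beta> e = x0"
  shows "continuous_map (nsphere n) X (sph.coaction_map \<beta> \<alpha>)" "sph.coaction_map \<beta> \<alpha> e = x0"
  using assms sph.continuous_coaction_map[where f = \<beta> and \<alpha> = \<alpha> and ?w0.0 = x0]
    sph.coaction_map_base[where f = \<beta> and \<alpha> = \<alpha> and ?w0.0 = x0] by simp_all

text \<open>The unit law and associativity are those of the coaction with the sphere as cone; left
  inverses come from the reflection.\<close>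

lemma group_homotopy_group: "group \<pi>"
proof (rule groupI)
  let ?G = "\<pi>"
  show "\<one>\<^bsub>?G\<^esub> \<in> carrier ?G"
    unfolding one_homotopy_group using x0 by (intro sphere_class_in_carrier) auto
  fix A assume "A \<in> carrier ?G"
  then obtain \<alpha> where \<alpha>: "A = sphere_class \<alpha>" "continuous_map (nsphere n) X \<alpha>" "\<alpha> e = x0"
    by (rule homotopy_group_carrierE)
  show "\<one>\<^bsub>?G\<^esub> \<otimes>\<^bsub>?G\<^esub> A = A"
  proof -
    have "\<one>\<^bsub>?G\<^esub> \<otimes>\<^bsub>?G\<^esub> A = sphere_class (sph.coaction_map \<alpha> (\<lambda>_. x0))"
      unfolding one_homotopy_group \<alpha>(1) using x0 \<alpha> by (intro mult_sphere_class) auto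
    also have "\<dots> = A"
      unfolding \<alpha>(1) using \<alpha> by (intro homotopy_class_eqI sph.coaction_map_const[unfolded sph_x0])
    finally show ?thesis .
  qed
  show "\<exists>B\<in>carrier ?G. B \<otimes>\<^bsub>?G\<^esub> A = \<one>\<^bsub>?G\<^esub>"
    using mult_reflect[OF \<alpha>(2,3)] \<alpha>
    by (intro bexI[of _ "sphere_class (\<alpha> \<circ> reflect)"] sphere_class_in_carrier
        continuous_map_compose[OF continuous_reflect]) auto
  fix B assume "B \<in> carrier ?G"
  then obtain \<beta> where \<beta>: "B = sphere_class \<beta>" "continuous_map (nsphere n) X \<beta>" "\<beta> e = x0"
    by (rule homotopy_group_carrierE)
  note AB = mult_sphere_class[OF \<alpha>(2,3) \<beta>(2,3), folded \<alpha>(1) \<beta>(1)]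
  note ab = coaction_map_props[OF \<alpha>(2,3) \<beta>(2,3)]
  show "A \<otimes>\<^bsub>?G\<^esub> B \<in> carrier ?G"
    unfolding AB by (intro sphere_class_in_carrier ab)
  fix C assume "C \<in> carrier ?G"
  then obtain \<delta> where \<delta>: "C = sphere_class \<delta>" "continuous_map (nsphere n) X \<delta>" "\<delta> e = x0"
    by (rule homotopy_group_carrierE)
  note BC = mult_sphere_class[OF \<beta>(2,3) \<delta>(2,3), folded \<beta>(1) \<delta>(1)]
  note bc = coaction_map_props[OF \<beta>(2,3) \<delta>(2,3)]
  have "A \<otimes>\<^bsub>?G\<^esub> B \<otimes>\<^bsub>?G\<^esub> C = sphere_class (sph.coaction_map \<delta> (sph.coaction_map \<beta> \<alpha>))"
    unfolding AB \<delta>(1) by (rule mult_sphere_class[OF ab \<delta>(2,3)])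
  also have "\<dots> = sphere_class (sph.coaction_map (sph.coaction_map \<delta> \<beta>) \<alpha>)"
    using \<alpha> \<beta> \<delta> ab sph.coaction_map(2,3)[where f = \<beta> and \<alpha> = \<alpha> and ?w0.0 = x0]
    by (intro homotopy_class_eqI[symmetric] sph.coaction_map_assoc[unfolded sph_x0]) simp_all
  also have "\<dots> = A \<otimes>\<^bsub>?G\<^esub> (B \<otimes>\<^bsub>?G\<^esub> C)"
    unfolding BC \<alpha>(1) by (rule mult_sphere_class[OF \<alpha>(2,3) bc, symmetric])
  finally show "A \<otimes>\<^bsub>?G\<^esub> B \<otimes>\<^bsub>?G\<^esub> C = A \<otimes>\<^bsub>?G\<^esub> (B \<otimes>\<^bsub>?G\<^esub> C)" .
qed

end

section \<open>Gottlieb groups\<close>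

text \<open>This removes the wedge. Given \<open>a\<close>, the representative of \<open>A\<close>
  is taken to be \<open>a (x0, s)\<close> itself, so that the homotopy on the wedge can stay fixed
  on the sphere and deform only \<open>X\<close>.\<close>

lemma Gottlieb_iff:
  assumes x0: "x0 \<in> topspace X"
  shows "A \<in> Gottlieb n X x0 \<longleftrightarrow>
    (\<exists>a. continuous_map (prod_topology X (nsphere n)) X a
       \<and> based_homotopic X x0 X x0 (\<lambda>x. a (x, sphere_base)) id
       \<and> A = homotopy_class (nsphere n) sphere_base X x0 (\<lambda>s. a (x0, s)))" (is "_ \<longleftrightarrow> ?R")
proof
  let ?e = "sphere_base :: nat \<Rightarrow> real"
  let ?D = "disjoint_sum X (nsphere n)"
  let ?V = "wedge X x0 (nsphere n) ?e"
  have q: "quotient_map ?D ?V (wedge_rep x0 ?e)"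
    unfolding wedge_def by (rule quotient_map_quotient_topology)
  {
    assume "A \<in> Gottlieb n X x0"
    then obtain \<alpha> a where A: "A \<in> carrier (homotopy_group n X x0)" "\<alpha> \<in> A"
      and a: "continuous_map (prod_topology X (nsphere n)) X a"
      and h: "based_homotopic ?V (Inl x0) X x0 (a \<circ> wedge_incl x0 ?e) (case_sum id \<alpha>)"
      unfolding Gottlieb_def by blast
    obtain \<beta> where \<beta>: "A = homotopy_class (nsphere n) ?e X x0 \<beta>" "continuous_map (nsphere n) X \<beta>" "\<beta> ?e = x0"
      using A(1) by (auto simp: homotopy_group_def elim: homotopy_classesE)
    have A\<alpha>: "A = homotopy_class (nsphere n) ?e X x0 \<alpha>"
      using A(2) unfolding \<beta>(1) by (intro homotopy_class_eqI homotopy_class_memD(1))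
    have i1: "continuous_map X ?V (\<lambda>x. wedge_rep x0 ?e (Inl x))"
      using continuous_map_compose[OF continuous_map_Inl quotient_imp_continuous_map[OF q]] by (simp add: o_def)
    have i2: "continuous_map (nsphere n) ?V (\<lambda>s. wedge_rep x0 ?e (Inr s))"
      using continuous_map_compose[OF continuous_map_Inr quotient_imp_continuous_map[OF q]] by (simp add: o_def)
    have "based_homotopic X x0 X x0 ((a \<circ> wedge_incl x0 ?e) \<circ> (\<lambda>x. wedge_rep x0 ?e (Inl x)))
        (case_sum id \<alpha> \<circ> (\<lambda>x. wedge_rep x0 ?e (Inl x)))"
      by (rule homotopic_with_compose_continuous_map_right[OF h i1]) simp
    then have 1: "based_homotopic X x0 X x0 (\<lambda>x. a (x, ?e)) id"
      by (rule based_homotopic_eq) (simp_all add: x0 wedge_incl_def)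
    have \<alpha>e: "\<alpha> ?e = x0"
      using A(2) unfolding \<beta>(1) by (rule homotopy_class_memD(3))
    have "based_homotopic (nsphere n) ?e X x0 ((a \<circ> wedge_incl x0 ?e) \<circ> (\<lambda>s. wedge_rep x0 ?e (Inr s)))
        (case_sum id \<alpha> \<circ> (\<lambda>s. wedge_rep x0 ?e (Inr s)))"
      by (rule homotopic_with_compose_continuous_map_right[OF h i2]) simp
    then have "based_homotopic (nsphere n) ?e X x0 (\<lambda>s. a (x0, s)) \<alpha>"
      by (rule based_homotopic_eq) (simp_all add: wedge_incl_def \<alpha>e)
    then have "A = homotopy_class (nsphere n) ?e X x0 (\<lambda>s. a (x0, s))"
      unfolding A\<alpha> by (intro homotopy_class_eqI[symmetric])
    with a 1 show ?R
      by blast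
  }
  assume ?R
  then obtain a where a: "continuous_map (prod_topology X (nsphere n)) X a"
      and h: "based_homotopic X x0 X x0 (\<lambda>x. a (x, ?e)) id"
      and A: "A = homotopy_class (nsphere n) ?e X x0 (\<lambda>s. a (x0, s))"
    by blast
  define \<alpha> where "\<alpha> = (\<lambda>s. a (x0, s))"
  have \<alpha>c: "continuous_map (nsphere n) X \<alpha>"
    unfolding \<alpha>_def using x0
    by (intro continuous_map_compose[OF _ a, unfolded o_def] continuous_map_pairedI) auto
  obtain F where F: "continuous_map (prod_topology unit_interval X) X F"
      "\<And>x. F (0, x) = a (x, ?e)" "\<And>x. F (1, x) = x" "\<And>\<tau>. \<tau> \<in> {0..1} \<Longrightarrow> F (\<tau>, x0) = x0"
    using h unfolding homotopic_with_def by auto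
  have \<alpha>e: "\<alpha> ?e = x0"
    using F(2)[of x0] F(4)[of 0] by (simp add: \<alpha>_def)
  \<comment> \<open>Both pieces keep the value \<open>x0\<close> at the wedge point for all \<tau>,
    so \<open>K\<close> factors through the wedge.\<close>
  define K where "K = (\<lambda>(\<tau>, z). case z of Inl x \<Rightarrow> F (\<tau>, x) | Inr s \<Rightarrow> \<alpha> s)"
  let ?Q = "\<lambda>(\<tau>::real, z). (\<tau>, wedge_rep x0 ?e z)"
  have qI: "quotient_map (prod_topology unit_interval ?D) (prod_topology unit_interval ?V) ?Q"
    by (intro quotient_map_prod_right q)
      (auto simp: Hausdorff_space_subtopology compact_imp_locally_compact_space compact_space_subtopology)
  have "continuous_map (prod_topology unit_interval ?D) X K"
  proof (rule continuous_map_prod_disjoint_sum)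
    show "continuous_map (prod_topology unit_interval X) X (\<lambda>(z, b). K (z, Inl b))"
      using F(1) by (simp add: K_def)
    show "continuous_map (prod_topology unit_interval (nsphere n)) X (\<lambda>(z, b). K (z, Inr b))"
      using continuous_map_compose[OF continuous_map_snd \<alpha>c] by (simp add: K_def o_def case_prod_unfold)
  qed
  then have "continuous_map (prod_topology unit_interval ?D) X (K \<circ> ?Q)"
  proof (rule continuous_map_eq)
    fix p assume "p \<in> topspace (prod_topology unit_interval ?D)"
    then obtain \<tau> z where p: "p = (\<tau>, z)" "\<tau> \<in> {0..1}"
      by (cases p) auto
    show "K p = (K \<circ> ?Q) p"
      using p(2) by (cases z) (simp_all add: K_def p(1) F(4) \<alpha>e del: atLeastAtMost_iff)
  qed
  then have Kc: "continuous_map (prod_topology unit_interval ?V) X K"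
    by (rule continuous_compose_quotient_map[OF qI])
  have "based_homotopic ?V (Inl x0) X x0 (a \<circ> wedge_incl x0 ?e) (case_sum id \<alpha>)"
    unfolding homotopic_with_def
  proof (intro exI[of _ K] conjI allI ballI Kc)
    show "K (0, z) = (a \<circ> wedge_incl x0 ?e) z" "K (1, z) = case_sum id \<alpha> z" for z
      by (cases z; simp add: K_def F wedge_incl_def \<alpha>_def)+
  qed (simp add: K_def F(4))
  moreover have "\<alpha> \<in> A" "A \<in> carrier (homotopy_group n X x0)"
    using homotopy_class_self[of "nsphere n" X \<alpha> ?e x0] \<alpha>c \<alpha>e homotopy_class_in_classes[of "nsphere n" X \<alpha> ?e x0]
    by (simp_all add: A homotopy_group_def flip: \<alpha>_def)
  ultimately show "A \<in> Gottlieb n X x0"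
    unfolding Gottlieb_def using a by blast
qed

context pointed_space
begin

lemma Gottlieb_carrier: "A \<in> Gottlieb n X x0 \<Longrightarrow> A \<in> carrier \<pi>"
  by (simp add: Gottlieb_def)

lemma GottliebE:
  assumes "A \<in> Gottlieb n X x0"
  obtains a where "continuous_map (prod_topology X (nsphere n)) X a"
    "based_homotopic X x0 X x0 (\<lambda>x. a (x, e)) id" "A = sphere_class (\<lambda>s. a (x0, s))"
    "a (x0, e) = x0" "continuous_map (nsphere n) X (\<lambda>s. a (x0, s))"
proof -
  obtain a where a: "continuous_map (prod_topology X (nsphere n)) X a"
    "based_homotopic X x0 X x0 (\<lambda>x. a (x, e)) id" "A = sphere_class (\<lambda>s. a (x0, s))"
    using assms Gottlieb_iff[OF x0] by metis
  moreover have "a (x0, e) = x0"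
    using homotopic_with_imp_property[OF a(2)] by simp
  moreover have "continuous_map (nsphere n) X (\<lambda>s. a (x0, s))"
    using x0 by (intro continuous_map_compose[OF _ a(1), unfolded o_def] continuous_map_pairedI) auto
  ultimately show ?thesis
    using that by blast
qed

text \<open>The two associated maps act one inside the other, each moving on its own half of the
  sphere. Over \<open>x0\<close> this gives the sum, since \<open>a (x, e)\<close> is homotopic to
  \<open>x\<close>.\<close>

lemma Gottlieb_mult:
  assumes "A \<in> Gottlieb n X x0" "B \<in> Gottlieb n X x0"
  shows "A \<otimes>\<^bsub>\<pi>\<^esub> B \<in> Gottlieb n X x0"
proof -
  obtain a where a: "continuous_map (prod_topology X (nsphere n)) X a"
      "based_homotopic X x0 X x0 (\<lambda>x. a (x, e)) id" "A = sphere_class (\<lambda>s. a (x0, s))"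
      "a (x0, e) = x0" "continuous_map (nsphere n) X (\<lambda>s. a (x0, s))"
    using assms(1) by (rule GottliebE)
  obtain b where b: "continuous_map (prod_topology X (nsphere n)) X b"
      "based_homotopic X x0 X x0 (\<lambda>x. b (x, e)) id" "B = sphere_class (\<lambda>s. b (x0, s))"
      "b (x0, e) = x0" "continuous_map (nsphere n) X (\<lambda>s. b (x0, s))"
    using assms(2) by (rule GottliebE)
  interpret S: pointed_space n "nsphere n" e
    by unfold_locales (auto simp: n)
  \<comment> \<open>\<open>p1\<close> is the identity spread over the first half of the sphere and
    constant on the second, \<open>p2\<close> the other way round. Hence \<open>c (x0, s)\<close>
    runs through \<open>a (x0, s)\<close> first and then through
    \<open>a (b (x0, s), e)\<close>.\<close>
  define p1 p2 where "p1 = sph.coaction_map (\<lambda>_. e) id" and "p2 = sph.coaction_map id (\<lambda>_. e)"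
  have p1: "continuous_map (nsphere n) (nsphere n) p1" "p1 e = e"
    and p2: "continuous_map (nsphere n) (nsphere n) p2" "p2 e = e"
    unfolding p1_def p2_def by (rule S.coaction_map_props; simp)+
  define c where "c = (\<lambda>(x, s). a (b (x, p2 s), p1 s))"
  have c: "continuous_map (prod_topology X (nsphere n)) X c"
    unfolding c_def case_prod_unfold
    by (intro continuous_map_compose[OF _ a(1), unfolded o_def] continuous_map_compose[OF _ b(1), unfolded o_def]
        continuous_map_pairedI continuous_map_fst
        continuous_map_compose[OF continuous_map_snd p1(1), unfolded o_def]
        continuous_map_compose[OF continuous_map_snd p2(1), unfolded o_def])
  have ab: "continuous_map (nsphere n) X (\<lambda>s. a (b (x0, s), e))"
    by (intro continuous_map_compose[OF _ a(1), unfolded o_def] continuous_map_pairedI b(5)) simp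
  have cx: "based_homotopic X x0 X x0 (\<lambda>x. c (x, e)) id"
    using based_homotopic_compose[OF b(2) a(2)] by (simp add: c_def p1 p2 o_def id_def)
  have "based_homotopic (nsphere n) e X x0 ((\<lambda>x. a (x, e)) \<circ> (\<lambda>s. b (x0, s))) (id \<circ> (\<lambda>s. b (x0, s)))"
    by (rule homotopic_with_compose_continuous_map_right[OF a(2) b(5)]) (simp add: b(4))
  then have B: "B = sphere_class (\<lambda>s. a (b (x0, s), e))"
    unfolding b(3) by (intro homotopy_class_eqI[symmetric]) (simp add: o_def)
  have "A \<otimes>\<^bsub>\<pi>\<^esub> B
      = sphere_class (sph.coaction_map (\<lambda>s. a (b (x0, s), e)) (\<lambda>s. a (x0, s)))"
    unfolding a(3) B by (rule mult_sphere_class) (simp_all add: a b ab)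
  also have "\<dots> = sphere_class (\<lambda>s. c (x0, s))"
  proof (rule homotopy_class_cong)
    show "continuous_map (nsphere n) X (sph.coaction_map (\<lambda>s. a (b (x0, s), e)) (\<lambda>s. a (x0, s)))"
        "sph.coaction_map (\<lambda>s. a (b (x0, s), e)) (\<lambda>s. a (x0, s)) e = x0"
      by (rule coaction_map_props; simp add: a b ab)+
    fix x assume "x \<in> topspace (nsphere n)"
    then show "sph.coaction_map (\<lambda>s. a (b (x0, s), e)) (\<lambda>s. a (x0, s)) x = c (x0, x)"
    proof (cases x rule: susp_cases)
      case (1 s t)
      note cmab = sph.coaction_map(2,3)[where f = "\<lambda>s. a (b (x0, s), e)" and \<alpha> = "\<lambda>s. a (x0, s)" and ?w0.0 = x0, of s t]
      note cm1 = sph.coaction_map(2,3)[where f = "\<lambda>_. e" and \<alpha> = id and ?w0.0 = e, of s t]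
      note cm2 = sph.coaction_map(2,3)[where f = id and \<alpha> = "\<lambda>_. e" and ?w0.0 = e, of s t]
      show ?thesis
        using 1 a(4) b(4) cmab cm1 cm2 by (cases "t \<le> 1/2") (simp_all add: c_def p1_def p2_def)
    qed
  qed simp
  finally show ?thesis
    unfolding Gottlieb_iff[OF x0] using c cx by blast
qed

text \<open>The projection \<open>fst\<close> is associated with the unit, and reflecting the sphere
  variable of an associated map inverts the element.\<close>

lemma Gottlieb_subgroup: "subgroup (Gottlieb n X x0) \<pi>"
proof -
  interpret G: group "\<pi>"
    by (rule group_homotopy_group)
  show ?thesis
  proof (rule G.subgroupI)
    show "Gottlieb n X x0 \<subseteq> carrier \<pi>"
      using Gottlieb_carrier by blast
    have "sphere_class (\<lambda>s. fst (x0, s)) \<in> Gottlieb n X x0"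
      unfolding Gottlieb_iff[OF x0]
      by (intro exI[of _ fst] conjI continuous_map_fst) (simp_all add: id_def[symmetric])
    then show "Gottlieb n X x0 \<noteq> {}"
      by blast
    show "A \<otimes>\<^bsub>\<pi>\<^esub> B \<in> Gottlieb n X x0"
      if "A \<in> Gottlieb n X x0" "B \<in> Gottlieb n X x0" for A B
      using that by (rule Gottlieb_mult)
    fix A assume A: "A \<in> Gottlieb n X x0"
    obtain a where a: "continuous_map (prod_topology X (nsphere n)) X a"
        "based_homotopic X x0 X x0 (\<lambda>x. a (x, e)) id" "A = sphere_class (\<lambda>s. a (x0, s))"
        "a (x0, e) = x0" "continuous_map (nsphere n) X (\<lambda>s. a (x0, s))"
      using A by (rule GottliebE)
    define b where "b = (\<lambda>(x, s). a (x, reflect s))"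
    have "continuous_map (prod_topology X (nsphere n)) X b"
      unfolding b_def case_prod_unfold
      by (intro continuous_map_compose[OF _ a(1), unfolded o_def] continuous_map_pairedI continuous_map_fst
          continuous_map_compose[OF continuous_map_snd continuous_reflect, unfolded o_def])
    moreover have "based_homotopic X x0 X x0 (\<lambda>x. b (x, e)) id"
      using a(2) by (simp add: b_def)
    ultimately have "sphere_class (\<lambda>s. b (x0, s)) \<in> Gottlieb n X x0"
      unfolding Gottlieb_iff[OF x0] by blast
    moreover have bc: "(\<lambda>s. b (x0, s)) = (\<lambda>s. a (x0, s)) \<circ> reflect"
      by (simp add: b_def o_def)
    ultimately have B: "sphere_class ((\<lambda>s. a (x0, s)) \<circ> reflect) \<in> Gottlieb n X x0"
      by simp
    have "sphere_class ((\<lambda>s. a (x0, s)) \<circ> reflect) \<otimes>\<^bsub>\<pi>\<^esub> A = \<one>\<^bsub>\<pi>\<^esub>"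
      unfolding a(3) by (rule mult_reflect[OF a(5,4)])
    then have "inv\<^bsub>\<pi>\<^esub> A = sphere_class ((\<lambda>s. a (x0, s)) \<circ> reflect)"
      using A B Gottlieb_carrier by (intro G.inv_equality)
    then show "inv\<^bsub>\<pi>\<^esub> A \<in> Gottlieb n X x0"
      using B by simp
  qed
qed

text \<open>Up to homotopy the map \<open>a (\<beta> u, v)\<close> on the product of two spheres has
  the axes \<beta> and \<alpha>. The two sums traverse these axes in opposite orders and differ by a
  reparametrisation of both variables.\<close>

lemma Gottlieb_commute:
  assumes "A \<in> Gottlieb n X x0" "B \<in> carrier \<pi>"
  shows "A \<otimes>\<^bsub>\<pi>\<^esub> B = B \<otimes>\<^bsub>\<pi>\<^esub> A"
proof -
  obtain a where a: "continuous_map (prod_topology X (nsphere n)) X a"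
      "based_homotopic X x0 X x0 (\<lambda>x. a (x, e)) id" "A = sphere_class (\<lambda>s. a (x0, s))"
      "a (x0, e) = x0" "continuous_map (nsphere n) X (\<lambda>s. a (x0, s))"
    using assms(1) by (rule GottliebE)
  obtain \<beta> where \<beta>: "B = sphere_class \<beta>" "continuous_map (nsphere n) X \<beta>" "\<beta> e = x0"
    using assms(2) by (rule homotopy_group_carrierE)
  \<comment> \<open>Since \<open>a\<close> restricts to the identity of \<open>X\<close> only up to
    homotopy, the actual axis is \<open>\<beta>'\<close>, which lies in the class of
    \<beta>.\<close>
  define \<beta>' where "\<beta>' = (\<lambda>s. a (\<beta> s, e))"
  define a' where "a' = (\<lambda>(u, v). a (\<beta> u, v))"
  have a': "continuous_map (prod_topology (nsphere n) (nsphere n)) X a'"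
    unfolding a'_def case_prod_unfold
    by (intro continuous_map_compose[OF _ a(1), unfolded o_def] continuous_map_pairedI continuous_map_snd
        continuous_map_compose[OF continuous_map_fst \<beta>(2), unfolded o_def])
  have \<beta>'c: "continuous_map (nsphere n) X \<beta>'" "\<beta>' e = x0"
    unfolding \<beta>'_def
    by (intro continuous_map_compose[OF _ a(1), unfolded o_def] continuous_map_pairedI \<beta>(2))
      (simp_all only: a(4) \<beta>(3), simp)
  have "based_homotopic (nsphere n) e X x0 ((\<lambda>x. a (x, e)) \<circ> \<beta>) (id \<circ> \<beta>)"
    by (rule homotopic_with_compose_continuous_map_right[OF a(2) \<beta>(2)]) (simp add: \<beta>(3))
  then have B: "B = sphere_class \<beta>'"
    unfolding \<beta>(1) \<beta>'_def by (intro homotopy_class_eqI[symmetric]) (simp add: o_def)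
  let ?\<alpha> = "\<lambda>s. a (x0, s)"
  note ab = coaction_map_props[OF a(5,4) \<beta>'c]
  note cm = sph.coaction_map(2,3)[where f = \<beta>' and \<alpha> = ?\<alpha> and ?w0.0 = x0]
    and cm' = sph.coaction_map(2,3)[where f = ?\<alpha> and \<alpha> = \<beta>' and ?w0.0 = x0]
  have "based_homotopic (nsphere n) sph.x0 X x0 (sph.coaction_map \<beta>' ?\<alpha>) (sph.coaction_map ?\<alpha> \<beta>')"
  proof (rule sph.reparam_homotopic[OF a', where \<phi> = "\<lambda>t. max 0 (2 * t - 1)" and \<psi> = "\<lambda>t. min 1 (2 * t)"
        and \<phi>' = "\<lambda>t. min 1 (2 * t)" and \<psi>' = "\<lambda>t. max 0 (2 * t - 1)"])
    show "a' (sph.x0, e) = x0"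
      using a(4) \<beta>(3) by (simp add: a'_def)
    show "sph.coaction_map \<beta>' ?\<alpha> (case_sum (\<lambda>_. e) (sphere_susp n) (Inl y))
        = a' (case_sum (\<lambda>_. e) (sphere_susp n) (Inl y), e)" for y
      using sph.coaction_map_base[where f = \<beta>' and \<alpha> = ?\<alpha> and ?w0.0 = x0] a(4) \<beta>(3) \<beta>'c by (simp add: a'_def)
    show "sph.coaction_map ?\<alpha> \<beta>' (case_sum (\<lambda>_. e) (sphere_susp n) (Inl y))
        = a' (case_sum (\<lambda>_. e) (sphere_susp n) (Inl y), e)" for y
      using sph.coaction_map_base[where f = ?\<alpha> and \<alpha> = \<beta>' and ?w0.0 = x0] a(4) \<beta>(3) \<beta>'c by (simp add: a'_def)
    fix s t assume st: "s \<in> topspace (nsphere (n - 1))" "0 \<le> t" "t \<le> (1::real)"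
    show "sph.coaction_map \<beta>' ?\<alpha> (case_sum (\<lambda>_. e) (sphere_susp n) (Inr (s, t)))
        = a' (case_sum (\<lambda>_. e) (sphere_susp n) (Inr (s, max 0 (2 * t - 1))), sphere_susp n (s, min 1 (2 * t)))"
      using cm[of s t] st a(4) \<beta>'c(2) \<beta>(3)
      by (cases "t \<le> 1/2") (simp_all add: a'_def \<beta>'_def max_absorb1 max_absorb2 min_absorb1 min_absorb2)
    show "sph.coaction_map ?\<alpha> \<beta>' (case_sum (\<lambda>_. e) (sphere_susp n) (Inr (s, t)))
        = a' (case_sum (\<lambda>_. e) (sphere_susp n) (Inr (s, min 1 (2 * t))), sphere_susp n (s, max 0 (2 * t - 1)))"
      using cm'[of s t] st a(4) \<beta>'c(2) \<beta>(3)
      by (cases "t \<le> 1/2") (simp_all add: a'_def \<beta>'_def max_absorb1 max_absorb2 min_absorb1 min_absorb2)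
  qed (rule sph.reparam_intros)+
  then have "sphere_class (sph.coaction_map \<beta>' ?\<alpha>) = sphere_class (sph.coaction_map ?\<alpha> \<beta>')"
    by (intro homotopy_class_eqI) simp
  then show ?thesis
    unfolding a(3) B mult_sphere_class[OF a(5,4) \<beta>'c] mult_sphere_class[OF \<beta>'c a(5,4)] .
qed

section \<open>The Hurewicz homomorphism\<close>

lemma sph_pinch: "x \<in> topspace (nsphere n) \<Longrightarrow> sph.pinch x = x"
  by (cases x rule: susp_cases) (use sph.pinch(2) in auto)

text \<open>Homotopic representatives induce the same homomorphism, so \<open>the_elem\<close> is
  applied to a singleton.\<close>

lemma hurewicz_sphere_class:
  assumes "continuous_map (nsphere n) X \<alpha>" "\<alpha> e = x0"
  shows "hurewicz n X (sphere_class \<alpha>) = hom_induced (int n) (nsphere n) {} X {} \<alpha> (fundamental_class n)"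
proof -
  have "hom_induced (int n) (nsphere n) {} X {} a = hom_induced (int n) (nsphere n) {} X {} \<alpha>"
    if "a \<in> sphere_class \<alpha>" for a
    using homotopy_class_memD(1)[OF that] by (rule hom_induced_based_homotopic[symmetric])
  then have "(\<lambda>a. hom_induced (int n) (nsphere n) {} X {} a (fundamental_class n)) ` sphere_class \<alpha>
      = (\<lambda>a. hom_induced (int n) (nsphere n) {} X {} \<alpha> (fundamental_class n)) ` sphere_class \<alpha>"
    by (intro image_cong refl) metis
  also have "\<dots> = {hom_induced (int n) (nsphere n) {} X {} \<alpha> (fundamental_class n)}"
    unfolding image_constant_conv using homotopy_class_nonempty[where f = \<alpha>, OF assms] by (rule if_not_P)
  finally show ?thesis
    by (simp add: hurewicz_def)
qed

text \<open>The homology formula of the coaction on the sphere: there \<open>pinch\<close> is the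
  identity, the constant map is trivial as \<open>n \<ge> 1\<close>, and commutativity of homology
  absorbs the swapped order.\<close>

lemma hurewicz_hom: "group_hom \<pi> (homology_group (int n) X) (hurewicz n X)"
proof -
  let ?H = "homology_group (int n) X"
  interpret H: comm_group ?H
    by (rule abelian_homology_group)
  have "hurewicz n X \<in> hom \<pi> ?H"
  proof (rule homI)
    fix A assume "A \<in> carrier \<pi>"
    then obtain \<alpha> where \<alpha>: "A = sphere_class \<alpha>" "continuous_map (nsphere n) X \<alpha>" "\<alpha> e = x0"
      by (rule homotopy_group_carrierE)
    show "hurewicz n X A \<in> carrier ?H"
      unfolding \<alpha>(1) hurewicz_sphere_class[OF \<alpha>(2,3)] by (rule hom_induced_carrier)
    fix B assume "B \<in> carrier \<pi>"
    then obtain \<beta> where \<beta>: "B = sphere_class \<beta>" "continuous_map (nsphere n) X \<beta>" "\<beta> e = x0"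
      by (rule homotopy_group_carrierE)
    let ?i = "\<lambda>f. hom_induced (int n) (nsphere n) {} X {} f (fundamental_class n)"
    have i: "?i f \<in> carrier ?H" for f
      by (rule hom_induced_carrier)
    have k: "?i (\<lambda>_. x0) = \<one>\<^bsub>?H\<^esub>"
      using n by (intro hom_induced_const_trivial x0) simp
    have "hom_induced (int n) (nsphere n) {} X {} (\<alpha> \<circ> sph.pinch) = hom_induced (int n) (nsphere n) {} X {} \<alpha>"
      by (rule hom_induced_eq) (simp add: sph_pinch)
    then have "?i (sph.coaction_map \<beta> \<alpha>) \<otimes>\<^bsub>?H\<^esub> ?i (\<lambda>_. x0) = ?i \<beta> \<otimes>\<^bsub>?H\<^esub> ?i \<alpha>"
      using sph.hom_induced_coaction_map[where f = \<beta> and \<alpha> = \<alpha> and W = X and ?w0.0 = x0 and p = "int n"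
          and c = "fundamental_class n"] \<alpha> \<beta> fundamental_class_generates(1)[OF n] by simp
    then have "?i (sph.coaction_map \<beta> \<alpha>) = ?i \<alpha> \<otimes>\<^bsub>?H\<^esub> ?i \<beta>"
      unfolding k by (simp only: H.m_comm[OF i i] H.r_one[OF i])
    then show "hurewicz n X (A \<otimes>\<^bsub>\<pi>\<^esub> B) = hurewicz n X A \<otimes>\<^bsub>?H\<^esub> hurewicz n X B"
      using hurewicz_sphere_class[OF coaction_map_props[OF \<alpha>(2,3) \<beta>(2,3)]]
        hurewicz_sphere_class[OF \<alpha>(2,3)] hurewicz_sphere_class[OF \<beta>(2,3)]
      by (simp add: \<alpha>(1) \<beta>(1) mult_sphere_class[OF \<alpha>(2,3) \<beta>(2,3)])
  qed
  then show ?thesis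
    using group_homotopy_group H.group_axioms by (simp add: group_hom_def group_hom_axioms_def)
qed

end

section \<open>The mapping cone\<close>

locale based_cone =
  fixes n :: nat and Y :: "'a topology" and y0 :: 'a and \<gamma> :: "(nat \<Rightarrow> real) \<Rightarrow> 'a"
  assumes n: "n \<ge> 1" and y0: "y0 \<in> topspace Y"
    and \<gamma>: "continuous_map (nsphere (n - 1)) Y \<gamma>" "\<gamma> sphere_base = y0"
begin

abbreviation "X \<equiv> mapping_cone n Y y0 \<gamma>"
abbreviation "x0 \<equiv> (Inl y0 :: 'a + (nat \<Rightarrow> real) \<times> real)"

sublocale cone: cone_space n Y y0 \<gamma> X "cone_rep \<gamma> y0"
  by (rule cone_space_mapping_cone[OF n y0 \<gamma>])

lemma cone_x0 [simp]: "cone.x0 = x0"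
  by (simp add: cone.x0_def)

sublocale pointed_space n X x0
  using n cone.x0_in by unfold_locales simp_all

text \<open>Points are representatives under \<open>cone_rep\<close>, so collapsed ones reach
  \<open>coaction\<close> through the summand \<open>Y\<close>, where both sides reduce to
  \<open>f\<close>.\<close>

lemma coact_map_eq_coaction_map:
  assumes b: "f x0 = w0" "\<alpha> e = w0" and x: "x \<in> topspace X"
  shows "coact_map n y0 \<gamma> w0 f \<alpha> x = cone.coaction_map f \<alpha> x"
  using x
proof (cases x rule: cone.P_cases)
  case (Inl y)
  then show ?thesis
    using cone.coaction_map(1)[where f = f and \<alpha> = \<alpha> and ?w0.0 = w0, of y] b
    by (simp add: coact_map_def folding_def wedge_map_def coaction_def)
next
  case (Inr s t)
  note cm = cone.coaction_map(2,3)[where f = f and \<alpha> = \<alpha> and ?w0.0 = w0, of s t]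
  note base = cone.coaction_map_base[where f = f and \<alpha> = \<alpha> and ?w0.0 = w0]
  show ?thesis
  proof (cases "t = 0 \<or> s = e")
    case True
    then have "x = x0"
      using Inr(3) by auto
    then show ?thesis
      using base b by (simp add: coact_map_def folding_def wedge_map_def coaction_def)
  next
    case nz: False
    show ?thesis
    proof (cases "t = 1")
      case True
      then have x: "x = Inl (\<gamma> s)" "x = cone_rep \<gamma> y0 (Inl (\<gamma> s))"
        using Inr(3) nz by auto
      have "cone.coaction_map f \<alpha> x = f x"
        using cone.coaction_map(1)[where f = f and \<alpha> = \<alpha> and ?w0.0 = w0, of "\<gamma> s"] b cone.\<gamma>_in[OF Inr(1)] x
        by simp
      then show ?thesis
        by (simp add: x(1) coact_map_def folding_def wedge_map_def coaction_def)
    next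
      case False
      then have "x = Inr (s, t)"
        using Inr(3) nz by simp
      then show ?thesis
        using cm b Inr by (cases "t \<le> 1/2") (simp_all add: coact_map_def folding_def wedge_map_def coaction_def)
    qed
  qed
qed

lemma coact_homotopy_class:
  assumes f: "continuous_map X W f" "f x0 = w0" and \<alpha>: "continuous_map (nsphere n) W \<alpha>" "\<alpha> e = w0"
  shows "coact n Y y0 \<gamma> W w0 (homotopy_class X x0 W w0 f) (homotopy_class (nsphere n) e W w0 \<alpha>)
    = homotopy_class X x0 W w0 (cone.coaction_map f \<alpha>)"
  unfolding coact_def
proof (rule Union_homotopy_classes_eq)
  fix g \<beta> assume gb: "g \<in> homotopy_class X x0 W w0 f" "\<beta> \<in> homotopy_class (nsphere n) e W w0 \<alpha>"
  note g = homotopy_class_memD[OF gb(1)] and \<beta> = homotopy_class_memD[OF gb(2)]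
  have "homotopy_class X x0 W w0 (coact_map n y0 \<gamma> w0 g \<beta>) = homotopy_class X x0 W w0 (cone.coaction_map g \<beta>)"
  proof (rule homotopy_class_cong[symmetric])
    show "continuous_map X W (cone.coaction_map g \<beta>)"
      by (rule cone.continuous_coaction_map[where ?w0.0 = w0]) (simp_all add: g \<beta>)
    show "cone.coaction_map g \<beta> x0 = w0"
      using cone.coaction_map_base[where f = g and \<alpha> = \<beta> and ?w0.0 = w0] g \<beta> by simp
    show "cone.coaction_map g \<beta> x = coact_map n y0 \<gamma> w0 g \<beta> x" if "x \<in> topspace X" for x
      using coact_map_eq_coaction_map[where f = g and \<alpha> = \<beta> and ?w0.0 = w0] g(3) \<beta>(3) that by simp
  qed (rule x0)
  also have "\<dots> = homotopy_class X x0 W w0 (cone.coaction_map f \<alpha>)"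
    by (intro homotopy_class_eqI[symmetric] cone.coaction_map_homotopic[unfolded cone_x0] g \<beta>)
  finally show "homotopy_class X x0 W w0 (coact_map n y0 \<gamma> w0 g \<beta>)
    = homotopy_class X x0 W w0 (cone.coaction_map f \<alpha>)" .
qed (intro homotopy_class_nonempty f \<alpha>)+

abbreviation "\<iota> \<equiv> homotopy_class X x0 X x0 id"
abbreviation "\<Theta> \<equiv> coact n Y y0 \<gamma> X x0 \<iota>"

lemma coaction_id_props:
  assumes "continuous_map (nsphere n) X \<alpha>" "\<alpha> e = x0"
  shows "continuous_map X X (cone.coaction_map id \<alpha>)" "cone.coaction_map id \<alpha> x0 = x0"
    "\<Theta> (sphere_class \<alpha>) = homotopy_class X x0 X x0 (cone.coaction_map id \<alpha>)"
proof -
  show "continuous_map X X (cone.coaction_map id \<alpha>)"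
    by (rule cone.continuous_coaction_map[where ?w0.0 = x0]) (simp_all add: assms)
  show "cone.coaction_map id \<alpha> x0 = x0"
    using cone.coaction_map_base[where f = id and \<alpha> = \<alpha> and ?w0.0 = x0] assms by simp
  show "\<Theta> (sphere_class \<alpha>) = homotopy_class X x0 X x0 (cone.coaction_map id \<alpha>)"
    by (rule coact_homotopy_class) (simp_all add: assms)
qed

lemma \<Theta>_in_classes:
  assumes "A \<in> carrier \<pi>"
  shows "\<Theta> A \<in> homotopy_classes X x0 X x0"
proof -
  obtain \<alpha> where \<alpha>: "A = sphere_class \<alpha>" "continuous_map (nsphere n) X \<alpha>" "\<alpha> e = x0"
    using assms by (rule homotopy_group_carrierE)
  show ?thesis
    unfolding \<alpha>(1) coaction_id_props(3)[OF \<alpha>(2,3)] by (intro homotopy_class_in_classes coaction_id_props \<alpha>)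
qed

lemma \<Theta>_one: "\<Theta> \<one>\<^bsub>\<pi>\<^esub> = \<iota>"
proof -
  have "\<Theta> \<one>\<^bsub>\<pi>\<^esub> = homotopy_class X x0 X x0 (cone.coaction_map id (\<lambda>_. x0))"
    unfolding one_homotopy_group using x0 by (intro coaction_id_props(3)) auto
  also have "\<dots> = \<iota>"
    by (intro homotopy_class_eqI cone.coaction_map_const[unfolded cone_x0]) simp_all
  finally show ?thesis .
qed

end

locale based_cone_pinch_trivial = based_cone +
  assumes pinch_trivial: "\<And>\<beta>. \<lbrakk>continuous_map (nsphere n) X \<beta>; \<beta> e = x0\<rbrakk>
    \<Longrightarrow> based_homotopic (nsphere n) e (nsphere n) e (cone.pinch \<circ> \<beta>) (\<lambda>_. e)"
begin

text \<open>\<open>\<iota>\<^sup>\<alpha>\<close> is \<open>x \<mapsto> a (x, q x)\<close>, and \<open>q\<close> is trivial on the homotopy groups in question.\<close>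

lemma \<Theta>_acts_trivially:
  assumes A: "A \<in> Gottlieb n X x0" and i: "i \<le> n" and B: "B \<in> carrier (homotopy_group i X x0)"
  shows "homotopy_induced i X x0 (\<Theta> A) B = B"
proof -
  obtain a where a: "continuous_map (prod_topology X (nsphere n)) X a"
      "based_homotopic X x0 X x0 (\<lambda>x. a (x, e)) id" "A = sphere_class (\<lambda>s. a (x0, s))"
      "a (x0, e) = x0" "continuous_map (nsphere n) X (\<lambda>s. a (x0, s))"
    using A by (rule GottliebE)
  let ?\<alpha> = "\<lambda>s. a (x0, s)"
  let ?i = "nsphere i"
  obtain \<beta> where \<beta>: "B = homotopy_class ?i e X x0 \<beta>" "continuous_map ?i X \<beta>" "\<beta> e = x0"
    using B homotopy_classesE[of B ?i e X x0] by (auto simp: homotopy_group_def)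
  have "based_homotopic ?i e (nsphere n) e (cone.pinch \<circ> \<beta>) (\<lambda>_. e)"
  proof (cases "i = n")
    case True
    then show ?thesis
      using pinch_trivial[of \<beta>] \<beta> by simp
  next
    case False
    have "continuous_map ?i (nsphere n) (cone.pinch \<circ> \<beta>)"
      by (rule continuous_map_compose[OF \<beta>(2) cone.continuous_pinch])
    then show ?thesis
      using False i \<beta>(3) cone.pinch_base by (intro homotopic_const_lower_nsphere) auto
  qed
  then obtain N where N: "continuous_map (prod_topology unit_interval ?i) (nsphere n) N"
      "\<And>z. N (0, z) = cone.pinch (\<beta> z)" "\<And>z. N (1, z) = e" "\<And>\<tau>. \<tau> \<in> {0..1} \<Longrightarrow> N (\<tau>, e) = e"
    unfolding homotopic_with_def by auto
  \<comment> \<open>The null-homotopy \<open>N\<close> is inserted in the sphere variable while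
    \<beta> stays put.\<close>
  define K where "K = (\<lambda>p. a (\<beta> (snd p), N p))"
  have "continuous_map (prod_topology unit_interval ?i) X K"
    unfolding K_def
    by (intro continuous_map_compose[OF _ a(1), unfolded o_def] continuous_map_pairedI N(1)
        continuous_map_compose[OF continuous_map_snd \<beta>(2), unfolded o_def])
  then have 2: "based_homotopic ?i e X x0 (\<lambda>z. a (\<beta> z, cone.pinch (\<beta> z))) (\<lambda>z. a (\<beta> z, e))"
    unfolding homotopic_with_def
    by (intro exI[of _ K]) (simp add: K_def N(2,3,4) \<beta>(3) a(4) del: atLeastAtMost_iff)
  have "based_homotopic X x0 X x0 (\<lambda>x. a (x, cone.pinch x)) (cone.coaction_map (\<lambda>x. a (x, e)) ?\<alpha>)"
    using cone.coaction_map_axes[where a = a and W = X and ?w0.0 = x0] a by simp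
  moreover have "based_homotopic X x0 X x0 (cone.coaction_map (\<lambda>x. a (x, e)) ?\<alpha>) (cone.coaction_map id ?\<alpha>)"
    using a by (intro cone.coaction_map_homotopic[unfolded cone_x0]) simp_all
  ultimately have "based_homotopic X x0 X x0 (\<lambda>x. a (x, cone.pinch x)) (cone.coaction_map id ?\<alpha>)"
    by (rule homotopic_with_trans)
  then have "based_homotopic ?i e X x0 ((\<lambda>x. a (x, cone.pinch x)) \<circ> \<beta>) (cone.coaction_map id ?\<alpha> \<circ> \<beta>)"
    using \<beta> by (intro homotopic_with_compose_continuous_map_right[OF _ \<beta>(2)]) simp_all
  from homotopic_with_symD[OF this]
  have 1: "based_homotopic ?i e X x0 (cone.coaction_map id ?\<alpha> \<circ> \<beta>) (\<lambda>z. a (\<beta> z, cone.pinch (\<beta> z)))"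
    by (simp add: o_def)
  have 3: "based_homotopic ?i e X x0 (\<lambda>z. a (\<beta> z, e)) \<beta>"
    using homotopic_with_compose_continuous_map_right[OF a(2) \<beta>(2), of "\<lambda>h. h e = x0"] \<beta>(3) by (simp add: o_def)
  have "homotopy_induced i X x0 (\<Theta> A) B = homotopy_class ?i e X x0 (cone.coaction_map id ?\<alpha> \<circ> \<beta>)"
    unfolding a(3) \<beta>(1) coaction_id_props(3)[OF a(5,4)]
    by (intro class_comp_homotopy_class coaction_id_props \<beta> a)
  also have "\<dots> = B"
    unfolding \<beta>(1) by (rule homotopy_class_eqI[OF homotopic_with_trans[OF 1 homotopic_with_trans[OF 2 3]]])
  finally show ?thesis .
qed

lemma \<Theta>_mult:
  assumes A: "A \<in> Gottlieb n X x0" and B: "B \<in> carrier \<pi>"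
  shows "class_comp X x0 X x0 (\<Theta> A) (\<Theta> B) = \<Theta> (A \<otimes>\<^bsub>\<pi>\<^esub> B)"
proof -
  obtain \<alpha> where \<alpha>: "A = sphere_class \<alpha>" "continuous_map (nsphere n) X \<alpha>" "\<alpha> e = x0"
    using Gottlieb_carrier[OF A] by (rule homotopy_group_carrierE)
  obtain \<beta> where \<beta>: "B = sphere_class \<beta>" "continuous_map (nsphere n) X \<beta>" "\<beta> e = x0"
    using B by (rule homotopy_group_carrierE)
  define f g where "f = cone.coaction_map id \<alpha>" and "g = cone.coaction_map id \<beta>"
  note f = coaction_id_props[OF \<alpha>(2,3), folded f_def] and g = coaction_id_props[OF \<beta>(2,3), folded g_def]
  have "sphere_class (f \<circ> \<beta>) = sphere_class \<beta>"
    using \<Theta>_acts_trivially[OF A order_refl B] class_comp_homotopy_class[where f = f and a = \<beta> and X = "nsphere n" and ?x0.0 = e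
        and V = X and ?v0.0 = x0 and W = X and ?w0.0 = x0] f(1,2) \<beta>(2,3)
    by (simp add: \<alpha>(1) \<beta>(1) f(3))
  then have f\<beta>: "based_homotopic (nsphere n) e X x0 (f \<circ> \<beta>) \<beta>"
    by (rule homotopy_class_eqD) (simp_all add: \<beta>)
  \<comment> \<open>The two maps agree pointwise: composing with \<open>f\<close> commutes with the
    case distinction that defines the coaction.\<close>
  have fg: "homotopy_class X x0 X x0 (f \<circ> g) = homotopy_class X x0 X x0 (cone.coaction_map f (f \<circ> \<beta>))"
  proof (rule homotopy_class_cong)
    show "continuous_map X X (f \<circ> g)" "(f \<circ> g) x0 = x0"
      using f g by (auto intro: continuous_map_compose)
    note cg = cone.coaction_map[where f = id and \<alpha> = \<beta> and ?w0.0 = x0, folded g_def]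
    note cfb = cone.coaction_map[where f = f and \<alpha> = "f \<circ> \<beta>" and ?w0.0 = x0]
    fix x assume "x \<in> topspace X"
    then show "(f \<circ> g) x = cone.coaction_map f (f \<circ> \<beta>) x"
    proof (cases x rule: cone.P_cases)
      case (Inl y)
      have "g x = x" "cone.coaction_map f (f \<circ> \<beta>) x = f x"
        unfolding Inl(2) using cg(1)[of y] cfb(1)[of y] Inl(1) f(2) \<beta>(3) by simp_all
      then show ?thesis
        by simp
    next
      case (Inr s t)
      show ?thesis
      proof (cases "t \<le> 1/2")
        case True
        have "g x = \<beta> (sphere_susp n (s, 2 * t))" "cone.coaction_map f (f \<circ> \<beta>) x = f (\<beta> (sphere_susp n (s, 2 * t)))"
          unfolding Inr(3) using cg(2)[of s t] cfb(2)[of s t] Inr(1,2) True f(2) \<beta>(3)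
          by (simp_all del: cone_rep.simps)
        then show ?thesis
          by simp
      next
        case False
        have "g x = cone_rep \<gamma> y0 (Inr (s, 2 * t - 1))"
            "cone.coaction_map f (f \<circ> \<beta>) x = f (cone_rep \<gamma> y0 (Inr (s, 2 * t - 1)))"
          unfolding Inr(3) using cg(3)[of s t] cfb(3)[of s t] Inr(1,2) False f(2) \<beta>(3)
          by (simp_all del: cone_rep.simps)
        then show ?thesis
          by simp
      qed
    qed
  qed (rule x0)
  have "based_homotopic X x0 X x0 (cone.coaction_map f (f \<circ> \<beta>)) (cone.coaction_map f \<beta>)"
    using f by (intro cone.coaction_map_homotopic[unfolded cone_x0] f\<beta>) simp
  moreover have "based_homotopic X x0 X x0 (cone.coaction_map f \<beta>) (cone.coaction_map id (sph.coaction_map \<alpha> \<beta>))"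
    unfolding f_def
    using \<alpha> \<beta> coaction_map_props[OF \<beta>(2,3) \<alpha>(2,3)] sph.coaction_map(2,3)[where f = \<alpha> and \<alpha> = \<beta> and ?w0.0 = x0]
    by (intro cone.coaction_map_assoc[unfolded cone_x0]) simp_all
  ultimately have "homotopy_class X x0 X x0 (cone.coaction_map f (f \<circ> \<beta>))
      = homotopy_class X x0 X x0 (cone.coaction_map id (sph.coaction_map \<alpha> \<beta>))"
    by (rule homotopy_class_eqI[OF homotopic_with_trans])
  also have "\<dots> = \<Theta> (sphere_class (sph.coaction_map \<alpha> \<beta>))"
    by (rule coaction_id_props(3)[symmetric, OF coaction_map_props[OF \<beta>(2,3) \<alpha>(2,3)]])
  \<comment> \<open>The outer coaction contributes the first summand, hence the order
    \<open>B\<close>, \<open>A\<close>; it is reversed because \<open>A\<close> is a Gottlieb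
    element.\<close>
  also have "sphere_class (sph.coaction_map \<alpha> \<beta>) = B \<otimes>\<^bsub>\<pi>\<^esub> A"
    unfolding \<alpha>(1) \<beta>(1) by (rule mult_sphere_class[symmetric, OF \<beta>(2,3) \<alpha>(2,3)])
  also have "B \<otimes>\<^bsub>\<pi>\<^esub> A = A \<otimes>\<^bsub>\<pi>\<^esub> B"
    by (rule Gottlieb_commute[symmetric, OF A B])
  finally have "homotopy_class X x0 X x0 (cone.coaction_map f (f \<circ> \<beta>)) = \<Theta> (A \<otimes>\<^bsub>\<pi>\<^esub> B)" .
  moreover have "class_comp X x0 X x0 (\<Theta> A) (\<Theta> B) = homotopy_class X x0 X x0 (f \<circ> g)"
    unfolding \<alpha>(1) \<beta>(1) f(3) g(3) by (intro class_comp_homotopy_class f g)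
  ultimately show ?thesis
    using fg by (simp only:)
qed

lemma \<Theta>_in_sharp:
  assumes A: "A \<in> Gottlieb n X x0"
  shows "\<Theta> A \<in> self_equivs_sharp n X x0"
proof -
  interpret G: group \<pi>
    by (rule group_homotopy_group)
  have Ac: "A \<in> carrier \<pi>" and Ai: "inv\<^bsub>\<pi>\<^esub> A \<in> Gottlieb n X x0" "inv\<^bsub>\<pi>\<^esub> A \<in> carrier \<pi>"
    using Gottlieb_carrier A subgroup.m_inv_closed[OF Gottlieb_subgroup A] by auto
  have "class_comp X x0 X x0 (\<Theta> A) (\<Theta> (inv\<^bsub>\<pi>\<^esub> A)) = \<iota>"
      "class_comp X x0 X x0 (\<Theta> (inv\<^bsub>\<pi>\<^esub> A)) (\<Theta> A) = \<iota>"
    using \<Theta>_mult[OF A Ai(2)] \<Theta>_mult[OF Ai(1) Ac] G.r_inv[OF Ac] G.l_inv[OF Ac] \<Theta>_one by simp_all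
  then have "\<Theta> A \<in> carrier (self_equivs X x0)"
    using \<Theta>_in_classes[OF Ac] \<Theta>_in_classes[OF Ai(2)] by (auto simp: self_equivs_def)
  then show ?thesis
    using \<Theta>_acts_trivially[OF A] by (simp add: self_equivs_sharp_def)
qed

text \<open>With \<open>k\<close> the image of \<open>c\<close> under the constant map, the homology
  formula reads \<open>f_* c + k = c + \<alpha>_* q_* c\<close>, and the last term equals
  \<open>k\<close> again. Cancelling works in every degree, 0 included.\<close>

lemma \<Theta>_in_star:
  assumes A: "A \<in> Gottlieb n X x0" and h: "hurewicz n X A = \<one>\<^bsub>homology_group (int n) X\<^esub>"
  shows "\<Theta> A \<in> self_equivs_star X x0"
proof -
  obtain \<alpha> where \<alpha>: "A = sphere_class \<alpha>" "continuous_map (nsphere n) X \<alpha>" "\<alpha> e = x0"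
    using Gottlieb_carrier[OF A] by (rule homotopy_group_carrierE)
  note f = coaction_id_props[OF \<alpha>(2,3)]
  have "hom_induced p X {} X {} (cone.coaction_map id \<alpha>) c = c" if c: "c \<in> carrier (homology_group p X)" for p c
  proof -
    let ?H = "homology_group p X"
    let ?k = "hom_induced p X {} X {} (\<lambda>_. x0) c"
    interpret H: group ?H
      by simp
    have "hom_induced p X {} X {} (cone.coaction_map id \<alpha>) c \<otimes>\<^bsub>?H\<^esub> ?k
        = c \<otimes>\<^bsub>?H\<^esub> hom_induced p X {} X {} (\<alpha> \<circ> cone.pinch) c"
      using cone.hom_induced_coaction_map[where f = id and \<alpha> = \<alpha> and W = X and ?w0.0 = x0 and p = p and c = c] \<alpha> c
      by (simp add: hom_induced_id)
    also have "hom_induced p X {} X {} (\<alpha> \<circ> cone.pinch) c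
        = hom_induced p (nsphere n) {} X {} \<alpha> (hom_induced p X {} (nsphere n) {} cone.pinch c)"
      using cone.continuous_pinch \<alpha>(2) by (simp add: hom_induced_compose_empty)
    also have "\<dots> = hom_induced p (nsphere n) {} X {} (\<lambda>_. x0) (hom_induced p X {} (nsphere n) {} cone.pinch c)"
      using h hurewicz_sphere_class[OF \<alpha>(2,3)]
      by (intro hom_induced_nsphere_eq_const[OF n \<alpha>(2,3)] hom_induced_carrier) (simp add: \<alpha>(1))
    also have "\<dots> = ?k"
      using cone.continuous_pinch x0 by (subst hom_induced_compose') (auto simp: o_def)
    finally show ?thesis
      using H.right_cancel[OF hom_induced_carrier hom_induced_carrier c] by blast
  qed
  moreover have "\<Theta> A \<in> carrier (self_equivs X x0)"
    using \<Theta>_in_sharp[OF A] by (simp add: self_equivs_sharp_def)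
  ultimately show ?thesis
    using homotopy_class_in_self_equivs_star_iff[where f = "cone.coaction_map id \<alpha>" and X = X and ?x0.0 = x0] f
    by (simp add: \<alpha>(1))
qed

end

theorem theorem2p3:
  fixes n :: nat
    and Y :: "'a topology" and y0 :: 'a and \<gamma> :: "(nat \<Rightarrow> real) \<Rightarrow> 'a"
    and X :: "('a + (nat \<Rightarrow> real) \<times> real) topology" and x0 :: "'a + (nat \<Rightarrow> real) \<times> real"
    and q :: "('a + (nat \<Rightarrow> real) \<times> real \<Rightarrow> nat \<Rightarrow> real) set"
    and \<Theta> :: "((nat \<Rightarrow> real) \<Rightarrow> 'a + (nat \<Rightarrow> real) \<times> real) set
             \<Rightarrow> ('a + (nat \<Rightarrow> real) \<times> real \<Rightarrow> 'a + (nat \<Rightarrow> real) \<times> real) set"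
  assumes n: "n \<ge> 1"
    and Y: "finite_type_CW Y" "y0 \<in> topspace Y"
    and \<gamma>: "continuous_map (nsphere (n - 1)) Y \<gamma>" "\<gamma> sphere_base = y0"
    and X_def: "X = mapping_cone n Y y0 \<gamma>" and x0_def: "x0 = Inl y0"
    and q_def: "q = homotopy_class X x0 (nsphere n) sphere_base (cone_pinch n)"
    and \<Theta>_def: "\<Theta> = (\<lambda>A. coact n Y y0 \<gamma> X x0 (homotopy_class X x0 X x0 id) A)"
    and X_CW: "finite_type_CW_dim n X"
    and X_1conn: "one_connected X x0"
    and q_zero: "\<And>A. A \<in> carrier (homotopy_group n X x0) \<Longrightarrow>
        homotopy_induced n (nsphere n) sphere_base q A
          = \<one>\<^bsub>homotopy_group n (nsphere n) sphere_base\<^esub>"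
  shows "group_hom
           ((homotopy_group n X x0)\<lparr>carrier := Gottlieb n X x0\<rparr>)
           ((self_equivs X x0)\<lparr>carrier := self_equivs_sharp n X x0\<rparr>)
           \<Theta>
       \<and> group_hom
           ((homotopy_group n X x0)\<lparr>carrier := Gottlieb n X x0 \<inter>
              kernel (homotopy_group n X x0) (homology_group (int n) X) (hurewicz n X)\<rparr>)
           ((self_equivs X x0)\<lparr>carrier := self_equivs_star X x0 \<inter> self_equivs_sharp n X x0\<rparr>)
           \<Theta>"
proof -
  interpret C: based_cone n Y y0 \<gamma>
    using n Y(2) \<gamma> by unfold_locales
  interpret C: based_cone_pinch_trivial n Y y0 \<gamma>
  proof
    let ?e = "sphere_base :: nat \<Rightarrow> real"
    fix \<beta> assume \<beta>: "continuous_map (nsphere n) (mapping_cone n Y y0 \<gamma>) \<beta>" "\<beta> ?e = Inl y0"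
    \<comment> \<open>The two versions of the pinching map are compared on the points of the space
      only, which is enough for them to have the same class.\<close>
    have "homotopy_class X x0 (nsphere n) ?e C.cone.pinch = q"
      unfolding q_def X_def x0_def
    proof (rule homotopy_class_cong[OF C.cone.continuous_pinch])
      show "C.cone.pinch (Inl y0) = ?e"
        using C.cone.pinch_base by simp
      fix x assume x: "x \<in> topspace (mapping_cone n Y y0 \<gamma>)"
      then show "C.cone.pinch x = cone_pinch n x"
      proof (cases x rule: C.cone.P_cases)
        case (Inl y)
        then show ?thesis
          using C.cone.pinch(1)[of y] by (simp add: cone_pinch_def)
      next
        case (Inr s t)
        then have "C.cone.pinch x = sphere_susp n (s, t)"
          using C.cone.pinch(2)[of s t] by simp
        then show ?thesis
          unfolding Inr(3) by (auto simp: cone_pinch_def)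
      qed
    qed (rule C.x0)
    then have "homotopy_class (nsphere n) ?e (nsphere n) ?e (C.cone.pinch \<circ> \<beta>)
        = homotopy_induced n (nsphere n) ?e q (homotopy_class (nsphere n) ?e X x0 \<beta>)"
      using class_comp_homotopy_class[where f = C.cone.pinch and a = \<beta> and X = "nsphere n" and ?x0.0 = ?e
          and V = C.X and ?v0.0 = "Inl y0" and W = "nsphere n" and ?w0.0 = ?e] C.cone.continuous_pinch \<beta> C.cone.pinch_base
      by (simp add: X_def x0_def)
    also have "\<dots> = homotopy_class (nsphere n) ?e (nsphere n) ?e (\<lambda>_. ?e)"
      using q_zero[of "homotopy_class (nsphere n) ?e X x0 \<beta>"] \<beta>
      by (simp add: homotopy_group_def homotopy_class_in_classes X_def x0_def)
    finally show "based_homotopic (nsphere n) ?e (nsphere n) ?e (C.cone.pinch \<circ> \<beta>) (\<lambda>_. ?e)"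
      by (rule homotopy_class_eqD) auto
  qed
  let ?\<pi> = "homotopy_group n X x0" and ?E = "self_equivs X x0"
  let ?G = "Gottlieb n X x0" and ?K = "kernel ?\<pi> (homology_group (int n) X) (hurewicz n X)"
  interpret E: group ?E
    by (rule group_self_equivs)
  interpret P: group ?\<pi>
    unfolding X_def x0_def by (rule C.group_homotopy_group)
  have G: "subgroup ?G ?\<pi>"
    unfolding X_def x0_def by (rule C.Gottlieb_subgroup)
  have K: "subgroup ?K ?\<pi>"
    unfolding X_def x0_def by (rule group_hom.subgroup_kernel[OF C.hurewicz_hom])
  have sharp: "\<Theta> A \<in> self_equivs_sharp n X x0" if "A \<in> ?G" for A
    using C.\<Theta>_in_sharp that by (simp add: \<Theta>_def X_def x0_def)
  have star: "\<Theta> A \<in> self_equivs_star X x0" if "A \<in> ?G \<inter> ?K" for A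
    using C.\<Theta>_in_star[of A] that by (simp add: \<Theta>_def X_def x0_def kernel_def)
  have mult: "\<Theta> (A \<otimes>\<^bsub>?\<pi>\<^esub> B) = \<Theta> A \<otimes>\<^bsub>?E\<^esub> \<Theta> B" if "A \<in> ?G" "B \<in> ?G" for A B
    using C.\<Theta>_mult[of A B] that C.Gottlieb_carrier[of B]
    by (simp add: \<Theta>_def X_def x0_def self_equivs_simps)
  show ?thesis
  proof
    show "group_hom (?\<pi>\<lparr>carrier := ?G\<rparr>) (?E\<lparr>carrier := self_equivs_sharp n X x0\<rparr>) \<Theta>"
      unfolding group_hom_def group_hom_axioms_def
      using P.subgroup_imp_group[OF G] E.subgroup_imp_group[OF self_equivs_sharp_subgroup] sharp mult
      by (auto simp: hom_def)
    show "group_hom (?\<pi>\<lparr>carrier := ?G \<inter> ?K\<rparr>)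
        (?E\<lparr>carrier := self_equivs_star X x0 \<inter> self_equivs_sharp n X x0\<rparr>) \<Theta>"
      unfolding group_hom_def group_hom_axioms_def
      using P.subgroup_imp_group[OF P.subgroups_Inter_pair[OF G K]]
        E.subgroup_imp_group[OF E.subgroups_Inter_pair[OF self_equivs_star_subgroup self_equivs_sharp_subgroup]]
        sharp star mult
      by (auto simp: hom_def)
  qed
qed

end
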